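(* Let $\Omega \subset \mathbb{R}^d$, $d \geq 2$, be a bounded, convex, and smooth domain, $\theta \in (0 , \pi)$, $\mu \in (-1 , \sqrt{2} - 1)$, and let $\mathcal{Q}$ be a cube with $\mathcal{Q} \cap \Omega \neq \emptyset$ and diameter $R > 0$. Then there exists $C > 0$ depending only on $d$, $\mu$, and $\theta$ such that for all $\lambda \in \mathrm{S}_\theta$ all smooth functions (smooth up to the boundary) $u : (2 \mathcal{Q}) \cap \Omega \to \mathbb{C}^d$ and $\phi : (2 \mathcal{Q}) \cap \Omega \to \mathbb{C}$ solving $$\lambda u - \Delta u + \nabla \phi = 0 \quad\text{and}\quad \operatorname{div}(u) = 0 \quad \text{in } (2 \mathcal{Q}) \cap \Omega$$ and which satisfy $\{ D u + \mu [D u]^{\top} \} n - \phi n = 0$ on $(2 \mathcal{Q}) \cap \partial \Omega$ satisfy $$\lvert \lambda \rvert \int_{\mathcal{Q} \cap \Omega} \lvert \nabla u \rvert^2 \, dx + \int_{\mathcal{Q} \cap \Omega} \lvert \nabla^2 u \rvert^2 \, dx + \int_{\mathcal{Q} \cap \Omega} \lvert \nabla \phi \rvert^2 \, dx \leq C \bigg(\lvert \lambda \rvert^2 \int_{(2 \mathcal{Q}) \cap \Omega} \lvert u \rvert^2 \, dx + \frac{1}{R^2} \int_{(2 \mathcal{Q}) \cap \Omega} \big( \lvert \nabla u \rvert^2 + \lvert \phi \rvert^2 \big) \, dx \bigg).$$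
   Context: Sector: $\mathrm{S}_{\theta} := \{ z \in \mathbb{C} \setminus \{0\} : \lvert \arg(z) \rvert < \theta \}$ for $\theta \in (0,\pi)$. A cube is a non-degenerate open cube in $\mathbb{R}^d$ with sides parallel to the coordinate axes; $2\mathcal{Q}$ is the cube with the same center and twice the diameter. $n$ is the outward unit normal to $\Omega$, $Du$ the Jacobi matrix of $u$; the $\beta$-th component of the boundary condition is $n_k \partial_k u_\beta + \mu n_k \partial_\beta u_k - \phi n_\beta = 0$ (summation over repeated indices). *)

theory Defs
  imports "HOL-Analysis.Analysis"
begin

definition sector :: "real \<Rightarrow> complex set" where
  "sector \<theta> = {z. z \<noteq> 0 \<and> \<bar>Arg z\<bar> < \<theta>}"

text \<open>The open axis-parallel cube with centre \<open>c\<close> and side length \<open>2 * h\<close>. The cube with the same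
  centre and twice the diameter is \<open>cube c (2 * h)\<close>.\<close>

definition cube :: "real^'n \<Rightarrow> real \<Rightarrow> (real^'n) set" where
  "cube c h = box (c - vec h) (c + vec h)"

definition pd :: "'n \<Rightarrow> (real^'n \<Rightarrow> 'b::real_normed_vector) \<Rightarrow> real^'n \<Rightarrow> 'b" where
  "pd i f x = vector_derivative (\<lambda>t. f (x + t *\<^sub>R axis i 1)) (at 0)"

primrec pds :: "'n list \<Rightarrow> (real^'n \<Rightarrow> 'b::real_normed_vector) \<Rightarrow> real^'n \<Rightarrow> 'b" where
  "pds [] f = f"
| "pds (i # is) f = pd i (pds is f)"

text \<open>This is the class of infinitely differentiable functions when \<open>S\<close> is open, the only case in
  which it is used.\<close>

definition smooth_on :: "(real^'n) set \<Rightarrow> (real^'n \<Rightarrow> 'b::real_normed_vector) \<Rightarrow> bool" where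
  "smooth_on S f \<longleftrightarrow> (\<forall>is. pds is f differentiable_on S)"

text \<open>\<open>D\<close> is open and \<open>D \<subseteq> E \<subseteq> closure D\<close>: every partial derivative of \<open>f\<close>, of any order, extends
  continuously from \<open>D\<close> to \<open>E\<close>. Nothing is said about the values of \<open>f\<close> outside \<open>D\<close>.\<close>

definition smooth_up_to ::
  "(real^'n) set \<Rightarrow> (real^'n) set \<Rightarrow> (real^'n \<Rightarrow> 'b::real_normed_vector) \<Rightarrow> bool" where
  "smooth_up_to D E f \<longleftrightarrow> smooth_on D f \<and>
     (\<forall>is. \<exists>g. continuous_on E g \<and> (\<forall>x\<in>D. g x = pds is f x))"

text \<open>The value at a boundary point \<open>x\<close> of \<open>D\<close> of the continuous extension of \<open>f\<close>.\<close>

definition boundary_value ::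
  "(real^'n) set \<Rightarrow> (real^'n \<Rightarrow> 'b::real_normed_vector) \<Rightarrow> real^'n \<Rightarrow> 'b" where
  "boundary_value D f x = Lim (at x within D) f"

definition grad :: "(real^'n \<Rightarrow> 'b::real_normed_vector) \<Rightarrow> real^'n \<Rightarrow> 'b^'n" where
  "grad f x = (\<chi> i. pd i f x)"

definition laplacian :: "(real^'n \<Rightarrow> 'b::real_normed_vector) \<Rightarrow> real^'n \<Rightarrow> 'b" where
  "laplacian f x = (\<Sum>k\<in>UNIV. pd k (pd k f) x)"

definition divergence :: "(real^'n \<Rightarrow> 'b::real_normed_vector^'n) \<Rightarrow> real^'n \<Rightarrow> 'b" where
  "divergence u x = (\<Sum>k\<in>UNIV. pd k u x $ k)"

text \<open>Row \<open>\<beta>\<close>, column \<open>k\<close> holds the derivative of component \<open>\<beta>\<close> in direction \<open>k\<close>. The norm of a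
  matrix in \<open>'b^'n^'m\<close> is the Frobenius norm.\<close>

definition jacobi :: "(real^'n \<Rightarrow> 'b::real_normed_vector^'m) \<Rightarrow> real^'n \<Rightarrow> 'b^'n^'m" where
  "jacobi u x = (\<chi> \<beta> k. pd k u x $ \<beta>)"

definition local_defining_function ::
  "(real^'n) set \<Rightarrow> real^'n \<Rightarrow> (real^'n) set \<Rightarrow> (real^'n \<Rightarrow> real) \<Rightarrow> bool" where
  "local_defining_function \<Omega> x U \<rho> \<longleftrightarrow>
     open U \<and> x \<in> U \<and> smooth_on U \<rho> \<and> (\<forall>y\<in>U. grad \<rho> y \<noteq> 0) \<and> \<Omega> \<inter> U = {y\<in>U. \<rho> y < 0}"

definition smooth_domain :: "(real^'n) set \<Rightarrow> bool" where
  "smooth_domain \<Omega> \<longleftrightarrow> open \<Omega> \<and> connected \<Omega> \<and> \<Omega> \<noteq> {} \<and>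
     (\<forall>x\<in>frontier \<Omega>. \<exists>U \<rho>. local_defining_function \<Omega> x U \<rho>)"

text \<open>At a point \<open>x\<close> of the boundary of a smooth domain there is exactly one such \<open>\<nu>\<close>: the
  normalised gradient does not depend on the choice of the defining function, and it points
  outward because the defining function is negative inside.\<close>

definition outward_unit_normal :: "(real^'n) set \<Rightarrow> real^'n \<Rightarrow> real^'n \<Rightarrow> bool" where
  "outward_unit_normal \<Omega> x \<nu> \<longleftrightarrow>
     (\<exists>U \<rho>. local_defining_function \<Omega> x U \<rho> \<and> \<nu> = grad \<rho> x /\<^sub>R norm (grad \<rho> x))"

definition complex_vec :: "real^'n \<Rightarrow> complex^'n" where
  "complex_vec v = (\<chi> i. complex_of_real (v $ i))"

text \<open>\<open>{Du + \<mu> [Du]\<^sup>T} n - \<phi> n = 0\<close> at the boundary point \<open>x\<close> of \<open>D\<close>, with \<open>\<nu>\<close> the normal at \<open>x\<close>.\<close>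

definition neumann_condition ::
  "real \<Rightarrow> (real^'n) set \<Rightarrow> (real^'n \<Rightarrow> complex^'n) \<Rightarrow> (real^'n \<Rightarrow> complex) \<Rightarrow>
     real^'n \<Rightarrow> real^'n \<Rightarrow> bool" where
  "neumann_condition \<mu> D u \<phi> \<nu> x \<longleftrightarrow>
     (let J = boundary_value D (jacobi u) x; p = boundary_value D \<phi> x; N = complex_vec \<nu>
      in (J + \<mu> *\<^sub>R transpose J) *v N - p *s N = 0)"

end

theory Submission
  imports Defs
begin

text \<open>
  Let \<open>T = Du + \<mu> [Du]\<^sup>T - \<phi> I\<close> be the stress. As \<open>u\<close> is divergence free, the equation says that the
  rows of \<open>T\<close> satisfy \<open>div T\<^sub>b = \<lambda> u\<^sub>b\<close>, and the boundary condition says that every row is tangent to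
  the boundary. For a field \<open>v\<close> tangent to the boundary of a convex set, integration by parts gives
  \<open>\<integral> \<partial>\<^sub>j v\<^sub>k \<partial>\<^sub>k v\<^sub>j \<le> \<integral> (div v)\<^sup>2\<close>: the two sides differ by the boundary integral of the second
  fundamental form, which has a sign. Applied to the rows of \<open>T\<close>, the right-hand side is
  \<open>\<integral> |\<lambda> u|\<^sup>2\<close>, and the left-hand side expands (\<open>stress_derivative_identity\<close>) to
  \<open>|\<nabla>\<^sup>2u|\<^sup>2 + (2\<mu> + \<mu>\<^sup>2) \<partial>\<^sub>j\<partial>\<^sub>k u\<^sub>b \<partial>\<^sub>b\<partial>\<^sub>k u\<^sub>j + (1 - 2\<mu>) |\<nabla>\<phi>|\<^sup>2\<close> up to a term containing \<open>\<lambda> u\<close>. For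
  \<open>-1 < \<mu> < sqrt 2 - 1\<close> both \<open>|2\<mu> + \<mu>\<^sup>2| < 1\<close> and \<open>1 - 2\<mu> > 0\<close>, so it controls \<open>\<nabla>\<^sup>2u\<close> and \<open>\<nabla>\<phi>\<close>. The
  bound for \<open>|\<lambda>| |\<nabla>u|\<^sup>2\<close> comes from testing the equation with \<open>|\<lambda>| u\<close>.

  Both integrations by parts are the statement that one real vector field, a cutoff \<open>w\<close> times the
  \<open>flux\<close>, has a divergence with nonpositive integral. The pointwise estimate
  \<open>flux_divergence_lower_bound\<close> bounds this divergence from below by the quantities to be estimated
  minus the data. The derivatives of \<open>w\<close> are absorbed because \<open>|\<nabla>w|\<^sup>2\<close> is at most a constant times
  \<open>w / h\<^sup>2\<close>, where \<open>2 h\<close> is the side length of the cube.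

  No surface integral is formed. If the normal component of a field \<open>W\<close> is nonpositive on the
  boundary of a bounded convex set, then \<open>x \<mapsto> x + t W x\<close> maps the set into a dilation of itself by
  \<open>1 + o(t)\<close>; comparing volumes to first order in \<open>t\<close> gives \<open>\<integral> div W \<le> 0\<close>
  (\<open>integral_divergence_le_0\<close>). The sign of the normal component of the flux is a statement about
  single boundary points (\<open>tangent_field_second_fundamental_form\<close>), which follows from the
  convexity of the domain and the uniqueness of its supporting planes.
\<close>

section \<open>The volume of the image of a perturbed identity\<close>

lemma abs_entry_le_norm:
  fixes A :: "real^'n^'m"
  shows "\<bar>A $ i $ j\<bar> \<le> norm A"
  by (metis component_le_norm_cart Finite_Cartesian_Product.norm_nth_le order_trans real_norm_def)

lemma prod_one_plus_expansion:
  fixes M :: real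
  assumes "finite S" "0 \<le> M"
  shows "\<exists>C\<ge>0. \<forall>a t. (\<forall>i\<in>S. \<bar>a i\<bar> \<le> M) \<and> \<bar>t\<bar> \<le> 1 \<longrightarrow>
           \<bar>(\<Prod>i\<in>S. 1 + t * a i) - 1 - t * (\<Sum>i\<in>S. a i)\<bar> \<le> C * t\<^sup>2"
  using assms(1)
proof (induction S rule: finite_induct)
  case empty
  then show ?case by auto
next
  case (insert k S)
  then obtain C where C: "C \<ge> 0" "\<And>a t. (\<forall>i\<in>S. \<bar>a i\<bar> \<le> M) \<Longrightarrow> \<bar>t\<bar> \<le> 1 \<Longrightarrow>
     \<bar>(\<Prod>i\<in>S. 1 + t * a i) - 1 - t * (\<Sum>i\<in>S. a i)\<bar> \<le> C * t\<^sup>2" by blast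
  show ?case
  proof (intro exI[of _ "C * (1 + M) + M * (real (card S) * M)"] conjI allI impI)
    show "0 \<le> C * (1 + M) + M * (real (card S) * M)" using C assms by simp
    fix a :: "'a \<Rightarrow> real" and t :: real
    assume *: "(\<forall>i\<in>insert k S. \<bar>a i\<bar> \<le> M) \<and> \<bar>t\<bar> \<le> 1"
    define r where "r = (\<Prod>i\<in>S. 1 + t * a i) - 1 - t * (\<Sum>i\<in>S. a i)"
    have r: "\<bar>r\<bar> \<le> C * t\<^sup>2" unfolding r_def using C(2)[of a t] * by auto
    have "\<bar>t * a k\<bar> \<le> 1 * M" unfolding abs_mult using * by (intro mult_mono) auto
    then have 1: "\<bar>1 + t * a k\<bar> \<le> 1 + M" by linarith
    have s: "\<bar>\<Sum>i\<in>S. a i\<bar> \<le> real (card S) * M"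
      using * sum_norm_bound[of S a M] by auto
    have "(\<Prod>i\<in>insert k S. 1 + t * a i) - 1 - t * (\<Sum>i\<in>insert k S. a i)
          = (1 + t * a k) * r + (a k * (\<Sum>i\<in>S. a i)) * t\<^sup>2"
      using insert.hyps by (simp add: r_def algebra_simps power2_eq_square)
    also have "\<bar>\<dots>\<bar> \<le> (1 + M) * (C * t\<^sup>2) + (M * (real (card S) * M)) * t\<^sup>2"
    proof -
      have "\<bar>(1 + t * a k) * r\<bar> \<le> (1 + M) * (C * t\<^sup>2)"
        unfolding abs_mult using 1 r assms by (intro mult_mono) auto
      moreover have "\<bar>(a k * (\<Sum>i\<in>S. a i)) * t\<^sup>2\<bar> \<le> (M * (real (card S) * M)) * t\<^sup>2"
        unfolding abs_mult using * s assms by (intro mult_mono) auto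
      ultimately show ?thesis by linarith
    qed
    finally show "\<bar>(\<Prod>i\<in>insert k S. 1 + t * a i) - 1 - t * (\<Sum>i\<in>insert k S. a i)\<bar>
        \<le> (C * (1 + M) + M * (real (card S) * M)) * t\<^sup>2" by (simp add: algebra_simps)
  qed
qed

text \<open>
  First-order expansion of the determinant at the identity, uniform on bounded sets of matrices. The
  diagonal product gives the trace, and every other permutation contributes only at order \<open>t\<^sup>2\<close>.
\<close>

lemma det_one_plus_ge:
  fixes M :: real
  assumes "0 \<le> M"
  shows "\<exists>C\<ge>0. \<forall>(A :: real^'n^'n) t. norm A \<le> M \<and> \<bar>t\<bar> \<le> 1 \<longrightarrow>
           1 + t * trace A - C * t\<^sup>2 \<le> det (mat 1 + t *\<^sub>R A)"
proof -
  obtain C0 where C0: "C0 \<ge> 0" "\<And>(a :: 'n \<Rightarrow> real) t. (\<forall>i\<in>UNIV. \<bar>a i\<bar> \<le> M) \<and> \<bar>t\<bar> \<le> 1 \<Longrightarrow>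
     \<bar>(\<Prod>i\<in>UNIV. 1 + t * a i) - 1 - t * (\<Sum>i\<in>UNIV. a i)\<bar> \<le> C0 * t\<^sup>2"
    using prod_one_plus_expansion[of "UNIV :: 'n set" M] assms by auto
  let ?P = "{p. p permutes (UNIV :: 'n set)}"
  define C1 where "C1 = real (card ?P) * ((1 + M) ^ CARD('n))"
  show ?thesis
  proof (intro exI[of _ "C0 + C1"] conjI allI impI)
    show "0 \<le> C0 + C1" using C0 assms by (simp add: C1_def)
    fix A :: "real^'n^'n" and t :: real
    assume *: "norm A \<le> M \<and> \<bar>t\<bar> \<le> 1"
    define B where "B = mat 1 + t *\<^sub>R A"
    have A: "\<bar>A $ i $ j\<bar> \<le> M" for i j using abs_entry_le_norm[of A i j] * by linarith
    have tA: "\<bar>t * A $ i $ j\<bar> \<le> \<bar>t\<bar> * (1 + M)" for i j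
      unfolding abs_mult using A[of i j] by (intro mult_left_mono) auto
    have Bd: "B $ i $ i = 1 + t * A $ i $ i" for i by (simp add: B_def mat_def)
    have Bo: "B $ i $ j = t * A $ i $ j" if "i \<noteq> j" for i j using that by (simp add: B_def mat_def)
    have B1: "\<bar>B $ i $ j\<bar> \<le> 1 + M" for i j
    proof -
      have "\<bar>t * A $ i $ j\<bar> \<le> 1 * M" unfolding abs_mult using A[of i j] * by (intro mult_mono) auto
      then show ?thesis by (cases "i = j") (auto simp: Bd Bo)
    qed
    \<comment> \<open>A permutation other than the identity moves two indices, so its product has two factors \<open>t\<close>.\<close>
    have off: "\<bar>of_int (sign p) * (\<Prod>i\<in>UNIV. B $ i $ p i)\<bar> \<le> (1 + M) ^ CARD('n) * t\<^sup>2"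
      if p: "p permutes UNIV" "p \<noteq> id" for p
    proof -
      obtain i where i: "p i \<noteq> i" using p(2) by (metis eq_id_iff)
      have i2: "p (p i) \<noteq> p i" using i p(1) by (metis permutes_def)
      let ?R = "UNIV - {i, p i}"
      have "(\<Prod>k\<in>UNIV. B $ k $ p k) = B $ i $ p i * (B $ p i $ p (p i) * (\<Prod>k\<in>?R. B $ k $ p k))"
      proof -
        have "UNIV = insert i (insert (p i) ?R)" by auto
        then have "(\<Prod>k\<in>UNIV. B $ k $ p k) = (\<Prod>k\<in>insert i (insert (p i) ?R). B $ k $ p k)" by metis
        also have "\<dots> = B $ i $ p i * (B $ p i $ p (p i) * (\<Prod>k\<in>?R. B $ k $ p k))"
          using i by (subst prod.insert; simp)
        finally show ?thesis .
      qed
      also have "\<bar>\<dots>\<bar> \<le> (\<bar>t\<bar> * (1 + M)) * ((\<bar>t\<bar> * (1 + M)) * (1 + M) ^ card ?R)"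
        unfolding abs_mult abs_prod
      proof (intro mult_mono)
        show "\<bar>B $ i $ p i\<bar> \<le> \<bar>t\<bar> * (1 + M)" using tA Bo i by metis
        show "\<bar>B $ p i $ p (p i)\<bar> \<le> \<bar>t\<bar> * (1 + M)" using tA Bo i2 by metis
        show "(\<Prod>k\<in>?R. \<bar>B $ k $ p k\<bar>) \<le> (1 + M) ^ card ?R"
          using prod_mono[of ?R "\<lambda>k. \<bar>B $ k $ p k\<bar>" "\<lambda>k. 1 + M"] B1 by auto
      qed (use assms in \<open>auto intro!: mult_nonneg_nonneg prod_nonneg\<close>)
      also have "\<dots> = (1 + M) ^ (card ?R + 2) * t\<^sup>2"
        by (simp add: power_add power2_eq_square algebra_simps flip: abs_mult)
      also have "card ?R + 2 = CARD('n)"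
      proof -
        have "card {i, p i} = 2" using i by auto
        moreover have "card ?R = CARD('n) - card {i, p i}" by (rule card_Diff_subset) auto
        moreover have "card {i, p i} \<le> CARD('n)" by (rule card_mono) auto
        ultimately show ?thesis by simp
      qed
      finally show ?thesis by (simp add: abs_mult sign_def)
    qed
    have idP: "id \<in> ?P" by (simp add: permutes_id)
    have finP: "finite ?P" by simp
    have "det B = (\<Sum>p\<in>?P. of_int (sign p) * (\<Prod>i\<in>UNIV. B $ i $ p i))" by (simp add: det_def)
    also have "\<dots> = (\<Prod>i\<in>UNIV. B $ i $ i)
        + (\<Sum>p\<in>?P - {id}. of_int (sign p) * (\<Prod>i\<in>UNIV. B $ i $ p i))"
      using sum.remove[OF finP idP, of "\<lambda>p. of_int (sign p) * (\<Prod>i\<in>UNIV. B $ i $ p i)"]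
      by (simp add: sign_id)
    finally have det: "det B = \<dots>" .
    have "\<bar>\<Sum>p\<in>?P - {id}. of_int (sign p) * (\<Prod>i\<in>UNIV. B $ i $ p i)\<bar>
         \<le> real (card (?P - {id})) * ((1 + M) ^ CARD('n) * t\<^sup>2)"
      using sum_norm_bound[of "?P - {id}" "\<lambda>p. of_int (sign p) * (\<Prod>i\<in>UNIV. B $ i $ p i)"
          "(1 + M) ^ CARD('n) * t\<^sup>2"] off by auto
    also have "\<dots> \<le> real (card ?P) * ((1 + M) ^ CARD('n) * t\<^sup>2)"
      using finP assms by (intro mult_right_mono) (auto intro: card_mono)
    finally have off2: "\<bar>\<Sum>p\<in>?P - {id}. of_int (sign p) * (\<Prod>i\<in>UNIV. B $ i $ p i)\<bar> \<le> C1 * t\<^sup>2"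
      by (simp add: C1_def)
    have "\<bar>(\<Prod>i\<in>UNIV. B $ i $ i) - 1 - t * trace A\<bar> \<le> C0 * t\<^sup>2"
      unfolding Bd trace_def using C0(2)[of "\<lambda>i. A $ i $ i" t] A * by auto
    with off2 show "1 + t * trace A - (C0 + C1) * t\<^sup>2 \<le> det (mat 1 + t *\<^sub>R A)"
      unfolding B_def[symmetric] det by (simp add: algebra_simps)
  qed
qed

lemma norm_matrix_vector_le:
  fixes A :: "real^'n^'m"
  shows "norm (A *v v) \<le> norm A * norm v"
proof -
  have "norm (A *v v) = L2_set (\<lambda>i. (A *v v) $ i) UNIV" by (simp add: norm_vec_def L2_set_def)
  also have "\<dots> \<le> L2_set (\<lambda>i. norm (A $ i) * norm v) UNIV"
    unfolding L2_set_def
    by (intro real_sqrt_le_mono sum_mono)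
      (metis Cauchy_Schwarz_ineq2 abs_le_square_iff abs_mult abs_norm_cancel matrix_vector_mul_component)
  also have "\<dots> = norm A * norm v" by (simp add: L2_set_right_distrib[symmetric] norm_vec_def L2_set_left_distrib)
  finally show ?thesis .
qed

lemma bounded_continuous_integrable:
  fixes f :: "'a::euclidean_space \<Rightarrow> real"
  assumes "open D" "bounded D" "continuous_on D f" "\<And>x. x \<in> D \<Longrightarrow> \<bar>f x\<bar> \<le> K"
  shows "f absolutely_integrable_on D"
proof (rule measurable_bounded_by_integrable_imp_absolutely_integrable)
  have D: "D \<in> lmeasurable" using assms by (intro lmeasurable_open)
  then show "D \<in> sets lebesgue" by auto
  then show "f \<in> borel_measurable (lebesgue_on D)"
    using assms(3) continuous_imp_measurable_on_sets_lebesgue by blast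
  show "(\<lambda>x. K) integrable_on D" using D integrable_on_const by blast
qed (use assms in auto)

text \<open>
  For small \<open>t\<close> the map \<open>x \<mapsto> x + t w x\<close> is injective on the convex set \<open>D\<close>, since \<open>w\<close> is Lipschitz
  there. The volume of its image is the integral of the Jacobian, which is \<open>1 + t div w\<close> up to a
  uniform error of order \<open>t\<^sup>2\<close>. The order on the index type is that of the change of variables formula.
\<close>

lemma volume_of_perturbed_identity_wellorder:
  fixes w :: "real^'n::{finite,wellorder} \<Rightarrow> real^'n::_" and A :: "real^'n::_ \<Rightarrow> real^'n::_^'n::_"
  assumes D: "open D" "bounded D" "convex D"
    and der: "\<And>x. x \<in> D \<Longrightarrow> (w has_derivative (\<lambda>v. A x *v v)) (at x)"
    and contA: "continuous_on D A" and bdA: "\<And>x. x \<in> D \<Longrightarrow> norm (A x) \<le> M"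
  shows "\<exists>C t0. t0 > 0 \<and> (\<forall>t B. 0 < t \<and> t < t0 \<and> B \<in> lmeasurable \<and> (\<lambda>x. x + t *\<^sub>R w x) ` D \<subseteq> B \<longrightarrow>
     measure lebesgue D + t * integral D (\<lambda>x. trace (A x)) - C * t\<^sup>2 \<le> measure lebesgue B)"
proof -
  define M' where "M' = \<bar>M\<bar> + 1"
  have bd: "norm (A x) \<le> M'" if "x \<in> D" for x using bdA[OF that] by (simp add: M'_def)
  have M': "M' \<ge> 1" by (simp add: M'_def)
  obtain C where C: "C \<ge> 0" "\<And>(A :: real^'n::_^'n::_) t. norm A \<le> M' \<and> \<bar>t\<bar> \<le> 1 \<Longrightarrow>
           1 + t * trace A - C * t\<^sup>2 \<le> det (mat 1 + t *\<^sub>R A)"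
    using det_one_plus_ge[of M'] M' by force
  have Dm: "D \<in> lmeasurable" using D by (intro lmeasurable_open)
  have ctr: "continuous_on D (\<lambda>x. trace (A x))"
    unfolding trace_def by (intro continuous_intros contA)
  have itr: "(\<lambda>x. trace (A x)) absolutely_integrable_on D"
  proof (rule bounded_continuous_integrable[OF D(1,2) ctr])
    fix x assume "x \<in> D"
    have "\<bar>trace (A x)\<bar> \<le> real (card (UNIV :: 'n::_ set)) * M'" unfolding trace_def
      using sum_norm_bound[of UNIV "\<lambda>i. A x $ i $ i" M'] abs_entry_le_norm[of "A x"] bd[OF \<open>x \<in> D\<close>]
      by (smt (verit) real_norm_def)
    then show "\<bar>trace (A x)\<bar> \<le> real (CARD('n::_)) * M'" .
  qed
  show ?thesis
  proof (rule exI[of _ "C * measure lebesgue D"], rule exI[of _ "1 / M'"], intro conjI allI impI)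
    show "1 / M' > 0" using M' by simp
    fix t B assume *: "0 < t \<and> t < 1 / M' \<and> B \<in> lmeasurable \<and> (\<lambda>x. x + t *\<^sub>R w x) ` D \<subseteq> B"
    have "1 / M' \<le> 1" using M' by simp
    with * have t: "0 < t" "t \<le> 1" by auto
    from * have tM: "t * M' < 1" using M' by (auto simp: less_divide_eq)
    let ?F = "\<lambda>x. x + t *\<^sub>R w x" and ?F' = "\<lambda>x v. (mat 1 + t *\<^sub>R A x) *v v"
    have derF: "(?F has_derivative ?F' x) (at x within D)" if "x \<in> D" for x
      using has_derivative_add[OF has_derivative_ident has_derivative_scaleR_right[OF der[OF that], of t]]
      by (simp add: matrix_vector_mult_add_rdistrib scaleR_matrix_vector_assoc has_derivative_at_withinI)
    have lip: "norm (w x - w y) \<le> M' * norm (x - y)" if "x \<in> D" "y \<in> D" for x y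
    proof (rule differentiable_bound[OF D(3) _ _ that])
      fix z assume z: "z \<in> D"
      show "(w has_derivative (\<lambda>v. A z *v v)) (at z within D)"
        using der[OF z] by (rule has_derivative_at_withinI)
      show "onorm (\<lambda>v. A z *v v) \<le> M'"
      proof (rule onorm_le)
        fix v
        show "norm (A z *v v) \<le> M' * norm v"
          using norm_matrix_vector_le[of "A z" v] mult_right_mono[OF bd[OF z] norm_ge_zero[of v]] by linarith
      qed
    qed
    have inj: "inj_on ?F D"
    proof (rule inj_onI)
      fix x y assume xy: "x \<in> D" "y \<in> D" "?F x = ?F y"
      have e: "x - y = t *\<^sub>R (w y - w x)" using xy(3) by (simp add: algebra_simps)
      have "norm (x - y) = t * norm (w x - w y)" unfolding e using t by (simp add: norm_minus_commute)
      also have "\<dots> \<le> t * (M' * norm (x - y))" using lip[OF xy(1,2)] t by (intro mult_left_mono) auto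
      finally have "norm (x - y) * (1 - t * M') \<le> 0" by (simp add: algebra_simps)
      then show "x = y" using tM by (simp add: mult_le_0_iff)
    qed
    let ?J = "\<lambda>x. \<bar>det (matrix (?F' x))\<bar>"
    have J: "?J x = \<bar>det (mat 1 + t *\<^sub>R A x)\<bar>" for x by simp
    have cJ: "continuous_on D ?J" unfolding J unfolding det_def
      by (intro continuous_intros contA)
    have lm: "?F ` D \<in> lmeasurable \<and> ?J integrable_on D"
    proof -
      have "\<exists>K. \<forall>X \<in> cball (0::real^'n::_^'n::_) M'. \<bar>det (mat 1 + t *\<^sub>R X)\<bar> \<le> K"
      proof -
        have "continuous_on (cball 0 M') (\<lambda>X :: real^'n::_^'n::_. det (mat 1 + t *\<^sub>R X))"
          unfolding det_def by (intro continuous_intros)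
        then have "compact ((\<lambda>X :: real^'n::_^'n::_. det (mat 1 + t *\<^sub>R X)) ` cball 0 M')"
          by (intro compact_continuous_image) auto
        from compact_imp_bounded[OF this] show ?thesis unfolding bounded_iff by auto
      qed
      then obtain K where K: "\<And>X. norm X \<le> M' \<Longrightarrow> \<bar>det (mat 1 + t *\<^sub>R (X::real^'n::_^'n::_))\<bar> \<le> K"
        by (metis mem_cball_0)
      have "?J absolutely_integrable_on D"
        by (rule bounded_continuous_integrable[OF D(1,2) cJ, of K]) (use K bd in \<open>auto\<close>)
      then have I: "?J integrable_on D" using set_lebesgue_integral_eq_integral(1) by blast
      then show ?thesis using measurable_differentiable_image_eq[OF _ derF inj] Dm by blast
    qed
    have i1: "((\<lambda>x. trace (A x)) has_integral integral D (\<lambda>x. trace (A x))) D"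
      using itr set_lebesgue_integral_eq_integral(1) integrable_integral by blast
    have "((\<lambda>x. 1::real) has_integral measure lebesgue D) D"
      using Dm lmeasure_integral lmeasurable_iff_integrable_on integrable_integral by metis
    then have c1: "((\<lambda>x. c) has_integral c * measure lebesgue D) D" for c :: real
      using has_integral_mult_right[of "\<lambda>x. 1::real" "measure lebesgue D" D c] by simp
    have i2: "((\<lambda>x. 1 + t * trace (A x) - C * t\<^sup>2) has_integral
        (1 * measure lebesgue D + t * integral D (\<lambda>x. trace (A x)) - C * t\<^sup>2 * measure lebesgue D)) D"
      by (intro has_integral_diff has_integral_add c1 has_integral_mult_right i1)
    have "measure lebesgue D + t * integral D (\<lambda>x. trace (A x)) - C * measure lebesgue D * t\<^sup>2
        = integral D (\<lambda>x. 1 + t * trace (A x) - C * t\<^sup>2)"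
      using i2 by (simp add: integral_unique algebra_simps)
    also have "\<dots> \<le> integral D ?J"
    proof (rule integral_le)
      show "?J integrable_on D" using lm by blast
      show "(\<lambda>x. 1 + t * trace (A x) - C * t\<^sup>2) integrable_on D"
        using i2 by blast
      fix x assume "x \<in> D"
      then have "1 + t * trace (A x) - C * t\<^sup>2 \<le> det (mat 1 + t *\<^sub>R A x)" using C(2) bd t by auto
      then show "1 + t * trace (A x) - C * t\<^sup>2 \<le> ?J x" unfolding J by linarith
    qed
    also have "integral D ?J = measure lebesgue (?F ` D)"
      using measure_differentiable_image_eq[OF _ derF inj] Dm lm by (metis fmeasurableD)
    also have "\<dots> \<le> measure lebesgue B" using * lm by (intro measure_mono_fmeasurable) auto
    finally show "measure lebesgue D + t * integral D (\<lambda>x. trace (A x)) - C * measure lebesgue D * t\<^sup>2 \<le> measure lebesgue B" .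
  qed
qed

section \<open>Reindexing coordinates by a well-ordered type\<close>

text \<open>
  The volume estimate is needed for coordinates indexed by an arbitrary finite type. Every such type
  has a copy that carries a well-order, and renaming the coordinates preserves Lebesgue measure, the
  norm and the trace.
\<close>

typedef 'a wo_copy = "UNIV :: 'a set" morphisms of_copy to_copy by auto

lemma to_copy_inverse' [simp]: "of_copy (to_copy x) = x" by (simp add: to_copy_inverse)

lemma bij_to_copy: "bij to_copy"
  by (metis bij_betw_def inj_def of_copy_inverse surj_def to_copy_inverse')

instance wo_copy :: (finite) finite
proof
  have "(UNIV :: 'a wo_copy set) = to_copy ` UNIV" by (rule bij_is_surj[OF bij_to_copy, symmetric])
  then show "finite (UNIV :: 'a wo_copy set)" by (metis finite_imageI finite_class.finite_UNIV)
qed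

definition copy_index :: "'a::finite wo_copy \<Rightarrow> nat" where
  "copy_index = (SOME f. inj f)"

lemma inj_copy_index: "inj (copy_index :: 'a::finite wo_copy \<Rightarrow> nat)"
proof -
  have "\<exists>f :: 'a wo_copy \<Rightarrow> nat. inj f"
    using finite_imp_inj_to_nat_seg[of "UNIV :: 'a wo_copy set"] by auto
  then show ?thesis unfolding copy_index_def by (rule someI_ex)
qed

instantiation wo_copy :: (finite) wellorder
begin

definition less_eq_wo_copy :: "'a wo_copy \<Rightarrow> 'a wo_copy \<Rightarrow> bool" where
  "less_eq_wo_copy x y \<longleftrightarrow> copy_index x \<le> copy_index y"

definition less_wo_copy :: "'a wo_copy \<Rightarrow> 'a wo_copy \<Rightarrow> bool" where
  "less_wo_copy x y \<longleftrightarrow> copy_index x < copy_index y"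

instance
proof
  fix P :: "'a wo_copy \<Rightarrow> bool" and a
  assume step: "\<And>x. (\<And>y. y < x \<Longrightarrow> P y) \<Longrightarrow> P x"
  show "P a"
    by (induction a rule: measure_induct_rule[of copy_index]) (rule step, simp add: less_wo_copy_def)
qed (use inj_copy_index in \<open>auto simp: less_eq_wo_copy_def less_wo_copy_def inj_def\<close>)

end

definition vec_copy :: "real^'n \<Rightarrow> real^'n wo_copy" where
  "vec_copy x = (\<chi> i. x $ of_copy i)"

definition vec_uncopy :: "real^'n wo_copy \<Rightarrow> real^'n" where
  "vec_uncopy x = (\<chi> i. x $ to_copy i)"

lemma vec_copy_inverse [simp]: "vec_uncopy (vec_copy x) = x" "vec_copy (vec_uncopy y) = y"
  by (simp_all add: vec_copy_def vec_uncopy_def of_copy_inverse)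

lemma sum_copy: "(\<Sum>i\<in>UNIV. f (to_copy i)) = (\<Sum>i\<in>UNIV. f i)"
  by (rule sum.reindex_bij_betw[OF bij_to_copy])

lemma prod_copy: "(\<Prod>i\<in>UNIV. f (to_copy i)) = (\<Prod>i\<in>UNIV. f i)"
  by (rule prod.reindex_bij_betw[OF bij_to_copy])

lemma linear_vec_copy: "linear vec_copy" "linear vec_uncopy"
  by (auto intro!: linearI simp: vec_copy_def vec_uncopy_def vec_eq_iff)

lemma bounded_linear_vec_copy: "bounded_linear vec_copy" "bounded_linear vec_uncopy"
  using linear_vec_copy linear_conv_bounded_linear by auto

lemma norm_vec_copy [simp]: "norm (vec_uncopy x) = norm x"
  unfolding norm_vec_def L2_set_def vec_uncopy_def using sum_copy[of "\<lambda>i. (norm (x $ i))\<^sup>2"] by simp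

lemma vec_uncopy_vimage_box: "vec_uncopy -` box a b = box (vec_copy a) (vec_copy b)"
proof -
  have "(\<forall>i. a $ i < x $ to_copy i \<and> x $ to_copy i < b $ i) \<longleftrightarrow> (\<forall>i. a $ of_copy i < x $ i \<and> x $ i < b $ of_copy i)" for x :: "real^'a wo_copy"
    by (metis of_copy_inverse to_copy_inverse')
  then show ?thesis by (auto simp: mem_box_cart vec_copy_def vec_uncopy_def)
qed

lemma lborel_distr_vec_uncopy:
  "distr lborel borel (vec_uncopy :: real^'n wo_copy \<Rightarrow> real^'n) = lborel"
proof (rule lborel_eqI[symmetric])
  have m: "vec_uncopy \<in> borel_measurable (borel :: (real^'n wo_copy) measure)"
    using bounded_linear_vec_copy by (intro borel_measurable_continuous_onI linear_continuous_on)
  fix l u :: "real^'n"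
  assume le: "\<And>b. b \<in> Basis \<Longrightarrow> l \<bullet> b \<le> u \<bullet> b"
  then have le': "l $ i \<le> u $ i" for i
    by (metis axis_in_Basis_iff Basis_real_def inner_axis inner_real_def insertI1 mult.right_neutral real_inner_1_right)
  have "emeasure (distr lborel borel vec_uncopy) (box l u) = emeasure lborel (box (vec_copy l) (vec_copy u) :: (real^'n wo_copy) set)"
    using m by (subst emeasure_distr) (auto simp: vec_uncopy_vimage_box)
  also have "\<dots> = ennreal (\<Prod>i\<in>UNIV. (vec_copy u - vec_copy l) $ i)"
  proof (subst emeasure_lborel_box)
    show "vec_copy l \<bullet> b \<le> vec_copy u \<bullet> b" if "b \<in> Basis" for b :: "real^'n wo_copy"
      using that le' by (auto simp: Basis_vec_def inner_axis vec_copy_def)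
    show "ennreal (\<Prod>b\<in>Basis. (vec_copy u - vec_copy l) \<bullet> b) = ennreal (\<Prod>i\<in>UNIV. (vec_copy u - vec_copy l) $ i)"
      by (simp add: Basis_vec_def cart_eq_inner_axis prod.UNION_disjoint UNION_singleton_eq_range prod.reindex inj_on_def axis_eq_axis)
  qed
  also have "(\<Prod>i\<in>UNIV. (vec_copy u - vec_copy l) $ i) = (\<Prod>i\<in>UNIV. (u - l) $ i)"
    using prod_copy[of "\<lambda>i. (vec_copy u - vec_copy l) $ i"] by (simp add: vec_copy_def)
  also have "\<dots> = (\<Prod>b\<in>Basis. (u - l) \<bullet> b)"
    by (simp add: Basis_vec_def cart_eq_inner_axis prod.UNION_disjoint UNION_singleton_eq_range prod.reindex inj_on_def axis_eq_axis)
  finally show "emeasure (distr lborel borel vec_uncopy) (box l u) = ennreal (\<Prod>b\<in>Basis. (u - l) \<bullet> b)" .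
qed simp

lemma volume_of_perturbed_identity:
  fixes w :: "real^'n \<Rightarrow> real^'n" and A :: "real^'n \<Rightarrow> real^'n^'n"
  assumes D: "open D" "bounded D" "convex D"
    and der: "\<And>x. x \<in> D \<Longrightarrow> (w has_derivative (\<lambda>v. A x *v v)) (at x)"
    and contA: "continuous_on D A" and bdA: "\<And>x. x \<in> D \<Longrightarrow> norm (A x) \<le> M"
  shows "\<exists>C t0. t0 > 0 \<and> (\<forall>t B. 0 < t \<and> t < t0 \<and> open B \<and> bounded B \<and> (\<lambda>x. x + t *\<^sub>R w x) ` D \<subseteq> B \<longrightarrow>
     measure lborel D + t * (LINT x:D|lborel. trace (A x)) - C * t\<^sup>2 \<le> measure lborel B)"
proof -
  let ?T = "vec_copy :: real^'n \<Rightarrow> real^'n wo_copy" and ?U = "vec_uncopy :: real^'n wo_copy \<Rightarrow> real^'n"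
  define w' where "w' = (\<lambda>y. ?T (w (?U y)))"
  define A' where "A' = (\<lambda>y. \<chi> i j. A (?U y) $ of_copy i $ of_copy j)"
  define D' where "D' = ?U -` D"
  have cU: "continuous_on X ?U" for X using bounded_linear_vec_copy by (intro linear_continuous_on)
  have meas: "?U \<in> borel_measurable borel" using cU by (intro borel_measurable_continuous_onI)
  have mU: "measure lborel (?U -` X) = measure lborel X" if "open X" for X
    using that meas by (subst (2) lborel_distr_vec_uncopy[symmetric], subst measure_distr) auto
  have op: "open (?U -` X)" if "open X" for X using that cU by (intro open_vimage) auto
  have bdd: "bounded (?U -` X)" if "bounded X" for X
    using that unfolding bounded_iff by (metis norm_vec_copy vimageD)
  have conv: "convex D'" unfolding D'_def using D(3) linear_vec_copy(2) by (rule convex_linear_vimage[rotated])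
  have Av: "A' y *v v = ?T (A (?U y) *v ?U v)" for y v
  proof -
    have "(\<Sum>j\<in>UNIV. A (?U y) $ of_copy i $ of_copy j * v $ j) = (\<Sum>j\<in>UNIV. A (?U y) $ of_copy i $ j * v $ to_copy j)" for i
      using sum_copy[of "\<lambda>j. A (?U y) $ of_copy i $ of_copy j * v $ j"] by simp
    then show ?thesis by (simp add: vec_eq_iff A'_def matrix_vector_mult_def vec_copy_def vec_uncopy_def)
  qed
  have tr: "trace (A' y) = trace (A (?U y))" for y
    using sum_copy[of "\<lambda>j. A (?U y) $ of_copy j $ of_copy j"] by (simp add: trace_def A'_def)
  have der': "(w' has_derivative (\<lambda>v. A' y *v v)) (at y)" if "y \<in> D'" for y
  proof -
    have "(w has_derivative (\<lambda>v. A (?U y) *v v)) (at (?U y))" using that der by (simp add: D'_def)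
    from has_derivative_compose[OF bounded_linear_imp_has_derivative[OF bounded_linear_vec_copy(2)] this]
    have "((\<lambda>y. w (?U y)) has_derivative (\<lambda>v. A (?U y) *v ?U v)) (at y)" .
    from bounded_linear.has_derivative[OF bounded_linear_vec_copy(1) this]
    show ?thesis unfolding w'_def Av .
  qed
  have cA': "continuous_on D' A'"
    unfolding A'_def
    by (intro continuous_on_vec_lambda continuous_on_component continuous_on_compose2[OF contA cU])
       (auto simp: D'_def)
  have bA': "norm (A' y) \<le> M * CARD('n) * CARD('n)" if "y \<in> D'" for y
  proof -
    have M: "norm (A (?U y)) \<le> M" using that bdA by (simp add: D'_def)
    have c: "CARD('n wo_copy) = CARD('n)" using bij_to_copy by (metis bij_betw_same_card)
    have "norm (A' y) \<le> (\<Sum>i\<in>UNIV. norm (A' y $ i))" unfolding norm_vec_def by (rule L2_set_le_sum) auto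
    also have "\<dots> \<le> (\<Sum>i\<in>(UNIV :: 'n wo_copy set). \<Sum>j\<in>(UNIV :: 'n wo_copy set). M)"
    proof (rule sum_mono)
      fix i
      have "norm (A' y $ i) \<le> (\<Sum>j\<in>UNIV. norm (A' y $ i $ j))" unfolding norm_vec_def[of "A' y $ i"] by (rule L2_set_le_sum) auto
      also have "\<dots> \<le> (\<Sum>j\<in>(UNIV :: 'n wo_copy set). M)"
        using abs_entry_le_norm[of "A (?U y)"] M by (intro sum_mono) (auto simp: A'_def intro: order_trans)
      finally show "norm (A' y $ i) \<le> (\<Sum>j\<in>(UNIV :: 'n wo_copy set). M)" .
    qed
    also have "\<dots> = M * CARD('n) * CARD('n)" by (simp add: c)
    finally show ?thesis .
  qed
  have D'o: "open D'" "bounded D'" using D op bdd by (auto simp: D'_def)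
  obtain C t0 where C: "t0 > 0" "\<And>t B. 0 < t \<and> t < t0 \<and> B \<in> lmeasurable \<and> (\<lambda>x. x + t *\<^sub>R w' x) ` D' \<subseteq> B \<Longrightarrow>
     measure lebesgue D' + t * integral D' (\<lambda>x. trace (A' x)) - C * t\<^sup>2 \<le> measure lebesgue B"
    using volume_of_perturbed_identity_wellorder[OF D'o conv der' cA' bA'] by blast
  have int: "(LINT x:D|lborel. trace (A x)) = integral D' (\<lambda>x. trace (A' x))"
  proof -
    have m: "(\<lambda>x. indicator D x *\<^sub>R trace (A x)) \<in> borel_measurable borel"
      using D(1) contA unfolding trace_def
      by (intro borel_measurable_continuous_on_indicator continuous_intros) auto
    have "(LINT x:D|lborel. trace (A x)) = (LINT x|distr lborel borel ?U. indicator D x *\<^sub>R trace (A x))"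
      by (simp add: lborel_distr_vec_uncopy set_lebesgue_integral_def)
    also have "\<dots> = (LINT x|lborel. indicator D (?U x) *\<^sub>R trace (A (?U x)))"
      using m meas by (subst integral_distr) auto
    also have "\<dots> = (LINT x:D'|lborel. trace (A' x))"
      by (simp add: set_lebesgue_integral_def tr D'_def indicator_vimage[symmetric] indicator_def)
    also have "\<dots> = integral D' (\<lambda>x. trace (A' x))"
    proof (rule set_borel_integral_eq_integral(2))
      have "emeasure lborel D' < \<infinity>" using D'o emeasure_bounded_finite by auto
      moreover have "norm (trace (A' x)) \<le> M * CARD('n) * CARD('n) * CARD('n wo_copy)" if "x \<in> D'" for x
      proof -
        have "\<bar>A' x $ i $ i\<bar> \<le> M * CARD('n) * CARD('n)" for i using bA'[OF that] abs_entry_le_norm[of "A' x" i i] by linarith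
        then show ?thesis unfolding trace_def
          using sum_norm_bound[of "UNIV :: 'n wo_copy set" "\<lambda>i. A' x $ i $ i" "M * CARD('n) * CARD('n)"] by (simp add: mult.commute)
      qed
      moreover have "set_borel_measurable lborel D' (\<lambda>x. trace (A' x))"
      proof -
        have "continuous_on D' (\<lambda>x. trace (A' x))" unfolding trace_def by (intro continuous_intros cA')
        then show ?thesis unfolding set_borel_measurable_def
          using D'o borel_measurable_continuous_on_indicator[of D' "\<lambda>x. trace (A' x)"] by simp
      qed
      ultimately show "set_integrable lborel D' (\<lambda>x. trace (A' x))"
        using D'o unfolding set_integrable_def set_borel_measurable_def
        by (intro integrableI_bounded_set[where A = D']) (auto simp: indicator_def)
    qed
    finally show ?thesis .
  qed
  show ?thesis
  proof (rule exI[of _ C], rule exI[of _ t0], intro conjI allI impI)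
    fix t B assume *: "0 < t \<and> t < t0 \<and> open B \<and> bounded B \<and> (\<lambda>x. x + t *\<^sub>R w x) ` D \<subseteq> B"
    have "(\<lambda>x. x + t *\<^sub>R w' x) ` D' \<subseteq> ?U -` B"
    proof
      fix y assume "y \<in> (\<lambda>x. x + t *\<^sub>R w' x) ` D'"
      then obtain x where x: "?U x \<in> D" "y = x + t *\<^sub>R w' x" by (auto simp: D'_def)
      have "?U y = ?U x + t *\<^sub>R w (?U x)"
        unfolding x(2) w'_def linear_add[OF linear_vec_copy(2)] linear_scale[OF linear_vec_copy(2)] by simp
      then show "y \<in> ?U -` B" using * x(1) by auto
    qed
    moreover have "?U -` B \<in> lmeasurable" using * op bdd by (intro lmeasurable_open) auto
    ultimately have "measure lebesgue D' + t * integral D' (\<lambda>x. trace (A' x)) - C * t\<^sup>2 \<le> measure lebesgue (?U -` B)"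
      using C(2)[of t "?U -` B"] * by blast
    moreover have "measure lebesgue D' = measure lborel D" "measure lebesgue (?U -` B) = measure lborel B"
      using mU[of D] mU[of B] op[of B] * D D'o by (simp_all add: D'_def)
    ultimately show "measure lborel D + t * (LINT x:D|lborel. trace (A x)) - C * t\<^sup>2 \<le> measure lborel B"
      by (simp add: int)
  qed (rule C)
qed

section \<open>A divergence inequality on convex sets\<close>

lemma supporting_point_in_frontier:
  fixes D :: "'a::euclidean_space set"
  assumes "open D" "x \<in> closure D" "\<nu> \<noteq> 0" "\<And>z. z \<in> D \<Longrightarrow> \<nu> \<bullet> z \<le> \<nu> \<bullet> x"
  shows "x \<in> frontier D"
proof -
  have "x \<notin> D"
  proof
    assume "x \<in> D"
    then obtain e where e: "e > 0" "ball x e \<subseteq> D" using assms(1) openE by blast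
    have n: "norm \<nu> > 0" using assms(3) by simp
    define y where "y = x + (e / (2 * norm \<nu>)) *\<^sub>R \<nu>"
    have "dist x y = e / 2" using n e by (simp add: y_def dist_norm)
    then have "y \<in> D" using e by auto
    then have "\<nu> \<bullet> y \<le> \<nu> \<bullet> x" by (rule assms(4))
    moreover have "\<nu> \<bullet> y = \<nu> \<bullet> x + (e / (2 * norm \<nu>)) * (\<nu> \<bullet> \<nu>)" by (simp add: y_def inner_add_right)
    moreover have "(e / (2 * norm \<nu>)) * (\<nu> \<bullet> \<nu>) > 0" using n e by simp
    ultimately show False by linarith
  qed
  then show ?thesis using assms(1,2) by (simp add: frontier_def interior_open)
qed

text \<open>
  A compactness argument. If it failed for times \<open>t\<^sub>m\<close> tending to 0 and points \<open>x\<^sub>m\<close>, then hyperplanes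
  separating the images from the dilated set would have unit normals \<open>\<nu>\<^sub>m\<close> with
  \<open>\<delta> (\<nu>\<^sub>m \<bullet> (x\<^sub>m - z0)) \<le> \<nu>\<^sub>m \<bullet> w x\<^sub>m\<close>. In the limit \<open>x\<close> is a boundary point with supporting normal
  \<open>\<nu>\<close>, where the left-hand side is positive, because \<open>z0\<close> is an interior point, and the right-hand
  side is nonpositive by assumption.
\<close>

lemma flow_stays_in_dilation:
  fixes D :: "'a::euclidean_space set" and w :: "'a \<Rightarrow> 'a"
  assumes D: "open D" "convex D" "bounded D" "z0 \<in> D"
    and cw: "continuous_on (closure D) w"
    and inw: "\<And>x \<nu>. x \<in> frontier D \<Longrightarrow> (\<And>z. z \<in> D \<Longrightarrow> \<nu> \<bullet> z \<le> \<nu> \<bullet> x) \<Longrightarrow> \<nu> \<bullet> w x \<le> 0"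
    and \<delta>: "\<delta> > 0"
  shows "\<exists>t0>0. \<forall>t x. 0 < t \<and> t < t0 \<and> x \<in> D \<longrightarrow> z0 + (x + t *\<^sub>R w x - z0) /\<^sub>R (1 + \<delta> * t) \<in> D"
proof (rule ccontr)
  assume neg: "\<not> ?thesis"
  have "\<exists>t x. 0 < t \<and> t < inverse (real (Suc m)) \<and> x \<in> D \<and> z0 + (x + t *\<^sub>R w x - z0) /\<^sub>R (1 + \<delta> * t) \<notin> D" for m
    using neg by (metis inverse_positive_iff_positive of_nat_0_less_iff zero_less_Suc)
  then obtain t x where tx: "\<And>m. 0 < t m" "\<And>m. t m < inverse (real (Suc m))" "\<And>m. x m \<in> D"
    "\<And>m. z0 + (x m + t m *\<^sub>R w (x m) - z0) /\<^sub>R (1 + \<delta> * t m) \<notin> D" by metis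
  define y where "y m = z0 + (x m + t m *\<^sub>R w (x m) - z0) /\<^sub>R (1 + \<delta> * t m)" for m
  have "\<exists>\<nu>. norm \<nu> = 1 \<and> (\<forall>z\<in>D. \<nu> \<bullet> z \<le> \<nu> \<bullet> y m)" for m
  proof -
    obtain a b where ab: "a \<noteq> 0" "\<forall>z\<in>D. a \<bullet> z \<le> b" "\<forall>z\<in>{y m}. a \<bullet> z \<ge> b"
      using separating_hyperplane_sets[of D "{y m}"] D tx(4)[of m] by (auto simp: y_def)
    then show ?thesis
      by (intro exI[of _ "a /\<^sub>R norm a"]) (auto intro!: mult_left_mono intro: order_trans)
  qed
  then obtain \<nu> where \<nu>: "\<And>m. norm (\<nu> m) = 1" "\<And>m z. z \<in> D \<Longrightarrow> \<nu> m \<bullet> z \<le> \<nu> m \<bullet> y m" by metis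
  have cc: "compact (closure D \<times> sphere (0::'a) 1)" using D by (intro compact_Times) auto
  have "(x m, \<nu> m) \<in> closure D \<times> sphere 0 1" for m using tx(3)[of m] \<nu>(1) closure_subset by auto
  then obtain l r where lr: "l \<in> closure D \<times> sphere (0::'a) 1" "strict_mono r" "((\<lambda>m. (x m, \<nu> m)) \<circ> r) \<longlonglongrightarrow> l"
    using cc unfolding compact_def by meson
  obtain xl \<nu>l where l: "l = (xl, \<nu>l)" by force
  have xl: "(\<lambda>m. x (r m)) \<longlonglongrightarrow> xl" and \<nu>l: "(\<lambda>m. \<nu> (r m)) \<longlonglongrightarrow> \<nu>l"
    using tendsto_fst[OF lr(3)] tendsto_snd[OF lr(3)] by (auto simp: l o_def)
  have xlc: "xl \<in> closure D" and n\<nu>: "norm \<nu>l = 1" using lr(1) by (auto simp: l)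
  have t0: "(\<lambda>m. t (r m)) \<longlonglongrightarrow> 0"
  proof (rule LIMSEQ_subseq_LIMSEQ[OF _ lr(2), unfolded o_def])
    show "t \<longlonglongrightarrow> 0"
      using tx(1,2) by (intro tendsto_sandwich[OF _ _ tendsto_const LIMSEQ_inverse_real_of_nat] always_eventually allI less_imp_le)
  qed
  have wl: "(\<lambda>m. w (x (r m))) \<longlonglongrightarrow> w xl"
    using cw xl xlc tx(3) closure_subset by (intro continuous_on_tendsto_compose[OF cw] always_eventually allI) auto
  have pos: "1 + \<delta> * t m > 0" for m using \<delta> tx(1)[of m] by (simp add: add_pos_pos)
  have key: "(1 + \<delta> * t m) * (\<nu> m \<bullet> z - \<nu> m \<bullet> z0) \<le> \<nu> m \<bullet> (x m - z0) + t m * (\<nu> m \<bullet> w (x m))" if "z \<in> D" for z m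
  proof -
    have "\<nu> m \<bullet> z - \<nu> m \<bullet> z0 \<le> (\<nu> m \<bullet> (x m - z0) + t m * (\<nu> m \<bullet> w (x m))) / (1 + \<delta> * t m)"
      using \<nu>(2)[OF that, of m] by (simp add: y_def inner_add_right inner_diff_right divide_inverse algebra_simps)
    then show ?thesis using pos[of m] by (simp add: field_simps)
  qed
  have sup: "\<nu>l \<bullet> z \<le> \<nu>l \<bullet> xl" if "z \<in> D" for z
  proof -
    have "(\<lambda>m. (1 + \<delta> * t (r m)) * (\<nu> (r m) \<bullet> z - \<nu> (r m) \<bullet> z0)) \<longlonglongrightarrow> (1 + \<delta> * 0) * (\<nu>l \<bullet> z - \<nu>l \<bullet> z0)"
      by (intro tendsto_intros \<nu>l t0)
    moreover have "(\<lambda>m. \<nu> (r m) \<bullet> (x (r m) - z0) + t (r m) * (\<nu> (r m) \<bullet> w (x (r m)))) \<longlonglongrightarrow> \<nu>l \<bullet> (xl - z0) + 0 * (\<nu>l \<bullet> w xl)"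
      by (intro tendsto_intros \<nu>l t0 xl wl)
    ultimately have "(1 + \<delta> * 0) * (\<nu>l \<bullet> z - \<nu>l \<bullet> z0) \<le> \<nu>l \<bullet> (xl - z0) + 0 * (\<nu>l \<bullet> w xl)"
      using key[OF that] by (intro LIMSEQ_le) auto
    then show ?thesis by (simp add: inner_diff_right)
  qed
  have "\<delta> * (\<nu> m \<bullet> (x m - z0)) \<le> \<nu> m \<bullet> w (x m)" for m
  proof -
    have "t m * (\<delta> * (\<nu> m \<bullet> (x m - z0))) \<le> t m * (\<nu> m \<bullet> w (x m))"
      using key[OF tx(3)[of m], of m] by (simp add: algebra_simps inner_diff_right)
    then show ?thesis using tx(1)[of m] by simp
  qed
  moreover have "(\<lambda>m. \<delta> * (\<nu> (r m) \<bullet> (x (r m) - z0))) \<longlonglongrightarrow> \<delta> * (\<nu>l \<bullet> (xl - z0))"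
    by (intro tendsto_intros \<nu>l xl)
  moreover have "(\<lambda>m. \<nu> (r m) \<bullet> w (x (r m))) \<longlonglongrightarrow> \<nu>l \<bullet> w xl" by (intro tendsto_intros \<nu>l wl)
  ultimately have 1: "\<delta> * (\<nu>l \<bullet> (xl - z0)) \<le> \<nu>l \<bullet> w xl" by (intro LIMSEQ_le) auto
  have "xl \<in> frontier D"
    using supporting_point_in_frontier[OF D(1) xlc _ sup] n\<nu> by force
  from inw[OF this sup] have 2: "\<nu>l \<bullet> w xl \<le> 0" .
  obtain e where e: "e > 0" "ball z0 e \<subseteq> D" using D openE by blast
  have "z0 + (e/2) *\<^sub>R \<nu>l \<in> D" using e n\<nu> by (intro subsetD[OF e(2)]) (simp add: dist_norm)
  from sup[OF this] have "e / 2 \<le> \<nu>l \<bullet> (xl - z0)"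
    using n\<nu> by (simp add: inner_add_right inner_diff_right dot_square_norm)
  then have "\<delta> * (\<nu>l \<bullet> (xl - z0)) > 0" using e \<delta> by simp
  with 1 2 show False by linarith
qed

lemma measure_dilation:
  fixes D :: "(real^'n) set"
  assumes "open D" "0 < m"
  shows "measure lborel ((\<lambda>y. z0 + m *\<^sub>R (y - z0)) ` D) = m ^ CARD('n) * measure lborel D"
    and "open ((\<lambda>y. z0 + m *\<^sub>R (y - z0)) ` D)"
proof -
  have e: "(\<lambda>y. z0 + m *\<^sub>R (y - z0)) ` D = (\<lambda>y. (z0 - m *\<^sub>R z0) + y) ` ((\<lambda>y. m *\<^sub>R y) ` D)"
    by (simp add: image_image algebra_simps)
  show op: "open ((\<lambda>y. z0 + m *\<^sub>R (y - z0)) ` D)"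
    unfolding e using assms by (intro open_translation open_scaling) auto
  have "emeasure lebesgue ((\<lambda>y. (z0 - m *\<^sub>R z0) + m *\<^sub>R y) ` D) = \<bar>m\<bar> ^ DIM(real^'n) * emeasure lebesgue D"
    using emeasure_lebesgue_affine[of m "z0 - m *\<^sub>R z0" D] by (simp add: add.commute)
  then have "measure lebesgue ((\<lambda>y. (z0 - m *\<^sub>R z0) + m *\<^sub>R y) ` D) = m ^ CARD('n) * measure lebesgue D"
    using assms by (simp add: measure_def enn2real_mult)
  then show "measure lborel ((\<lambda>y. z0 + m *\<^sub>R (y - z0)) ` D) = m ^ CARD('n) * measure lborel D"
    using op assms unfolding e by (simp add: image_image)
qed

text \<open>
  The divergence theorem for a field that does not point outward, in the form of an inequality. At a
  corner, "not outward" is tested against the normals of all supporting hyperplanes. Moving \<open>D\<close> along the field for a time \<open>t\<close> changes its volume by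
  \<open>t \<integral> div w\<close> to first order, while the result lies in a dilation by \<open>1 + \<delta> t\<close> with \<open>\<delta>\<close> as small
  as desired.
\<close>

theorem integral_divergence_le_0:
  fixes w :: "real^'n \<Rightarrow> real^'n" and A :: "real^'n \<Rightarrow> real^'n^'n"
  assumes D: "open D" "convex D" "bounded D"
    and der: "\<And>x. x \<in> D \<Longrightarrow> (w has_derivative (\<lambda>v. A x *v v)) (at x)"
    and contA: "continuous_on D A" and bdA: "\<And>x. x \<in> D \<Longrightarrow> norm (A x) \<le> M"
    and cw: "continuous_on (closure D) w"
    and inw: "\<And>x \<nu>. x \<in> frontier D \<Longrightarrow> (\<And>z. z \<in> D \<Longrightarrow> \<nu> \<bullet> z \<le> \<nu> \<bullet> x) \<Longrightarrow> \<nu> \<bullet> w x \<le> 0"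
  shows "(LINT x:D|lborel. trace (A x)) \<le> 0"
proof (cases "D = {}")
  case False
  then obtain z0 where z0: "z0 \<in> D" by blast
  let ?I = "LINT x:D|lborel. trace (A x)" and ?m = "measure lborel D"
  obtain C t1 where C: "t1 > 0" "\<And>t B. 0 < t \<and> t < t1 \<and> open B \<and> bounded B \<and> (\<lambda>x. x + t *\<^sub>R w x) ` D \<subseteq> B \<Longrightarrow>
     ?m + t * ?I - C * t\<^sup>2 \<le> measure lborel B"
    using volume_of_perturbed_identity[OF D(1,3,2) der contA bdA] by blast
  have main: "?I \<le> real CARD('n) * \<delta> * ?m" if \<delta>: "\<delta> > 0" for \<delta>
  proof -
    obtain t0 where t0: "t0 > 0" "\<And>t x. 0 < t \<and> t < t0 \<and> x \<in> D \<Longrightarrow> z0 + (x + t *\<^sub>R w x - z0) /\<^sub>R (1 + \<delta> * t) \<in> D"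
      using flow_stays_in_dilation[OF D z0 cw inw \<delta>] by blast
    define t2 where "t2 = min t0 t1"
    have t2: "t2 > 0" using t0 C by (simp add: t2_def)
    have ineq: "?I \<le> ?m * (((1 + \<delta> * t) ^ CARD('n) - 1) / t) + C * t" if t: "0 < t" "t < t2" for t
    proof -
      let ?B = "(\<lambda>y. z0 + (1 + \<delta> * t) *\<^sub>R (y - z0)) ` D"
      have pos: "1 + \<delta> * t > 0" using \<delta> t by (simp add: add_pos_pos)
      have "(\<lambda>x. x + t *\<^sub>R w x) ` D \<subseteq> ?B"
      proof (rule image_subsetI)
        fix x assume "x \<in> D"
        then have "z0 + (x + t *\<^sub>R w x - z0) /\<^sub>R (1 + \<delta> * t) \<in> D" using t0(2) t by (simp add: t2_def)
        then show "x + t *\<^sub>R w x \<in> ?B" using pos by (intro image_eqI) auto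
      qed
      moreover have "bounded ?B"
        using bounded_translation[OF bounded_scaling[OF bounded_translation[OF D(3), of "-z0"], of "1 + \<delta> * t"], of z0]
        by (simp add: image_image)
      ultimately have "?m + t * ?I - C * t\<^sup>2 \<le> (1 + \<delta> * t) ^ CARD('n) * ?m"
        using C(2)[of t ?B] measure_dilation[OF D(1) pos, of z0] t by (simp add: t2_def)
      moreover have "t * (?m * (((1 + \<delta> * t) ^ CARD('n) - 1) / t) + C * t)
          = (1 + \<delta> * t) ^ CARD('n) * ?m - ?m + C * t\<^sup>2"
        using t by (simp add: field_simps power2_eq_square)
      ultimately have "t * ?I \<le> t * (?m * (((1 + \<delta> * t) ^ CARD('n) - 1) / t) + C * t)"
        by linarith
      then show ?thesis using t by simp
    qed
    have "((\<lambda>t. (1 + \<delta> * t) ^ CARD('n)) has_real_derivative real CARD('n) * \<delta>) (at 0)"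
      by (auto intro!: derivative_eq_intros)
    then have "((\<lambda>t. ((1 + \<delta> * t) ^ CARD('n) - 1) / t) \<longlongrightarrow> real CARD('n) * \<delta>) (at 0)"
      by (simp add: has_field_derivative_iff)
    then have "((\<lambda>t. ((1 + \<delta> * t) ^ CARD('n) - 1) / t) \<longlongrightarrow> real CARD('n) * \<delta>) (at_right 0)"
      by (rule tendsto_within_subset) auto
    then have lim: "((\<lambda>t. ?m * (((1 + \<delta> * t) ^ CARD('n) - 1) / t) + C * t) \<longlongrightarrow> ?m * (real CARD('n) * \<delta>) + C * 0) (at_right 0)"
      by (intro tendsto_intros)
    have "?I \<le> ?m * (real CARD('n) * \<delta>) + C * 0"
    proof (rule tendsto_lowerbound[OF lim])
      show "\<forall>\<^sub>F t in at_right 0. ?I \<le> ?m * (((1 + \<delta> * t) ^ CARD('n) - 1) / t) + C * t"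
        unfolding eventually_at_right_field using t2 ineq by blast
    qed simp
    then show ?thesis by (simp add: mult_ac)
  qed
  have "((\<lambda>\<delta>. real CARD('n) * \<delta> * ?m) \<longlongrightarrow> real CARD('n) * 0 * ?m) (at_right 0)"
    by (intro tendsto_intros)
  then have "?I \<le> real CARD('n) * 0 * ?m"
    by (rule tendsto_lowerbound) (use main in \<open>auto simp: eventually_at_right_field intro: exI[of _ 1]\<close>)
  then show ?thesis by simp
qed (simp add: set_lebesgue_integral_def)

section \<open>Fields tangent to the boundary of a convex set\<close>

lemma has_derivative_sequence:
  fixes f :: "'a::real_normed_vector \<Rightarrow> 'b::real_normed_vector"
  assumes f: "(f has_derivative f') (at x within S)"
    and p: "\<And>m. p m \<in> S" and t: "\<And>m. t m > (0::real)" "t \<longlonglongrightarrow> 0"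
    and v: "(\<lambda>m. (p m - x) /\<^sub>R t m) \<longlonglongrightarrow> v"
  shows "(\<lambda>m. (f (p m) - f x) /\<^sub>R t m) \<longlonglongrightarrow> f' v"
proof -
  have bl: "bounded_linear f'" using f by (rule has_derivative_bounded_linear)
  have px: "(\<lambda>m. p m - x) \<longlonglongrightarrow> 0"
  proof -
    have "(\<lambda>m. t m *\<^sub>R ((p m - x) /\<^sub>R t m)) \<longlonglongrightarrow> 0 *\<^sub>R v" by (intro tendsto_intros t v)
    then show ?thesis using t(1) by (simp add: order_less_imp_not_eq2)
  qed
  have lin: "(\<lambda>m. f' ((p m - x) /\<^sub>R t m)) \<longlonglongrightarrow> f' v" using bounded_linear.tendsto[OF bl v] .
  have nv: "(\<lambda>m. norm ((p m - x) /\<^sub>R t m)) \<longlonglongrightarrow> norm v" using v by (rule tendsto_norm)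
  then obtain K where K: "K > 0" "\<And>m. norm ((p m - x) /\<^sub>R t m) \<le> K"
    using convergent_imp_Bseq[of "\<lambda>m. (p m - x) /\<^sub>R t m"] v unfolding Bseq_def convergent_def by auto
  have "(\<lambda>m. (f (p m) - f x) /\<^sub>R t m - f' ((p m - x) /\<^sub>R t m)) \<longlonglongrightarrow> 0"
  proof (rule LIMSEQ_I)
    fix e :: real assume e: "e > 0"
    then obtain d where d: "d > 0" "\<And>y. y \<in> S \<Longrightarrow> norm (y - x) < d \<Longrightarrow>
        norm (f y - f x - f' (y - x)) \<le> e / (2 * K) * norm (y - x)"
      using f K(1) unfolding has_derivative_within_alt by (metis divide_pos_pos mult_pos_pos zero_less_numeral)
    obtain M where M: "\<And>m. m \<ge> M \<Longrightarrow> norm (p m - x) < d" using LIMSEQ_D[OF px d(1)] by auto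
    show "\<exists>M. \<forall>m\<ge>M. norm ((f (p m) - f x) /\<^sub>R t m - f' ((p m - x) /\<^sub>R t m) - 0) < e"
    proof (intro exI allI impI)
      fix m assume "m \<ge> M"
      have "f' ((p m - x) /\<^sub>R t m) = f' (p m - x) /\<^sub>R t m"
        by (rule linear_scale[OF bounded_linear.linear[OF bl]])
      then have "(f (p m) - f x) /\<^sub>R t m - f' ((p m - x) /\<^sub>R t m) = (f (p m) - f x - f' (p m - x)) /\<^sub>R t m"
        by (simp only: scaleR_diff_right)
      also have "norm \<dots> = norm (f (p m) - f x - f' (p m - x)) / t m" using t(1)[of m] by (simp add: divide_inverse mult.commute)
      also have "\<dots> \<le> (e / (2 * K) * norm (p m - x)) / t m"
        using d(2)[OF p M[OF \<open>m \<ge> M\<close>]] t(1)[of m] by (intro divide_right_mono) auto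
      also have "\<dots> = e / (2 * K) * norm ((p m - x) /\<^sub>R t m)"
      proof -
        have "norm ((p m - x) /\<^sub>R t m) = norm (p m - x) / t m"
          using t(1)[of m] by (simp add: divide_inverse mult.commute)
        then show ?thesis by (simp only: times_divide_eq_right)
      qed
      also have "\<dots> \<le> e / (2 * K) * K" using K e by (intro mult_left_mono) auto
      also have "\<dots> < e" using K e by simp
      finally show "norm ((f (p m) - f x) /\<^sub>R t m - f' ((p m - x) /\<^sub>R t m) - 0) < e" by simp
    qed
  qed
  from tendsto_add[OF this lin] show ?thesis by simp
qed

text \<open>
  The directions that enter \<open>\<Omega>\<close> from \<open>x\<close> form a convex cone. A direction outside this cone can be
  separated from it, and the separating functional is a supporting normal at \<open>x\<close>, hence equal to
  \<open>\<nu>\<close> up to scaling. So a direction with \<open>e \<bullet> \<nu> < 0\<close> lies in the cone.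
\<close>

lemma inward_direction_enters:
  fixes \<Omega> :: "'a::euclidean_space set"
  assumes \<Omega>: "open \<Omega>" "convex \<Omega>" "\<Omega> \<noteq> {}" and x: "x \<in> closure \<Omega>"
    and uniq: "\<And>\<mu>. norm \<mu> = 1 \<Longrightarrow> (\<And>z. z \<in> \<Omega> \<Longrightarrow> \<mu> \<bullet> z \<le> \<mu> \<bullet> x) \<Longrightarrow> \<mu> = \<nu>"
    and e: "e \<bullet> \<nu> < 0"
  shows "\<exists>\<tau>>0. \<forall>t. 0 < t \<and> t < \<tau> \<longrightarrow> x + t *\<^sub>R e \<in> \<Omega>"
proof -
  let ?K = "\<Union>t\<in>{0<..}. (\<lambda>z. t *\<^sub>R (z - x)) ` \<Omega>"
  have cone: "c *\<^sub>R k \<in> ?K" if k: "k \<in> ?K" and c: "c > 0" for c k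
  proof -
    obtain s z where s: "s > 0" "z \<in> \<Omega>" "k = s *\<^sub>R (z - x)" using k by auto
    have "c *\<^sub>R k = (c * s) *\<^sub>R (z - x)" by (simp add: s(3))
    then show ?thesis using s c by (intro UN_I[of "c * s"]) auto
  qed
  have conv: "convex ?K"
  proof (rule convexI)
    fix k l :: 'a and u v :: real
    assume kl: "k \<in> ?K" "l \<in> ?K" and uv: "0 \<le> u" "0 \<le> v" "u + v = 1"
    obtain s z where s: "s > 0" "z \<in> \<Omega>" "k = s *\<^sub>R (z - x)" using kl by auto
    obtain t y where t: "t > 0" "y \<in> \<Omega>" "l = t *\<^sub>R (y - x)" using kl by auto
    let ?q = "u * s + v * t"
    have q: "?q > 0" using uv s t by (smt (verit) mult_nonneg_nonneg mult_pos_pos)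
    have "(u * s / ?q) *\<^sub>R z + (v * t / ?q) *\<^sub>R y \<in> \<Omega>"
      using uv s t q by (intro convexD[OF \<Omega>(2)]) (auto simp: add_divide_distrib[symmetric])
    moreover have "u *\<^sub>R k + v *\<^sub>R l = ?q *\<^sub>R ((u * s / ?q) *\<^sub>R z + (v * t / ?q) *\<^sub>R y - x)"
    proof -
      have "?q *\<^sub>R ((u * s / ?q) *\<^sub>R z + (v * t / ?q) *\<^sub>R y - x) = (u * s) *\<^sub>R z + (v * t) *\<^sub>R y - ?q *\<^sub>R x"
        using q by (simp only: scaleR_add_right scaleR_diff_right scaleR_scaleR nonzero_mult_div_cancel_left
          times_divide_eq_right less_imp_neq[symmetric] simp_thms)
      also have "\<dots> = u *\<^sub>R k + v *\<^sub>R l" by (simp add: s(3) t(3) algebra_simps)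
      finally show ?thesis by simp
    qed
    ultimately show "u *\<^sub>R k + v *\<^sub>R l \<in> ?K" using q by (intro UN_I[of ?q]) auto
  qed
  have "e \<in> ?K"
  proof (rule ccontr)
    assume ne: "e \<notin> ?K"
    obtain z1 where "z1 \<in> \<Omega>" using \<Omega>(3) by blast
    then have "1 *\<^sub>R (z1 - x) \<in> ?K" by (intro UN_I[of 1] imageI) auto
    then have neK: "?K \<noteq> {}" by blast
    obtain a b where ab: "a \<noteq> 0" "\<forall>k\<in>?K. a \<bullet> k \<le> b" "a \<bullet> e \<ge> b"
    proof -
      have "?K \<inter> {e} = {}" using ne by blast
      from separating_hyperplane_sets[OF conv convex_singleton[of e] neK _ this]
      show ?thesis using that by blast
    qed
    have le0: "a \<bullet> k \<le> 0" if k: "k \<in> ?K" for k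
    proof (rule ccontr)
      assume p: "\<not> a \<bullet> k \<le> 0"
      then have "(\<bar>b\<bar> + 1) / (a \<bullet> k) > 0" by simp
      from cone[OF k this] have "a \<bullet> (((\<bar>b\<bar> + 1) / (a \<bullet> k)) *\<^sub>R k) \<le> b" using ab(2) by blast
      then show False using p by simp
    qed
    have b0: "b \<ge> 0"
    proof (rule ccontr)
      assume "\<not> b \<ge> 0"
      then have b: "b < 0" by simp
      obtain k where k: "k \<in> ?K" using neK by blast
      have c: "a \<bullet> (c *\<^sub>R k) \<le> b" if "c > 0" for c using ab(2) cone[OF k that] by blast
      have ak: "a \<bullet> k < 0" using c[of 1] b by simp
      have "a \<bullet> ((b / (2 * (a \<bullet> k))) *\<^sub>R k) \<le> b" using c ak b by (intro c divide_neg_neg) auto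
      then show False using ak b by (simp add: field_simps)
    qed
    have "a /\<^sub>R norm a = \<nu>"
    proof (rule uniq)
      show "norm (a /\<^sub>R norm a) = 1" using ab(1) by simp
      fix z assume "z \<in> \<Omega>"
      then have "1 *\<^sub>R (z - x) \<in> ?K" by (intro UN_I[of 1] imageI) auto
      then have "z - x \<in> ?K" by simp
      from le0[OF this] show "(a /\<^sub>R norm a) \<bullet> z \<le> (a /\<^sub>R norm a) \<bullet> x"
        by (simp add: inner_diff_right mult_left_mono)
    qed
    then have "a = norm a *\<^sub>R \<nu>" using ab(1) by auto
    then have "a \<bullet> e = norm a * (e \<bullet> \<nu>)" by (metis inner_commute inner_scaleR_left)
    then have "a \<bullet> e < 0" using ab(1) e by (simp add: mult_pos_neg)
    with ab(3) b0 show False by linarith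
  qed
  then obtain s z where s: "s > 0" "z \<in> \<Omega>" "e = s *\<^sub>R (z - x)" by auto
  show ?thesis
  proof (intro exI[of _ "1 / s"] conjI allI impI)
    show "1 / s > 0" using s by simp
    fix t assume t: "0 < t \<and> t < 1 / s"
    have "z \<in> interior \<Omega>" using s \<Omega> by (simp add: interior_open)
    from in_interior_closure_convex_segment[OF \<Omega>(2) this x]
    have seg: "open_segment z x \<subseteq> interior \<Omega>" .
    have "x \<noteq> z" using e s by auto
    moreover have "x + t *\<^sub>R e = (1 - t * s) *\<^sub>R x + (t * s) *\<^sub>R z" by (simp add: s(3) algebra_simps)
    moreover have "0 < t * s" "t * s < 1" using t s by (auto simp: field_simps)
    ultimately have "x + t *\<^sub>R e \<in> open_segment x z" unfolding in_segment(2) by blast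
    then show "x + t *\<^sub>R e \<in> \<Omega>" using seg interior_subset by (auto simp: open_segment_commute)
  qed
qed

lemma supporting_normals_converge:
  fixes \<Omega> :: "'a::euclidean_space set"
  assumes p: "p \<longlonglongrightarrow> x"
    and N: "\<And>m. norm (N m) = 1" "\<And>m z. z \<in> \<Omega> \<Longrightarrow> N m \<bullet> z \<le> N m \<bullet> p m"
    and uniq: "\<And>\<mu>. norm \<mu> = 1 \<Longrightarrow> (\<And>z. z \<in> \<Omega> \<Longrightarrow> \<mu> \<bullet> z \<le> \<mu> \<bullet> x) \<Longrightarrow> \<mu> = \<nu>"
  shows "\<exists>r. strict_mono r \<and> (\<lambda>m. N (r m :: nat)) \<longlonglongrightarrow> \<nu>"
proof -
  have "N m \<in> sphere 0 1" for m using N(1) by simp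
  then obtain l r where lr: "l \<in> sphere (0::'a) 1" "strict_mono r" "(N \<circ> r) \<longlonglongrightarrow> l"
    using compact_sphere[of "0::'a" 1] unfolding compact_def by meson
  have l: "(\<lambda>m. N (r m)) \<longlonglongrightarrow> l" using lr(3) by (simp add: o_def)
  have px: "(\<lambda>m. p (r m)) \<longlonglongrightarrow> x" using LIMSEQ_subseq_LIMSEQ[OF p lr(2)] by (simp add: o_def)
  have "l = \<nu>"
  proof (rule uniq)
    show "norm l = 1" using lr(1) by simp
    fix z assume "z \<in> \<Omega>"
    then show "l \<bullet> z \<le> l \<bullet> x"
      using N(2) by (intro LIMSEQ_le[OF tendsto_inner[OF l tendsto_const] tendsto_inner[OF l px]]) auto
  qed
  then show ?thesis using l lr(2) by blast
qed

text \<open>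
  For a smooth boundary, differentiating \<open>N \<bullet> a = 0\<close> along \<open>a\<close> gives
  \<open>N \<bullet> a' a = - II(a, a)\<close>, and the second fundamental form of a convex set is nonnegative. Here the
  derivative of the normal field is avoided: one follows boundary points
  \<open>p = x + t (a x - s N x)\<close> with \<open>t, s\<close> tending to 0 and \<open>s \<ge> 0\<close>. The supporting plane at \<open>p\<close> has
  \<open>x\<close> on its inner side, so \<open>N p \<bullet> a x \<ge> 0 = N p \<bullet> a p\<close>, and dividing the difference by \<open>t\<close> gives
  the claim.
\<close>

lemma tangent_field_second_fundamental_form:
  fixes \<Omega> :: "'a::euclidean_space set" and a :: "'a \<Rightarrow> 'a"
  assumes \<Omega>: "open \<Omega>" "convex \<Omega>" "\<Omega> \<noteq> {}" and U: "open U" and x: "x \<in> frontier \<Omega>" "x \<in> U"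
    and N: "\<And>p. p \<in> frontier \<Omega> \<inter> U \<Longrightarrow> norm (N p) = 1"
      "\<And>p z. p \<in> frontier \<Omega> \<inter> U \<Longrightarrow> z \<in> \<Omega> \<Longrightarrow> N p \<bullet> z \<le> N p \<bullet> p"
    and uniq: "\<And>\<mu>. norm \<mu> = 1 \<Longrightarrow> (\<And>z. z \<in> \<Omega> \<Longrightarrow> \<mu> \<bullet> z \<le> \<mu> \<bullet> x) \<Longrightarrow> \<mu> = N x"
    and der: "(a has_derivative a') (at x within (U \<inter> closure \<Omega>))"
    and tang: "\<And>p. p \<in> frontier \<Omega> \<inter> U \<Longrightarrow> N p \<bullet> a p = 0"
  shows "N x \<bullet> a' (a x) \<le> 0"
proof -
  define \<nu> where "\<nu> = N x"
  have \<nu>1: "norm \<nu> = 1" and \<nu>s: "\<And>z. z \<in> \<Omega> \<Longrightarrow> \<nu> \<bullet> z \<le> \<nu> \<bullet> x" and \<nu>a: "\<nu> \<bullet> a x = 0"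
    using N tang x by (auto simp: \<nu>_def)
  have \<nu>0: "\<nu> \<noteq> 0" using \<nu>1 by auto
  have xc: "x \<in> closure \<Omega>" using x by (simp add: frontier_def)
  define \<epsilon> where "\<epsilon> m = inverse (real (Suc m))" for m
  have \<epsilon>: "\<epsilon> m > 0" "\<epsilon> m \<le> 1" "\<epsilon> \<longlonglongrightarrow> 0" for m
    using LIMSEQ_inverse_real_of_nat by (auto simp: \<epsilon>_def[abs_def] divide_simps simp del: of_nat_Suc)
  \<comment> \<open>The segment joins the interior point \<open>x + t (a x - \<epsilon> m \<nu>)\<close> to a point of the supporting plane.\<close>
  have "\<exists>t s. 0 < t \<and> t \<le> \<epsilon> m \<and> 0 \<le> s \<and> s \<le> \<epsilon> m \<and> x + t *\<^sub>R (a x - s *\<^sub>R \<nu>) \<in> frontier \<Omega>" for m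
  proof -
    have "(a x - \<epsilon> m *\<^sub>R \<nu>) \<bullet> \<nu> < 0"
    proof -
      have "a x \<bullet> \<nu> = 0" "\<nu> \<bullet> \<nu> = 1" using \<nu>a \<nu>1 by (simp_all add: inner_commute dot_square_norm)
      then show ?thesis using \<epsilon>(1)[of m] by (simp add: inner_diff_left)
    qed
    then obtain \<tau> where \<tau>: "\<tau> > 0" "\<And>t. 0 < t \<Longrightarrow> t < \<tau> \<Longrightarrow> x + t *\<^sub>R (a x - \<epsilon> m *\<^sub>R \<nu>) \<in> \<Omega>"
      using inward_direction_enters[OF \<Omega> xc, of \<nu>] uniq unfolding \<nu>_def by blast
    define t where "t = min (\<tau> / 2) (\<epsilon> m)"
    have t: "0 < t" "t \<le> \<epsilon> m" "t < \<tau>" using \<tau> \<epsilon>(1)[of m] by (auto simp: t_def)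
    let ?in = "x + t *\<^sub>R (a x - \<epsilon> m *\<^sub>R \<nu>)" and ?out = "x + t *\<^sub>R a x"
    have "?out \<notin> \<Omega>"
    proof
      assume out: "?out \<in> \<Omega>"
      then have "?out \<in> frontier \<Omega>"
        using \<nu>s \<nu>a closure_subset by (intro supporting_point_in_frontier[OF \<Omega>(1) _ \<nu>0]) (auto simp: inner_add_right)
      with out \<Omega>(1) show False by (simp add: frontier_def interior_open)
    qed
    moreover have "?in \<in> \<Omega>" using \<tau>(2) t by blast
    ultimately have "closed_segment ?in ?out \<inter> frontier \<Omega> \<noteq> {}"
      by (intro connected_Int_frontier) (auto simp: connected_segment)
    then obtain q where q: "0 \<le> q" "q \<le> 1" "(1 - q) *\<^sub>R ?in + q *\<^sub>R ?out \<in> frontier \<Omega>"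
      by (auto simp: in_segment(1))
    have "(1 - q) *\<^sub>R ?in + q *\<^sub>R ?out = x + t *\<^sub>R (a x - ((1 - q) * \<epsilon> m) *\<^sub>R \<nu>)"
      by (simp add: algebra_simps)
    moreover have "(1 - q) * \<epsilon> m \<le> \<epsilon> m" "0 \<le> (1 - q) * \<epsilon> m"
      using q \<epsilon>(1)[of m] by (auto simp: mult_le_cancel_right1)
    ultimately show ?thesis using t q by metis
  qed
  then obtain t s where ts: "\<And>m. 0 < t m" "\<And>m. t m \<le> \<epsilon> m" "\<And>m. 0 \<le> s m" "\<And>m. s m \<le> \<epsilon> m"
     "\<And>m. x + t m *\<^sub>R (a x - s m *\<^sub>R \<nu>) \<in> frontier \<Omega>" by metis
  have t0: "t \<longlonglongrightarrow> 0"
    using ts(1,2) by (intro tendsto_sandwich[OF _ _ tendsto_const \<epsilon>(3)] always_eventually allI) (auto intro: less_imp_le)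
  have s0: "s \<longlonglongrightarrow> 0"
    using ts(3,4) by (intro tendsto_sandwich[OF _ _ tendsto_const \<epsilon>(3)] always_eventually allI) auto
  define p where "p m = x + t m *\<^sub>R (a x - s m *\<^sub>R \<nu>)" for m
  have px: "p \<longlonglongrightarrow> x"
  proof -
    have "(\<lambda>m. x + t m *\<^sub>R (a x - s m *\<^sub>R \<nu>)) \<longlonglongrightarrow> x + 0 *\<^sub>R (a x - 0 *\<^sub>R \<nu>)" by (intro tendsto_intros t0 s0)
    then show ?thesis by (simp add: p_def[abs_def])
  qed
  obtain M where M: "\<And>m. m \<ge> M \<Longrightarrow> p m \<in> U"
    using topological_tendstoD[OF px U x(2)] by (auto simp: eventually_sequentially)
  define p' where "p' m = p (m + M)" for m
  have p'x: "p' \<longlonglongrightarrow> x" unfolding p'_def using px by (rule LIMSEQ_ignore_initial_segment)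
  have p'f: "p' m \<in> frontier \<Omega> \<inter> U" for m using M ts(5) by (auto simp: p'_def p_def)
  obtain r where r: "strict_mono r" "(\<lambda>m. N (p' (r m))) \<longlonglongrightarrow> \<nu>"
    using supporting_normals_converge[OF p'x, of "\<lambda>m. N (p' m)" \<Omega> \<nu>] N p'f uniq by (auto simp: \<nu>_def)
  define k where "k m = r m + M" for m
  have k: "strict_mono k" using r(1) by (auto simp: k_def strict_mono_def)
  define n where "n m = N (p (k m))" for m
  have n: "n \<longlonglongrightarrow> \<nu>" using r(2) by (simp add: n_def[abs_def] p'_def k_def)
  have pk: "p (k m) \<in> frontier \<Omega> \<inter> U" for m using p'f[of "r m"] by (simp add: p'_def k_def)
  have tk: "(\<lambda>m. t (k m)) \<longlonglongrightarrow> 0" and sk: "(\<lambda>m. s (k m)) \<longlonglongrightarrow> 0"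
    using LIMSEQ_subseq_LIMSEQ[OF t0 k] LIMSEQ_subseq_LIMSEQ[OF s0 k] by (auto simp: o_def)
  have "(\<lambda>m. (a (p (k m)) - a x) /\<^sub>R t (k m)) \<longlonglongrightarrow> a' (a x)"
  proof (rule has_derivative_sequence[OF der])
    show "p (k m) \<in> U \<inter> closure \<Omega>" for m using pk[of m] by (auto simp: frontier_def)
    have "(\<lambda>m. a x - s (k m) *\<^sub>R \<nu>) \<longlonglongrightarrow> a x - 0 *\<^sub>R \<nu>" by (intro tendsto_intros sk)
    moreover have "(p (k m) - x) /\<^sub>R t (k m) = a x - s (k m) *\<^sub>R \<nu>" for m
      using ts(1)[of "k m"] by (simp add: p_def)
    ultimately show "(\<lambda>m. (p (k m) - x) /\<^sub>R t (k m)) \<longlonglongrightarrow> a x" by simp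
  qed (use ts tk in auto)
  then have lim: "(\<lambda>m. n m \<bullet> ((a (p (k m)) - a x) /\<^sub>R t (k m))) \<longlonglongrightarrow> \<nu> \<bullet> a' (a x)" by (intro tendsto_inner n)
  have "(\<lambda>m. n m \<bullet> \<nu>) \<longlonglongrightarrow> \<nu> \<bullet> \<nu>" by (intro tendsto_inner n tendsto_const)
  then have "\<forall>\<^sub>F m in sequentially. n m \<bullet> \<nu> > 0"
    using \<nu>1 by (intro order_tendstoD(1)) (auto simp: dot_square_norm)
  \<comment> \<open>Since \<open>x\<close> lies on the inner side of the supporting plane at \<open>p m\<close>, the vector \<open>a x\<close> does not point inward at \<open>p m\<close>.\<close>
  then have "\<forall>\<^sub>F m in sequentially. n m \<bullet> ((a (p (k m)) - a x) /\<^sub>R t (k m)) \<le> 0"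
  proof eventually_elim
    case (elim m)
    have "n m \<bullet> x \<le> n m \<bullet> p (k m)"
    proof -
      have "closure \<Omega> \<subseteq> {z. n m \<bullet> z \<le> n m \<bullet> p (k m)}"
        using N(2)[OF pk[of m]] by (intro closure_minimal closed_halfspace_le) (auto simp: n_def)
      then show ?thesis using xc by blast
    qed
    then have "0 \<le> t (k m) * (n m \<bullet> a x - s (k m) * (n m \<bullet> \<nu>))"
      by (simp add: p_def inner_add_right inner_diff_right)
    then have "s (k m) * (n m \<bullet> \<nu>) \<le> n m \<bullet> a x" using ts(1)[of "k m"] by (simp add: zero_le_mult_iff)
    then have "0 \<le> n m \<bullet> a x" using ts(3)[of "k m"] elim by (meson less_imp_le mult_nonneg_nonneg order_trans)
    moreover have "n m \<bullet> a (p (k m)) = 0" using tang[OF pk[of m]] by (simp add: n_def)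
    ultimately show ?case using ts(1)[of "k m"] by (simp add: inner_diff_right mult_le_0_iff zero_le_mult_iff)
  qed
  then have "\<nu> \<bullet> a' (a x) \<le> 0" by (intro tendsto_upperbound[OF lim]) auto
  then show ?thesis by (simp add: \<nu>_def)
qed

section \<open>Normals of smooth domains\<close>

lemma pd_eq_derivative:
  assumes "(f has_derivative f') (at x)"
  shows "pd i f x = f' (axis i 1)"
proof -
  have "((\<lambda>t. x + t *\<^sub>R axis i 1) has_vector_derivative axis i 1) (at (0::real))"
    by (auto intro!: derivative_eq_intros simp: has_vector_derivative_def)
  from vector_derivative_diff_chain_within[OF this, of f f']
  have "((\<lambda>t. f (x + t *\<^sub>R axis i 1)) has_vector_derivative f' (axis i 1)) (at (0::real))"
    using assms by (simp add: o_def has_derivative_at_withinI)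
  then show ?thesis unfolding pd_def by (rule vector_derivative_at)
qed

lemma has_derivative_pd:
  fixes f :: "real^'n \<Rightarrow> 'b::real_normed_vector"
  assumes "f differentiable (at x)"
  shows "(f has_derivative (\<lambda>v. \<Sum>i\<in>UNIV. v $ i *\<^sub>R pd i f x)) (at x)"
proof -
  obtain f' where f': "(f has_derivative f') (at x)" using assms by (auto simp: differentiable_def)
  have "f' v = (\<Sum>i\<in>UNIV. v $ i *\<^sub>R pd i f x)" for v
  proof -
    have lin: "linear f'" using f' has_derivative_bounded_linear bounded_linear.linear by blast
    have "v = (\<Sum>i\<in>UNIV. v $ i *\<^sub>R axis i 1)" using basis_expansion[of v] by (simp add: scalar_mult_eq_scaleR)
    then have "f' v = f' (\<Sum>i\<in>UNIV. v $ i *\<^sub>R axis i 1)" by simp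
    then show ?thesis by (simp add: linear_sum[OF lin] linear_scale[OF lin] pd_eq_derivative[OF f'])
  qed
  then have "f' = (\<lambda>v. \<Sum>i\<in>UNIV. v $ i *\<^sub>R pd i f x)" by (rule ext)
  with f' show ?thesis by simp
qed

text \<open>
  A direction \<open>e\<close> with \<open>e \<bullet> grad \<rho> x < 0\<close> leads into \<open>\<Omega>\<close>, so \<open>\<nu> \<bullet> e \<le> 0\<close>. A vector that is nonpositive on
  this open half space is a nonnegative multiple of the gradient: testing with the part of \<open>\<nu>\<close>
  orthogonal to the gradient, tilted slightly inward, yields equality in the Cauchy-Schwarz
  inequality.
\<close>

lemma supporting_normal_unique:
  fixes \<Omega> :: "(real^'n) set"
  assumes \<rho>: "local_defining_function \<Omega> x U \<rho>" and \<Omega>: "open \<Omega>" and x: "x \<in> frontier \<Omega>"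
    and \<nu>: "norm \<nu> = 1" "\<And>z. z \<in> \<Omega> \<Longrightarrow> \<nu> \<bullet> z \<le> \<nu> \<bullet> x"
  shows "\<nu> = grad \<rho> x /\<^sub>R norm (grad \<rho> x)"
proof -
  have U: "open U" "x \<in> U" and g0: "grad \<rho> x \<noteq> 0" and eq: "\<Omega> \<inter> U = {y\<in>U. \<rho> y < 0}"
    and sm: "smooth_on U \<rho>" using \<rho> by (auto simp: local_defining_function_def)
  let ?g = "grad \<rho> x"
  have diff: "\<rho> differentiable (at x)"
    using sm U unfolding smooth_on_def by (metis pds.simps(1) differentiable_on_eq_differentiable_at)
  have der: "(\<rho> has_derivative (\<lambda>v. v \<bullet> ?g)) (at x)"
    using has_derivative_pd[OF diff] by (simp add: inner_vec_def grad_def)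
  have \<rho>x: "\<rho> x = 0"
  proof (rule antisym)
    have c: "isCont \<rho> x" using diff differentiable_imp_continuous_within by blast
    have "x \<in> closure (U \<inter> \<Omega>)"
      using x U open_Int_closure_subset[of U \<Omega>] by (auto simp: frontier_def)
    then obtain s where s: "\<And>m. s m \<in> U \<inter> \<Omega>" "s \<longlonglongrightarrow> x" unfolding closure_sequential by blast
    have "(\<lambda>m. \<rho> (s m)) \<longlonglongrightarrow> \<rho> x" using isCont_tendsto_compose[OF c s(2)] .
    moreover have "\<rho> (s m) \<le> 0" for m
    proof -
      have "s m \<in> \<Omega> \<inter> U" using s(1)[of m] by blast
      then show ?thesis unfolding eq by simp
    qed
    ultimately show "\<rho> x \<le> 0" by (intro LIMSEQ_le_const2) auto
  next
    have "x \<notin> \<Omega> \<inter> U" using x \<Omega> by (simp add: frontier_def interior_open)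
    then show "0 \<le> \<rho> x" unfolding eq using U by simp
  qed
  have half: "\<nu> \<bullet> e \<le> 0" if e: "e \<bullet> ?g < 0" for e
  proof (rule ccontr)
    assume p: "\<not> \<nu> \<bullet> e \<le> 0"
    have line: "((\<lambda>t. x + t *\<^sub>R e) has_derivative (\<lambda>t. t *\<^sub>R e)) (at (0::real))"
      by (auto intro!: derivative_eq_intros)
    have "(\<rho> has_derivative (\<lambda>v. v \<bullet> ?g)) (at (x + 0 *\<^sub>R e))" using der by simp
    from has_derivative_compose[OF line this]
    have "((\<lambda>t. \<rho> (x + t *\<^sub>R e)) has_derivative (\<lambda>t. (t *\<^sub>R e) \<bullet> ?g)) (at 0)" .
    moreover have "(\<lambda>t. (t *\<^sub>R e) \<bullet> ?g) = (*) (e \<bullet> ?g)" by (auto simp: fun_eq_iff)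
    ultimately have "((\<lambda>t. \<rho> (x + t *\<^sub>R e)) has_real_derivative (e \<bullet> ?g)) (at 0)"
      by (simp add: has_field_derivative_def)
    from DERIV_neg_dec_right[OF this e] obtain d where d: "d > 0" "\<And>t. t > 0 \<Longrightarrow> t < d \<Longrightarrow> \<rho> (x + t *\<^sub>R e) < 0"
      using \<rho>x by auto
    have "((\<lambda>t. x + t *\<^sub>R e) \<longlongrightarrow> x + 0 *\<^sub>R e) (at_right 0)" by (intro tendsto_intros)
    then have "\<forall>\<^sub>F t in at_right 0. x + t *\<^sub>R e \<in> U" using topological_tendstoD U by fastforce
    moreover have "\<forall>\<^sub>F t in at_right 0. 0 < t \<and> t < d" using d(1) by (auto simp: eventually_at_right_field)
    ultimately have "\<forall>\<^sub>F t in at_right (0::real). False"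
    proof eventually_elim
      case (elim t)
      then have "x + t *\<^sub>R e \<in> \<Omega> \<inter> U" unfolding eq using d(2) by simp
      then have "x + t *\<^sub>R e \<in> \<Omega>" by blast
      from \<nu>(2)[OF this] have "t * (\<nu> \<bullet> e) \<le> 0" by (simp add: inner_add_right)
      then show False using p elim by (simp add: mult_le_0_iff)
    qed
    then show False by simp
  qed
  have n0: "norm ?g > 0" using g0 by simp
  have g\<nu>: "\<nu> \<bullet> ?g \<ge> 0"
  proof -
    have "(- ?g) \<bullet> ?g < 0" using g0 by simp
    from half[OF this] show ?thesis by simp
  qed
  \<comment> \<open>The left-hand side is the squared norm of the part of \<open>\<nu>\<close> orthogonal to the gradient.\<close>
  have "1 - (\<nu> \<bullet> ?g)\<^sup>2 / (?g \<bullet> ?g) \<le> 0"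
  proof (rule field_le_epsilon)
    fix \<epsilon> :: real assume "\<epsilon> > 0"
    define \<delta> where "\<delta> = \<epsilon> / (1 + \<nu> \<bullet> ?g)"
    have \<delta>: "\<delta> > 0" "\<delta> * (\<nu> \<bullet> ?g) \<le> \<epsilon>" using \<open>\<epsilon> > 0\<close> g\<nu> by (auto simp: \<delta>_def field_simps add_pos_nonneg)
    have gg: "?g \<bullet> ?g > 0" using g0 by simp
    define e where "e = \<nu> - ((\<nu> \<bullet> ?g) / (?g \<bullet> ?g)) *\<^sub>R ?g - \<delta> *\<^sub>R ?g"
    have "e \<bullet> ?g = - \<delta> * (?g \<bullet> ?g)" using gg by (simp add: e_def inner_diff_left)
    then have "\<nu> \<bullet> e \<le> 0" using half gg \<delta> by (simp add: mult_neg_pos)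
    moreover have "\<nu> \<bullet> e = 1 - (\<nu> \<bullet> ?g)\<^sup>2 / (?g \<bullet> ?g) - \<delta> * (\<nu> \<bullet> ?g)"
      using \<nu>(1) by (simp add: e_def inner_diff_right power2_eq_square dot_square_norm)
    ultimately show "1 - (\<nu> \<bullet> ?g)\<^sup>2 / (?g \<bullet> ?g) \<le> 0 + \<epsilon>" using \<delta> by linarith
  qed
  then have "1 \<le> (\<nu> \<bullet> ?g)\<^sup>2 / (?g \<bullet> ?g)" by linarith
  moreover have "?g \<bullet> ?g > 0" using g0 by simp
  ultimately have "(norm ?g)\<^sup>2 \<le> (\<nu> \<bullet> ?g)\<^sup>2"
    by (simp only: pos_le_divide_eq dot_square_norm mult_1)
  then have "norm ?g \<le> \<nu> \<bullet> ?g" using g\<nu> by (rule power2_le_imp_le)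
  moreover have "\<nu> \<bullet> ?g \<le> norm \<nu> * norm ?g" by (rule norm_cauchy_schwarz)
  ultimately have "\<nu> \<bullet> ?g = norm \<nu> * norm ?g" using \<nu>(1) by simp
  then have "norm \<nu> *\<^sub>R ?g = norm ?g *\<^sub>R \<nu>" by (simp only: norm_cauchy_schwarz_eq)
  then have "?g = norm ?g *\<^sub>R \<nu>" using \<nu>(1) by simp
  then have "?g /\<^sub>R norm ?g = (norm ?g *\<^sub>R \<nu>) /\<^sub>R norm ?g" by (rule arg_cong)
  then show ?thesis using n0 by simp
qed

section \<open>Partial derivatives up to the boundary\<close>

text \<open>
  Differentiability in the sense of Frechet, recorded by the partial derivatives, so that the rules
  below compute divergences directly. The set \<open>S\<close> allows one-sided derivatives at boundary points.
\<close>

definition has_partials ::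
  "(real^'n \<Rightarrow> 'b::real_normed_vector) \<Rightarrow> ('n \<Rightarrow> 'b) \<Rightarrow> real^'n \<Rightarrow> (real^'n) set \<Rightarrow> bool" where
  "has_partials f A x S \<longleftrightarrow> (f has_derivative (\<lambda>v. \<Sum>i\<in>UNIV. v $ i *\<^sub>R A i)) (at x within S)"

lemma has_partials_const: "has_partials (\<lambda>y. c) (\<lambda>i. 0) x S"
  by (simp add: has_partials_def)

lemma has_partials_add:
  "has_partials f A x S \<Longrightarrow> has_partials g B x S \<Longrightarrow> has_partials (\<lambda>y. f y + g y) (\<lambda>i. A i + B i) x S"
  unfolding has_partials_def by (drule (1) has_derivative_add) (simp add: scaleR_add_right sum.distrib)

lemma has_partials_diff:
  "has_partials f A x S \<Longrightarrow> has_partials g B x S \<Longrightarrow> has_partials (\<lambda>y. f y - g y) (\<lambda>i. A i - B i) x S"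
  unfolding has_partials_def by (drule (1) has_derivative_diff) (simp add: scaleR_diff_right sum_subtractf)

lemma has_partials_bounded_linear:
  assumes "bounded_linear T" "has_partials f A x S"
  shows "has_partials (\<lambda>y. T (f y)) (\<lambda>i. T (A i)) x S"
proof -
  have lin: "linear T" using assms(1) by (rule bounded_linear.linear)
  show ?thesis
    using bounded_linear.has_derivative[OF assms(1) assms(2)[unfolded has_partials_def]]
    unfolding has_partials_def by (simp add: linear_sum[OF lin] linear_scale[OF lin])
qed

lemmas has_partials_scaleR = has_partials_bounded_linear[OF bounded_linear_scaleR_right]
lemmas has_partials_mult_left = has_partials_bounded_linear[OF bounded_linear_mult_right]
lemmas has_partials_component = has_partials_bounded_linear[OF bounded_linear_vec_nth]

lemma has_partials_sum:
  assumes "\<And>k. k \<in> K \<Longrightarrow> has_partials (f k) (A k) x S"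
  shows "has_partials (\<lambda>y. \<Sum>k\<in>K. f k y) (\<lambda>i. \<Sum>k\<in>K. A k i) x S"
  using assms by (induction K rule: infinite_finite_induct) (simp_all add: has_partials_const has_partials_add)

lemma has_partials_inner:
  fixes f g :: "real^'n \<Rightarrow> 'b::real_inner"
  assumes "has_partials f A x S" "has_partials g B x S"
  shows "has_partials (\<lambda>y. f y \<bullet> g y) (\<lambda>i. A i \<bullet> g x + f x \<bullet> B i) x S"
  using has_derivative_inner[OF assms[unfolded has_partials_def]]
  unfolding has_partials_def
  by (simp add: inner_sum_left inner_sum_right sum.distrib[symmetric] distrib_left add.commute)

lemma has_partials_mult:
  fixes f g :: "real^'n \<Rightarrow> real"
  assumes "has_partials f A x S" "has_partials g B x S"
  shows "has_partials (\<lambda>y. f y * g y) (\<lambda>i. A i * g x + f x * B i) x S"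
  using has_partials_inner[OF assms] by simp

lemma has_partials_within: "has_partials f A x S \<Longrightarrow> T \<subseteq> S \<Longrightarrow> has_partials f A x T"
  unfolding has_partials_def by (rule has_derivative_subset)

lemma has_partials_vector:
  assumes "\<And>j. has_partials (\<lambda>y. f y $ j) (B j) x S"
  shows "(f has_derivative (\<lambda>v. (\<chi> j i. B j i) *v v)) (at x within S)"
proof -
  have "((\<lambda>y. f y \<bullet> b) has_derivative (\<lambda>v. ((\<chi> j i. B j i) *v v) \<bullet> b)) (at x within S)" if b: "b \<in> Basis" for b
  proof -
    obtain j where j: "b = axis j 1" using b by (auto simp: Basis_vec_def)
    show ?thesis using assms[of j]
      by (simp add: j has_partials_def inner_axis matrix_vector_mult_def mult.commute)
  qed
  then show ?thesis by (subst has_derivative_componentwise_within) blast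
qed

lemma has_partials_unique:
  assumes "has_partials f A x S" "has_partials g B x S" "open S" "x \<in> S" "\<And>y. y \<in> S \<Longrightarrow> f y = g y"
  shows "A i = B i"
proof -
  have f: "(f has_derivative (\<lambda>v. \<Sum>i\<in>UNIV. v $ i *\<^sub>R A i)) (at x)"
    and g: "(g has_derivative (\<lambda>v. \<Sum>i\<in>UNIV. v $ i *\<^sub>R B i)) (at x)"
    using assms at_within_open[OF assms(4,3)] by (auto simp: has_partials_def)
  have "(g has_derivative (\<lambda>v. \<Sum>i\<in>UNIV. v $ i *\<^sub>R A i)) (at x)"
    using has_derivative_transform_within_open[OF f assms(3,4)] assms(5) by blast
  from has_derivative_unique[OF this g]
  have "(\<Sum>k\<in>UNIV. (axis i 1 :: real^'a) $ k *\<^sub>R A k) = (\<Sum>k\<in>UNIV. (axis i 1 :: real^'a) $ k *\<^sub>R B k)" by metis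
  then show ?thesis by (simp add: axis_def if_distrib[of "\<lambda>c. c *\<^sub>R _"] cong: if_cong)
qed

lemma has_partials_continuous: "has_partials f A x S \<Longrightarrow> continuous (at x within S) f"
  unfolding has_partials_def by (rule has_derivative_continuous)

text \<open>
  If a function and its gradient extend continuously from a convex open set to boundary points, then
  the extended gradient is the derivative there: the mean value inequality on the convex set, applied
  to the function minus its linearisation at \<open>x\<close>, survives the passage to the limit.
\<close>

lemma has_partials_extend_to_closure:
  fixes g :: "real^'n \<Rightarrow> 'b::real_normed_vector"
  assumes D: "open D" "convex D" and E: "D \<subseteq> E" "E \<subseteq> closure D"
    and der: "\<And>y. y \<in> D \<Longrightarrow> has_partials g (\<lambda>i. g' i y) y D"
    and cg: "continuous_on E g" and cg': "\<And>i. continuous_on E (g' i)" and x: "x \<in> E"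
  shows "has_partials g (\<lambda>i. g' i x) x E"
proof -
  let ?L = "\<lambda>y v. \<Sum>i\<in>UNIV. v $ i *\<^sub>R g' i y"
  have bl: "bounded_linear (?L y)" for y
    by (intro bounded_linear_sum bounded_linear_compose[OF bounded_linear_scaleR_left bounded_linear_vec_nth])
  show ?thesis
    unfolding has_partials_def has_derivative_within_alt
  proof (intro conjI allI impI bl)
    fix e :: real assume e: "e > 0"
    define c where "c = e / real CARD('n)"
    have c: "c > 0" using e by (simp add: c_def)
    have "\<exists>d>0. \<forall>y\<in>E. dist y x < d \<longrightarrow> dist (g' i y) (g' i x) < c" for i
      using cg'[of i] x c unfolding continuous_on_iff by blast
    then obtain d where d: "\<And>i. d i > 0" "\<And>i y. y \<in> E \<Longrightarrow> dist y x < d i \<Longrightarrow> dist (g' i y) (g' i x) < c" by metis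
    define r where "r = Min (range d)"
    have r: "r > 0" "\<And>i. r \<le> d i" using d(1) by (auto simp: r_def)
    have bound: "norm (g y - g z - ?L x (y - z)) \<le> e * norm (y - z)"
      if yz: "y \<in> D \<inter> ball x r" "z \<in> D \<inter> ball x r" for y z
    proof -
      have "norm ((\<lambda>y. g y - ?L x y) y - (\<lambda>y. g y - ?L x y) z) \<le> e * norm (y - z)"
      proof (rule differentiable_bound[where f' = "\<lambda>\<xi> v. ?L \<xi> v - ?L x v", OF _ _ _ yz])
        show "convex (D \<inter> ball x r)" using D by (intro convex_Int) auto
        fix \<xi> assume \<xi>: "\<xi> \<in> D \<inter> ball x r"
        have "(g has_derivative ?L \<xi>) (at \<xi> within D \<inter> ball x r)"
          using has_partials_within[OF der[of \<xi>]] \<xi> unfolding has_partials_def by blast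
        then show "((\<lambda>y. g y - ?L x y) has_derivative (\<lambda>v. ?L \<xi> v - ?L x v)) (at \<xi> within D \<inter> ball x r)"
          by (intro has_derivative_diff bounded_linear_imp_has_derivative bl)
        show "onorm (\<lambda>v. ?L \<xi> v - ?L x v) \<le> e"
        proof (rule onorm_le)
          fix v :: "real^'n"
          have "?L \<xi> v - ?L x v = (\<Sum>i\<in>UNIV. v $ i *\<^sub>R (g' i \<xi> - g' i x))"
            by (simp add: scaleR_diff_right sum_subtractf)
          also have "norm \<dots> \<le> (\<Sum>i\<in>(UNIV :: 'n set). norm v * c)"
          proof (rule sum_norm_le)
            fix i
            have "norm (g' i \<xi> - g' i x) \<le> c"
              using d(2)[of \<xi> i] \<xi> E(1) r(2)[of i] by (force simp: dist_norm norm_minus_commute)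
            then show "norm (v $ i *\<^sub>R (g' i \<xi> - g' i x)) \<le> norm v * c"
              using component_le_norm_cart[of v i] by (simp add: mult_mono)
          qed
          also have "\<dots> = e * norm v" by (simp add: c_def)
          finally show "norm (?L \<xi> v - ?L x v) \<le> e * norm v" .
        qed
      qed
      moreover have "?L x (y - z) = ?L x y - ?L x z" by (simp add: scaleR_diff_left sum_subtractf)
      moreover have "g y - g z - (?L x y - ?L x z) = (g y - ?L x y) - (g z - ?L x z)" by simp
      ultimately show ?thesis by metis
    qed
    \<comment> \<open>Both points of the mean value estimate are moved to \<open>E\<close> along sequences in \<open>D\<close>.\<close>
    show "\<exists>d>0. \<forall>y\<in>E. norm (y - x) < d \<longrightarrow> norm (g y - g x - ?L x (y - x)) \<le> e * norm (y - x)"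
    proof (intro exI[of _ r] conjI ballI impI r(1))
      fix y assume y: "y \<in> E" "norm (y - x) < r"
      obtain p where p: "\<And>m. p m \<in> D" "p \<longlonglongrightarrow> y" using y E(2) closure_sequential by (metis subsetD)
      obtain q where q: "\<And>m. q m \<in> D" "q \<longlonglongrightarrow> x" using x E(2) closure_sequential by (metis subsetD)
      have "\<forall>\<^sub>F m in sequentially. p m \<in> ball x r" "\<forall>\<^sub>F m in sequentially. q m \<in> ball x r"
        using y r(1) topological_tendstoD[OF p(2), of "ball x r"] topological_tendstoD[OF q(2), of "ball x r"]
        by (auto simp: dist_norm norm_minus_commute)
      then have ev: "\<forall>\<^sub>F m in sequentially. norm (g (p m) - g (q m) - ?L x (p m - q m)) \<le> e * norm (p m - q m)"
        by eventually_elim (use bound p(1) q(1) in auto)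
      have gp: "(\<lambda>m. g (p m)) \<longlonglongrightarrow> g y" and gq: "(\<lambda>m. g (q m)) \<longlonglongrightarrow> g x"
        using p q y x E(1) by (auto intro!: continuous_on_tendsto_compose[OF cg] always_eventually)
      have "(\<lambda>m. ?L x (p m - q m)) \<longlonglongrightarrow> ?L x (y - x)"
        by (intro bounded_linear.tendsto[OF bl] tendsto_diff p q)
      then have 1: "(\<lambda>m. norm (g (p m) - g (q m) - ?L x (p m - q m))) \<longlonglongrightarrow> norm (g y - g x - ?L x (y - x))"
        by (intro tendsto_norm tendsto_diff gp gq)
      have 2: "(\<lambda>m. e * norm (p m - q m)) \<longlonglongrightarrow> e * norm (y - x)" by (intro tendsto_intros p q)
      show "norm (g y - g x - ?L x (y - x)) \<le> e * norm (y - x)"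
        using tendsto_le[OF sequentially_bot 2 1 ev] .
    qed
  qed
qed

text \<open>
  The mean value theorem applied twice to the second difference over a parallelogram. This difference
  is symmetric in the two directions, which is what makes the mixed derivatives equal.
\<close>

lemma double_difference_mean_value:
  fixes f fe fde :: "'a::real_vector \<Rightarrow> real"
  assumes h: "h > 0"
    and fe: "\<And>s t. 0 \<le> s \<Longrightarrow> s \<le> h \<Longrightarrow> 0 \<le> t \<Longrightarrow> t \<le> h \<Longrightarrow>
       ((\<lambda>r. f (x + r *\<^sub>R e + t *\<^sub>R d)) has_real_derivative fe (x + s *\<^sub>R e + t *\<^sub>R d)) (at s)"
    and fde: "\<And>s t. 0 \<le> s \<Longrightarrow> s \<le> h \<Longrightarrow> 0 \<le> t \<Longrightarrow> t \<le> h \<Longrightarrow>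
       ((\<lambda>r. fe (x + s *\<^sub>R e + r *\<^sub>R d)) has_real_derivative fde (x + s *\<^sub>R e + t *\<^sub>R d)) (at t)"
  shows "\<exists>s t. 0 < s \<and> s < h \<and> 0 < t \<and> t < h \<and>
     f (x + h *\<^sub>R e + h *\<^sub>R d) - f (x + h *\<^sub>R e) - f (x + h *\<^sub>R d) + f x = h * h * fde (x + s *\<^sub>R e + t *\<^sub>R d)"
proof -
  let ?\<phi> = "\<lambda>s. f (x + s *\<^sub>R e + h *\<^sub>R d) - f (x + s *\<^sub>R e + 0 *\<^sub>R d)"
  have "\<exists>s>0. s < h \<and> ?\<phi> h - ?\<phi> 0 = (h - 0) * (fe (x + s *\<^sub>R e + h *\<^sub>R d) - fe (x + s *\<^sub>R e + 0 *\<^sub>R d))"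
    using h by (intro MVT2 DERIV_diff fe) auto
  then obtain s where s: "0 < s" "s < h"
    "?\<phi> h - ?\<phi> 0 = h * (fe (x + s *\<^sub>R e + h *\<^sub>R d) - fe (x + s *\<^sub>R e + 0 *\<^sub>R d))" by auto
  have "\<exists>t>0. t < h \<and> fe (x + s *\<^sub>R e + h *\<^sub>R d) - fe (x + s *\<^sub>R e + 0 *\<^sub>R d) = (h - 0) * fde (x + s *\<^sub>R e + t *\<^sub>R d)"
    using h s by (intro MVT2 fde) auto
  then obtain t where t: "0 < t" "t < h"
    "fe (x + s *\<^sub>R e + h *\<^sub>R d) - fe (x + s *\<^sub>R e + 0 *\<^sub>R d) = h * fde (x + s *\<^sub>R e + t *\<^sub>R d)" by auto
  show ?thesis using s t by (intro exI[of _ s] exI[of _ t]) (simp add: algebra_simps)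
qed

lemma line_derivative:
  fixes f :: "'a::real_normed_vector \<Rightarrow> real"
  assumes "(f has_derivative f') (at (c + s *\<^sub>R e))"
  shows "((\<lambda>r. f (c + r *\<^sub>R e)) has_real_derivative f' e) (at s)"
proof -
  have line: "((\<lambda>t. c + t *\<^sub>R e) has_derivative (\<lambda>t. t *\<^sub>R e)) (at s)"
    by (auto intro!: derivative_eq_intros)
  have lin: "linear f'" using assms has_derivative_bounded_linear bounded_linear.linear by blast
  have "(\<lambda>t. f' (t *\<^sub>R e)) = (*) (f' e)" by (auto simp: fun_eq_iff linear_scale[OF lin])
  then show ?thesis using has_derivative_compose[OF line assms] by (simp add: has_field_derivative_def)
qed

lemma mixed_partials_commute_real:
  fixes f fe fd fde fed :: "'a::real_normed_vector \<Rightarrow> real"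
  assumes D: "open D" "x \<in> D"
    and f: "\<And>y. y \<in> D \<Longrightarrow> \<exists>f'. (f has_derivative f') (at y) \<and> f' e = fe y \<and> f' d = fd y"
    and fe: "\<And>y. y \<in> D \<Longrightarrow> \<exists>f'. (fe has_derivative f') (at y) \<and> f' d = fde y"
    and fd: "\<And>y. y \<in> D \<Longrightarrow> \<exists>f'. (fd has_derivative f') (at y) \<and> f' e = fed y"
    and c: "isCont fde x" "isCont fed x"
  shows "fde x = fed x"
proof -
  obtain \<epsilon> where \<epsilon>: "\<epsilon> > 0" "ball x \<epsilon> \<subseteq> D" using D openE by blast
  define K where "K = norm e + norm d + 1"
  have K: "K > 0" by (simp add: K_def add_nonneg_pos)
  define h where "h m = \<epsilon> / K * inverse (real (Suc m))" for m
  have h0: "h m > 0" for m using \<epsilon> K by (simp add: h_def)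
  have hK: "h m * K \<le> \<epsilon>" for m
  proof -
    have "h m * K = \<epsilon> * inverse (real (Suc m))" using K by (simp add: h_def)
    also have "\<dots> \<le> \<epsilon> * 1" using \<epsilon> by (intro mult_left_mono) (auto simp: divide_simps)
    finally show ?thesis by simp
  qed
  have hl: "h \<longlonglongrightarrow> 0"
    using tendsto_mult[OF tendsto_const[of "\<epsilon> / K"] LIMSEQ_inverse_real_of_nat] by (simp add: h_def[abs_def])
  have dist: "norm (s *\<^sub>R e + t *\<^sub>R d) < h m * K" if "0 \<le> s" "s \<le> h m" "0 \<le> t" "t \<le> h m" for s t m
  proof -
    have "norm (s *\<^sub>R e + t *\<^sub>R d) \<le> s * norm e + t * norm d" using that norm_triangle_ineq[of "s *\<^sub>R e" "t *\<^sub>R d"] by simp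
    also have "\<dots> \<le> h m * norm e + h m * norm d" using that by (intro add_mono mult_right_mono) auto
    also have "\<dots> < h m * K" using h0[of m] by (simp add: K_def distrib_left)
    finally show ?thesis .
  qed
  have inD: "x + s *\<^sub>R e + t *\<^sub>R d \<in> D" if "0 \<le> s" "s \<le> h m" "0 \<le> t" "t \<le> h m" for s t m
  proof (rule subsetD[OF \<epsilon>(2)])
    have "dist x (x + s *\<^sub>R e + t *\<^sub>R d) = norm (s *\<^sub>R e + t *\<^sub>R d)" by (metis add.assoc add_diff_cancel_left' dist_norm norm_minus_commute)
    then show "x + s *\<^sub>R e + t *\<^sub>R d \<in> ball x \<epsilon>" using dist[OF that] hK[of m] by simp
  qed
  have swap: "x + s *\<^sub>R e + t *\<^sub>R d = x + t *\<^sub>R d + s *\<^sub>R e" for s t by (simp add: algebra_simps)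
  have de1: "((\<lambda>r. f (x + r *\<^sub>R e + t *\<^sub>R d)) has_real_derivative fe (x + s *\<^sub>R e + t *\<^sub>R d)) (at s)"
    if st: "0 \<le> s" "s \<le> h m" "0 \<le> t" "t \<le> h m" for s t m
  proof -
    from f[OF inD[OF st]] obtain f' where f': "(f has_derivative f') (at (x + s *\<^sub>R e + t *\<^sub>R d))"
      "f' e = fe (x + s *\<^sub>R e + t *\<^sub>R d)" by blast
    from f'(1) have "(f has_derivative f') (at (x + t *\<^sub>R d + s *\<^sub>R e))" by (simp only: swap[of s t])
    from line_derivative[OF this] f'(2) show ?thesis by (simp only: swap[of _ t])
  qed
  have de2: "((\<lambda>r. fe (x + s *\<^sub>R e + r *\<^sub>R d)) has_real_derivative fde (x + s *\<^sub>R e + t *\<^sub>R d)) (at t)"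
    if st: "0 \<le> s" "s \<le> h m" "0 \<le> t" "t \<le> h m" for s t m
    using fe[OF inD[OF st]] line_derivative[where f = fe and c = "x + s *\<^sub>R e" and s = t and e = d] by metis
  have dd1: "((\<lambda>r. f (x + r *\<^sub>R d + t *\<^sub>R e)) has_real_derivative fd (x + s *\<^sub>R d + t *\<^sub>R e)) (at s)"
    if st: "0 \<le> s" "s \<le> h m" "0 \<le> t" "t \<le> h m" for s t m
  proof -
    from f[OF inD[OF st(3,4,1,2)]] obtain f' where f': "(f has_derivative f') (at (x + t *\<^sub>R e + s *\<^sub>R d))"
      "f' d = fd (x + t *\<^sub>R e + s *\<^sub>R d)" by blast
    from line_derivative[OF f'(1)] f'(2) show ?thesis by (simp only: swap[of t])
  qed
  have dd2: "((\<lambda>r. fd (x + s *\<^sub>R d + r *\<^sub>R e)) has_real_derivative fed (x + s *\<^sub>R d + t *\<^sub>R e)) (at t)"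
    if st: "0 \<le> s" "s \<le> h m" "0 \<le> t" "t \<le> h m" for s t m
  proof -
    from fd[OF inD[OF st(3,4,1,2)]] obtain f' where f': "(fd has_derivative f') (at (x + t *\<^sub>R e + s *\<^sub>R d))"
      "f' e = fed (x + t *\<^sub>R e + s *\<^sub>R d)" by blast
    from f'(1) have "(fd has_derivative f') (at (x + s *\<^sub>R d + t *\<^sub>R e))" by (simp only: swap[of t s])
    from line_derivative[OF this] f'(2) show ?thesis by (simp only: swap[of _ s])
  qed
  have "\<exists>p q. norm p < h m * K \<and> norm q < h m * K \<and> fde (x + p) = fed (x + q)" for m
  proof -
    obtain s t where st: "0 < s" "s < h m" "0 < t" "t < h m"
      "f (x + h m *\<^sub>R e + h m *\<^sub>R d) - f (x + h m *\<^sub>R e) - f (x + h m *\<^sub>R d) + f x = h m * h m * fde (x + s *\<^sub>R e + t *\<^sub>R d)"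
      using double_difference_mean_value[where f = f and fe = fe and fde = fde and x = x and e = e and d = d, OF h0[of m] de1[where m = m] de2[where m = m]]
      by blast
    obtain s' t' where st': "0 < s'" "s' < h m" "0 < t'" "t' < h m"
      "f (x + h m *\<^sub>R d + h m *\<^sub>R e) - f (x + h m *\<^sub>R d) - f (x + h m *\<^sub>R e) + f x = h m * h m * fed (x + s' *\<^sub>R d + t' *\<^sub>R e)"
      using double_difference_mean_value[where f = f and fe = fd and fde = fed and x = x and e = d and d = e, OF h0[of m] dd1[where m = m] dd2[where m = m]]
      by blast
    have "f (x + h m *\<^sub>R e + h m *\<^sub>R d) = f (x + h m *\<^sub>R d + h m *\<^sub>R e)" by (simp only: swap)
    with st(5) st'(5) have "h m * h m * fde (x + s *\<^sub>R e + t *\<^sub>R d) = h m * h m * fed (x + s' *\<^sub>R d + t' *\<^sub>R e)"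
      by linarith
    then have "fde (x + s *\<^sub>R e + t *\<^sub>R d) = fed (x + s' *\<^sub>R d + t' *\<^sub>R e)" using h0[of m] by simp
    then have "fde (x + (s *\<^sub>R e + t *\<^sub>R d)) = fed (x + (t' *\<^sub>R e + s' *\<^sub>R d))"
      by (simp only: add.assoc add.commute[of "t' *\<^sub>R e"])
    moreover have "norm (s *\<^sub>R e + t *\<^sub>R d) < h m * K" "norm (t' *\<^sub>R e + s' *\<^sub>R d) < h m * K"
      using st(1-4) st'(1-4) dist[of s m t] dist[of t' m s'] by simp_all
    ultimately show ?thesis by blast
  qed
  then obtain p q where pq: "\<And>m. norm (p m) < h m * K" "\<And>m. norm (q m) < h m * K" "\<And>m. fde (x + p m) = fed (x + q m)" by metis
  have hK0: "(\<lambda>m. h m * K) \<longlonglongrightarrow> 0" using tendsto_mult_right[OF hl, of K] by simp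
  have p0: "p \<longlonglongrightarrow> 0"
    using pq(1) by (intro Lim_null_comparison[OF always_eventually hK0] allI less_imp_le)
  have q0: "q \<longlonglongrightarrow> 0"
    using pq(2) by (intro Lim_null_comparison[OF always_eventually hK0] allI less_imp_le)
  have "(\<lambda>m. x + p m) \<longlonglongrightarrow> x" "(\<lambda>m. x + q m) \<longlonglongrightarrow> x"
    using tendsto_add[OF tendsto_const p0, of x] tendsto_add[OF tendsto_const q0, of x] by simp_all
  then have "(\<lambda>m. fde (x + p m)) \<longlonglongrightarrow> fde x" "(\<lambda>m. fed (x + q m)) \<longlonglongrightarrow> fed x"
    using isCont_tendsto_compose c by blast+
  then show ?thesis using pq(3) LIMSEQ_unique by simp
qed

lemma smooth_on_has_derivative:
  assumes "smooth_on D f" "open D" "x \<in> D"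
  shows "(pds is f has_derivative (\<lambda>v. \<Sum>i\<in>UNIV. v $ i *\<^sub>R pds (i # is) f x)) (at x)"
  using has_derivative_pd[of "pds is f" x] assms differentiable_on_eq_differentiable_at[of D]
  unfolding smooth_on_def by auto

lemma mixed_partials_commute:
  fixes f :: "real^'n \<Rightarrow> 'b::real_inner"
  assumes sm: "smooth_on D f" and D: "open D" "x \<in> D"
  shows "pds (i # j # is) f x = pds (j # i # is) f x"
proof -
  have "\<forall>b. pds (i # j # is) f x \<bullet> b = pds (j # i # is) f x \<bullet> b"
  proof
    fix b
    have "pds (j # i # is) f x \<bullet> b = pds (i # j # is) f x \<bullet> b"
  proof (rule mixed_partials_commute_real[OF D, where f = "\<lambda>y. pds is f y \<bullet> b" and e = "axis i 1" and d = "axis j 1"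
        and fe = "\<lambda>y. pds (i # is) f y \<bullet> b" and fd = "\<lambda>y. pds (j # is) f y \<bullet> b"])
    have der: "((\<lambda>y. pds is f y \<bullet> b) has_derivative (\<lambda>v. (\<Sum>i\<in>UNIV. v $ i *\<^sub>R pds (i # is) f y) \<bullet> b)) (at y)"
      if "y \<in> D" for y "is"
      using bounded_linear.has_derivative[OF bounded_linear_inner_left smooth_on_has_derivative[OF sm D(1) that, of "is"]] .
    have ax: "(\<Sum>k\<in>UNIV. (axis i 1 :: real^'n) $ k *\<^sub>R g k) = g i" for i and g :: "'n \<Rightarrow> 'b"
      by (simp add: axis_def if_distrib[of "\<lambda>c. c *\<^sub>R _"] cong: if_cong)
    fix y assume y: "y \<in> D"
    show "\<exists>f'. ((\<lambda>y. pds is f y \<bullet> b) has_derivative f') (at y) \<and> f' (axis i 1) = pds (i # is) f y \<bullet> b \<and> f' (axis j 1) = pds (j # is) f y \<bullet> b"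
      by (intro exI conjI, rule der[OF y]) (simp_all only: ax)
    show "\<exists>f'. ((\<lambda>y. pds (i # is) f y \<bullet> b) has_derivative f') (at y) \<and> f' (axis j 1) = pds (j # i # is) f y \<bullet> b"
      by (intro exI conjI, rule der[OF y]) (simp_all only: ax)
    show "\<exists>f'. ((\<lambda>y. pds (j # is) f y \<bullet> b) has_derivative f') (at y) \<and> f' (axis i 1) = pds (i # j # is) f y \<bullet> b"
      by (intro exI conjI, rule der[OF y]) (simp_all only: ax)
  next
    have "isCont (pds is f) x" for "is"
      using smooth_on_has_derivative[OF sm D] has_derivative_continuous by blast
    then show "isCont (\<lambda>y. pds (j # i # is) f y \<bullet> b) x" "isCont (\<lambda>y. pds (i # j # is) f y \<bullet> b) x"
      by (intro continuous_inner continuous_const; blast)+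
  qed
  then show "pds (i # j # is) f x \<bullet> b = pds (j # i # is) f x \<bullet> b" by (rule sym)
  qed
  then show ?thesis by (simp only: vector_eq_rdot)
qed

text \<open>
  The continuous extensions of all the partial derivatives, bundled in one family indexed by lists of
  directions, which is differentiable up to the boundary with the expected derivatives.
\<close>

lemma smooth_up_to_extension:
  fixes f :: "real^'n \<Rightarrow> 'b::real_inner"
  assumes D: "open D" "convex D" and E: "D \<subseteq> E" "E \<subseteq> closure D" and f: "smooth_up_to D E f"
  obtains F where "\<And>is x. x \<in> D \<Longrightarrow> F is x = pds is f x" "\<And>is. continuous_on E (F is)"
    "\<And>is x. x \<in> E \<Longrightarrow> has_partials (F is) (\<lambda>i. F (i # is) x) x E"
    "\<And>is i j x. x \<in> D \<Longrightarrow> F (i # j # is) x = F (j # i # is) x"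
proof -
  have sm: "smooth_on D f" and ex: "\<forall>is. \<exists>g. continuous_on E g \<and> (\<forall>x\<in>D. g x = pds is f x)"
    using f by (auto simp: smooth_up_to_def)
  from choice[OF ex] obtain F where F: "\<And>is. continuous_on E (F is)" "\<And>is x. x \<in> D \<Longrightarrow> F is x = pds is f x" by blast
  have "has_partials (F is) (\<lambda>i. F (i # is) x) x D" if "x \<in> D" for x "is"
  proof -
    have "(F is has_derivative (\<lambda>v. \<Sum>i\<in>UNIV. v $ i *\<^sub>R pds (i # is) f x)) (at x within D)"
      by (rule has_derivative_transform[OF that F(2)
            has_derivative_at_withinI[OF smooth_on_has_derivative[OF sm D(1) that]]])
    then show ?thesis using F(2)[OF that] by (simp only: has_partials_def)
  qed
  then have "has_partials (F is) (\<lambda>i. F (i # is) x) x E" if "x \<in> E" for x "is"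
    using that by (intro has_partials_extend_to_closure[OF D E] F)
  moreover have "F (i # j # is) x = F (j # i # is) x" if "x \<in> D" for i j x "is"
    using mixed_partials_commute[OF sm D(1) that] F(2)[OF that] by simp
  ultimately show ?thesis using that F by blast
qed

lemma boundary_value_eq:
  assumes "continuous_on E g" "\<And>y. y \<in> D \<Longrightarrow> f y = g y" "x \<in> E" "D \<subseteq> E" "x \<in> closure D" "x \<notin> D"
  shows "boundary_value D f x = g x"
proof -
  have "(g \<longlongrightarrow> g x) (at x within D)"
    using assms(1,3,4) by (meson continuous_on_def tendsto_within_subset)
  then have "(f \<longlongrightarrow> g x) (at x within D)"
    by (rule Lim_transform_eventually) (use assms(2) in \<open>auto simp: eventually_at_filter\<close>)
  moreover have "\<not> trivial_limit (at x within D)"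
    using assms(5,6) by (simp add: trivial_limit_within closure_def)
  ultimately show ?thesis unfolding boundary_value_def by (intro tendsto_Lim)
qed

section \<open>Algebra of the stress\<close>

lemma abs_le_add_of_square_le:
  fixes z x y :: real
  assumes "z\<^sup>2 \<le> 4 * x * y" "0 \<le> x" "0 \<le> y"
  shows "\<bar>z\<bar> \<le> x + y"
proof (rule power2_le_imp_le)
  have "0 \<le> (x - y)\<^sup>2" by simp
  then show "\<bar>z\<bar>\<^sup>2 \<le> (x + y)\<^sup>2" using assms(1) by (simp add: power2_eq_square algebra_simps)
qed (use assms in simp)

text \<open>
  Young's inequality with a weight: in applications \<open>r\<close> is a derivative of the cutoff, and \<open>x\<close> and \<open>y\<close>
  distribute it over the two factors.
\<close>

lemma scaled_inner_bound:
  fixes p q :: "'b::real_inner"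
  assumes r: "r\<^sup>2 \<le> 4 * x * y" and "0 \<le> x" "0 \<le> y"
  shows "\<bar>r * (p \<bullet> q)\<bar> \<le> x * (norm p)\<^sup>2 + y * (norm q)\<^sup>2"
proof (rule abs_le_add_of_square_le)
  have "(r * (p \<bullet> q))\<^sup>2 = r\<^sup>2 * (p \<bullet> q)\<^sup>2" by (simp add: power_mult_distrib)
  also have "\<dots> \<le> (4 * x * y) * ((norm p)\<^sup>2 * (norm q)\<^sup>2)"
    using assms Cauchy_Schwarz_ineq[of p q] by (intro mult_mono) (auto simp: dot_square_norm)
  finally show "(r * (p \<bullet> q))\<^sup>2 \<le> 4 * (x * (norm p)\<^sup>2) * (y * (norm q)\<^sup>2)" by (simp add: mult_ac)
qed (use assms in auto)

lemma norm_add_add_diff_square_le: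
  fixes a b c :: "'b::real_inner"
  shows "(norm (a + b - c))\<^sup>2 \<le> 3 * ((norm a)\<^sup>2 + (norm b)\<^sup>2 + (norm c)\<^sup>2)"
proof -
  have "0 \<le> (norm (a - b))\<^sup>2 + (norm (a + c))\<^sup>2 + (norm (b + c))\<^sup>2" by simp
  also have "\<dots> = 3 * ((norm a)\<^sup>2 + (norm b)\<^sup>2 + (norm c)\<^sup>2) - (norm (a + b - c))\<^sup>2"
    by (simp add: power2_norm_eq_inner inner_add_left inner_add_right inner_diff_left inner_diff_right inner_commute)
  finally show ?thesis by simp
qed

text \<open>
  The entry \<open>(b, k)\<close> of \<open>Du + \<mu> [Du]\<^sup>T - \<phi> I\<close>, where \<open>G b k\<close> stands for \<open>\<partial>\<^sub>k u\<^sub>b\<close>. The definition is linear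
  in \<open>(G, \<phi>)\<close>, so with \<open>\<partial>\<^sub>i G\<close> and \<open>\<partial>\<^sub>i \<phi>\<close> in place of \<open>G\<close> and \<open>\<phi>\<close> it is \<open>\<partial>\<^sub>i\<close> of that entry. In what
  follows \<open>H b j k\<close> stands for \<open>\<partial>\<^sub>j \<partial>\<^sub>k u\<^sub>b\<close> and \<open>P j\<close> for \<open>\<partial>\<^sub>j \<phi>\<close>.
\<close>

definition stress :: "real \<Rightarrow> ('n \<Rightarrow> 'n \<Rightarrow> 'b::real_vector) \<Rightarrow> 'b \<Rightarrow> 'n \<Rightarrow> 'n \<Rightarrow> 'b" where
  "stress \<mu> G \<phi> b k = G b k + \<mu> *\<^sub>R G k b - (if b = k then \<phi> else 0)"

lemma sum_norm_stress_le:
  fixes G :: "'n::finite \<Rightarrow> 'n \<Rightarrow> 'b::real_inner"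
  assumes "\<bar>\<mu>\<bar> \<le> 1"
  shows "(\<Sum>b\<in>UNIV. \<Sum>k\<in>UNIV. (norm (stress \<mu> G \<phi> b k))\<^sup>2)
     \<le> 6 * (\<Sum>b\<in>UNIV. \<Sum>k\<in>UNIV. (norm (G b k))\<^sup>2) + 3 * real CARD('n) * (norm \<phi>)\<^sup>2"
proof -
  have 1: "(norm (stress \<mu> G \<phi> b k))\<^sup>2
      \<le> 3 * (norm (G b k))\<^sup>2 + 3 * (norm (G k b))\<^sup>2 + (if b = k then 3 * (norm \<phi>)\<^sup>2 else 0)" for b k
  proof -
    have "(norm (\<mu> *\<^sub>R G k b))\<^sup>2 \<le> (norm (G k b))\<^sup>2"
      using assms by (simp add: power_mult_distrib mult_left_le_one_le abs_square_le_1)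
    moreover define z where "z = (if b = k then \<phi> else 0)"
    moreover define m where "m = \<mu> *\<^sub>R G k b"
    ultimately have m: "(norm m)\<^sup>2 \<le> (norm (G k b))\<^sup>2" by (simp only: m_def)
    have "(norm (G b k + m - z))\<^sup>2 \<le> 3 * (norm (G b k))\<^sup>2 + 3 * (norm (G k b))\<^sup>2 + 3 * (norm z)\<^sup>2"
    proof -
      have "p \<le> 3 * q + 3 * s + 3 * t" if "p \<le> 3 * (q + r + t)" "r \<le> s" for p q r s t :: real
        using that by simp
      from this[OF norm_add_add_diff_square_le m] show ?thesis .
    qed
    then have "(norm (stress \<mu> G \<phi> b k))\<^sup>2
      \<le> 3 * (norm (G b k))\<^sup>2 + 3 * (norm (G k b))\<^sup>2 + 3 * (norm z)\<^sup>2"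
      by (simp only: stress_def z_def m_def)
    then show ?thesis by (simp add: z_def split: if_splits)
  qed
  have "(\<Sum>b\<in>UNIV. \<Sum>k\<in>UNIV. (norm (stress \<mu> G \<phi> b k))\<^sup>2)
     \<le> (\<Sum>b\<in>UNIV. \<Sum>k\<in>UNIV. 3 * (norm (G b k))\<^sup>2 + 3 * (norm (G k b))\<^sup>2 + (if b = k then 3 * (norm \<phi>)\<^sup>2 else 0))"
    by (intro sum_mono 1)
  also have "\<dots> = 3 * (\<Sum>b\<in>UNIV. \<Sum>k\<in>UNIV. (norm (G b k))\<^sup>2) + 3 * (\<Sum>b\<in>UNIV. \<Sum>k\<in>UNIV. (norm (G k b))\<^sup>2)
       + 3 * real CARD('n) * (norm \<phi>)\<^sup>2"
    by (simp add: sum.distrib sum_distrib_left)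
  also have "(\<Sum>b\<in>UNIV. \<Sum>k\<in>UNIV. (norm (G k b))\<^sup>2) = (\<Sum>b\<in>UNIV. \<Sum>k\<in>UNIV. (norm (G b k))\<^sup>2)" by (rule sum.swap)
  finally show ?thesis by simp
qed

text \<open>
  The pressure part of the stress is orthogonal to \<open>G\<close>, as \<open>G\<close> has trace 0.
\<close>

lemma sum_inner_stress:
  fixes G :: "'n::finite \<Rightarrow> 'n \<Rightarrow> 'b::real_inner"
  assumes "(\<Sum>k\<in>UNIV. G k k) = 0" "\<bar>\<mu>\<bar> \<le> 1"
  shows "(\<Sum>b\<in>UNIV. \<Sum>k\<in>UNIV. G b k \<bullet> stress \<mu> G \<phi> b k) \<ge> (1 - \<bar>\<mu>\<bar>) * (\<Sum>b\<in>UNIV. \<Sum>k\<in>UNIV. (norm (G b k))\<^sup>2)"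
proof -
  have e: "G b k \<bullet> stress \<mu> G \<phi> b k = (norm (G b k))\<^sup>2 + \<mu> * (G b k \<bullet> G k b) - (if b = k then G b k \<bullet> \<phi> else 0)" for b k
    by (simp add: stress_def inner_add_right inner_diff_right power2_norm_eq_inner)
  have le: "\<bar>\<mu> * (G b k \<bullet> G k b)\<bar> \<le> (\<bar>\<mu>\<bar> / 2) * (norm (G b k))\<^sup>2 + (\<bar>\<mu>\<bar> / 2) * (norm (G k b))\<^sup>2" for b k
    by (rule scaled_inner_bound) (auto simp: power2_eq_square)
  have "(\<Sum>b\<in>UNIV. \<Sum>k\<in>UNIV. if b = k then G b k \<bullet> \<phi> else 0) = (\<Sum>b\<in>UNIV. G b b) \<bullet> \<phi>"
    by (simp add: inner_sum_left)
  then have z: "(\<Sum>b\<in>UNIV. \<Sum>k\<in>UNIV. if b = k then G b k \<bullet> \<phi> else 0) = 0" using assms(1) by simp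
  have "(\<Sum>b\<in>UNIV. \<Sum>k\<in>UNIV. (norm (G b k))\<^sup>2 - ((\<bar>\<mu>\<bar> / 2) * (norm (G b k))\<^sup>2 + (\<bar>\<mu>\<bar> / 2) * (norm (G k b))\<^sup>2))
     \<le> (\<Sum>b\<in>UNIV. \<Sum>k\<in>UNIV. (norm (G b k))\<^sup>2 + \<mu> * (G b k \<bullet> G k b))"
  proof (intro sum_mono)
    fix b k
    show "(norm (G b k))\<^sup>2 - ((\<bar>\<mu>\<bar> / 2) * (norm (G b k))\<^sup>2 + (\<bar>\<mu>\<bar> / 2) * (norm (G k b))\<^sup>2)
      \<le> (norm (G b k))\<^sup>2 + \<mu> * (G b k \<bullet> G k b)" using le[of b k] by linarith
  qed
  also have "\<dots> = (\<Sum>b\<in>UNIV. \<Sum>k\<in>UNIV. G b k \<bullet> stress \<mu> G \<phi> b k)"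
    unfolding e sum_subtractf z by simp
  finally have "(\<Sum>b\<in>UNIV. \<Sum>k\<in>UNIV. (norm (G b k))\<^sup>2)
      - ((\<bar>\<mu>\<bar> / 2) * (\<Sum>b\<in>UNIV. \<Sum>k\<in>UNIV. (norm (G b k))\<^sup>2) + (\<bar>\<mu>\<bar> / 2) * (\<Sum>b\<in>UNIV. \<Sum>k\<in>UNIV. (norm (G k b))\<^sup>2))
     \<le> (\<Sum>b\<in>UNIV. \<Sum>k\<in>UNIV. G b k \<bullet> stress \<mu> G \<phi> b k)"
    by (simp only: sum_subtractf sum.distrib sum_distrib_left)
  also have "(\<Sum>b\<in>UNIV. \<Sum>k\<in>UNIV. (norm (G k b))\<^sup>2) = (\<Sum>b\<in>UNIV. \<Sum>k\<in>UNIV. (norm (G b k))\<^sup>2)" by (rule sum.swap)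
  finally show ?thesis by (simp add: left_diff_distrib)
qed

text \<open>
  The sum of \<open>\<partial>\<^sub>j T\<^sub>b\<^sub>k \<bullet> \<partial>\<^sub>k T\<^sub>b\<^sub>j\<close> over all indices. Three of the four products of second derivatives of
  \<open>u\<close> reduce to the same sum by the symmetry of \<open>H\<close>. The products with the pressure gradient contain
  either the gradient of \<open>div u\<close>, which vanishes, or the Laplacian of \<open>u\<close>.
\<close>

lemma stress_derivative_identity:
  fixes H :: "'n::finite \<Rightarrow> 'n \<Rightarrow> 'n \<Rightarrow> 'b::real_inner"
  assumes sym: "\<And>b j k. H b j k = H b k j" and div: "\<And>j. (\<Sum>k\<in>UNIV. H k j k) = 0"
  shows "(\<Sum>b\<in>UNIV. \<Sum>k\<in>UNIV. \<Sum>j\<in>UNIV. stress \<mu> (\<lambda>b. H b j) (P j) b k \<bullet> stress \<mu> (\<lambda>b. H b k) (P k) b j)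
    = (\<Sum>b\<in>UNIV. \<Sum>j\<in>UNIV. \<Sum>k\<in>UNIV. (norm (H b j k))\<^sup>2)
      + (2 * \<mu> + \<mu>\<^sup>2) * (\<Sum>b\<in>UNIV. \<Sum>j\<in>UNIV. \<Sum>k\<in>UNIV. H b j k \<bullet> H j b k)
      - 2 * \<mu> * (\<Sum>j\<in>UNIV. P j \<bullet> (\<Sum>k\<in>UNIV. H j k k)) + (\<Sum>j\<in>UNIV. (norm (P j))\<^sup>2)"
    (is "?lhs = ?A + _ * ?B - _ * ?X + ?P2")
proof -
  have e: "stress \<mu> (\<lambda>b. H b j) (P j) b k \<bullet> stress \<mu> (\<lambda>b. H b k) (P k) b j
    = (norm (H b k j))\<^sup>2 + \<mu> * (H b k j \<bullet> H j k b) + \<mu> * (H k j b \<bullet> H b k j) + \<mu> * \<mu> * (H k j b \<bullet> H j k b)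
      - (if b = j then H b k j \<bullet> P k else 0) - \<mu> * (if b = j then H k j b \<bullet> P k else 0)
      - (if b = k then P j \<bullet> H b k j else 0) - \<mu> * (if b = k then P j \<bullet> H j k b else 0)
      + (if b = k then if b = j then P j \<bullet> P k else 0 else 0)" for b j k
    unfolding stress_def sym[of b j k]
    by (simp add: inner_add_left inner_add_right inner_diff_left inner_diff_right
        power2_norm_eq_inner algebra_simps)
  have 2: "(\<Sum>b\<in>UNIV. \<Sum>k\<in>UNIV. \<Sum>j\<in>UNIV. H b k j \<bullet> H j k b) = ?B"
  proof -
    have "(\<Sum>b\<in>UNIV. \<Sum>k\<in>UNIV. \<Sum>j\<in>UNIV. H b k j \<bullet> H j k b) = (\<Sum>b\<in>UNIV. \<Sum>k\<in>UNIV. \<Sum>j\<in>UNIV. H b j k \<bullet> H j b k)"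
      using sym by (intro sum.cong refl) metis
    also have "\<dots> = ?B" by (rule sum.cong[OF refl sum.swap])
    finally show ?thesis .
  qed
  have 3: "(\<Sum>b\<in>UNIV. \<Sum>k\<in>UNIV. \<Sum>j\<in>UNIV. H k j b \<bullet> H b k j) = ?B"
    using sym by (intro sum.cong refl) (metis inner_commute)
  have 4: "(\<Sum>b\<in>UNIV. \<Sum>k\<in>UNIV. \<Sum>j\<in>UNIV. H k j b \<bullet> H j k b) = ?B"
  proof -
    have "(\<Sum>b\<in>UNIV. \<Sum>k\<in>UNIV. \<Sum>j\<in>UNIV. H k j b \<bullet> H j k b) = (\<Sum>k\<in>UNIV. \<Sum>b\<in>UNIV. \<Sum>j\<in>UNIV. H k j b \<bullet> H j k b)"
      by (rule sum.swap)
    also have "\<dots> = ?B" by (rule sum.cong[OF refl sum.swap])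
    finally show ?thesis .
  qed
  have 5: "(\<Sum>b\<in>UNIV. \<Sum>k\<in>UNIV. \<Sum>j\<in>UNIV. if b = j then H b k j \<bullet> P k else 0) = 0"
  proof -
    have "(\<Sum>b\<in>UNIV. \<Sum>k\<in>UNIV. \<Sum>j\<in>UNIV. if b = j then H b k j \<bullet> P k else 0) = (\<Sum>b\<in>UNIV. \<Sum>k\<in>UNIV. H b k b \<bullet> P k)" by simp
    also have "\<dots> = (\<Sum>k\<in>UNIV. \<Sum>b\<in>UNIV. H b k b \<bullet> P k)" by (rule sum.swap)
    also have "\<dots> = 0" by (simp add: inner_sum_left[symmetric] div)
    finally show ?thesis .
  qed
  have 6: "(\<Sum>b\<in>UNIV. \<Sum>k\<in>UNIV. \<Sum>j\<in>UNIV. if b = j then H k j b \<bullet> P k else 0) = ?X"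
  proof -
    have "(\<Sum>b\<in>UNIV. \<Sum>k\<in>UNIV. \<Sum>j\<in>UNIV. if b = j then H k j b \<bullet> P k else 0) = (\<Sum>b\<in>UNIV. \<Sum>k\<in>UNIV. H k b b \<bullet> P k)" by simp
    also have "\<dots> = (\<Sum>k\<in>UNIV. \<Sum>b\<in>UNIV. H k b b \<bullet> P k)" by (rule sum.swap)
    also have "\<dots> = (\<Sum>k\<in>UNIV. (\<Sum>b\<in>UNIV. H k b b) \<bullet> P k)" by (simp add: inner_sum_left)
    also have "\<dots> = ?X" by (rule sum.cong[OF refl inner_commute])
    finally show ?thesis .
  qed
  have row: "(\<Sum>k\<in>UNIV. \<Sum>j\<in>UNIV. if b = k then f k j else 0) = (\<Sum>j\<in>UNIV. f b j)" for b :: 'n and f :: "'n \<Rightarrow> 'n \<Rightarrow> real"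
  proof -
    have "(\<Sum>k\<in>UNIV. \<Sum>j\<in>UNIV. if b = k then f k j else 0) = (\<Sum>k\<in>UNIV. if b = k then \<Sum>j\<in>UNIV. f k j else 0)"
      by (rule sum.cong) auto
    then show ?thesis by simp
  qed
  have 7: "(\<Sum>b\<in>UNIV. \<Sum>k\<in>UNIV. \<Sum>j\<in>UNIV. if b = k then P j \<bullet> H b k j else 0) = 0"
  proof -
    have "(\<Sum>b\<in>UNIV. \<Sum>k\<in>UNIV. \<Sum>j\<in>UNIV. if b = k then P j \<bullet> H b k j else 0) = (\<Sum>b\<in>UNIV. \<Sum>j\<in>UNIV. P j \<bullet> H b b j)"
      by (rule sum.cong[OF refl row])
    also have "\<dots> = (\<Sum>j\<in>UNIV. \<Sum>b\<in>UNIV. P j \<bullet> H b b j)" by (rule sum.swap)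
    also have "\<dots> = (\<Sum>j\<in>UNIV. \<Sum>b\<in>UNIV. P j \<bullet> H b j b)" using sym by (intro sum.cong refl) metis
    also have "\<dots> = 0" by (simp add: inner_sum_right[symmetric] div)
    finally show ?thesis .
  qed
  have 8: "(\<Sum>b\<in>UNIV. \<Sum>k\<in>UNIV. \<Sum>j\<in>UNIV. if b = k then P j \<bullet> H j k b else 0) = ?X"
  proof -
    have "(\<Sum>b\<in>UNIV. \<Sum>k\<in>UNIV. \<Sum>j\<in>UNIV. if b = k then P j \<bullet> H j k b else 0) = (\<Sum>b\<in>UNIV. \<Sum>j\<in>UNIV. P j \<bullet> H j b b)"
      by (rule sum.cong[OF refl row])
    also have "\<dots> = (\<Sum>j\<in>UNIV. \<Sum>b\<in>UNIV. P j \<bullet> H j b b)" by (rule sum.swap)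
    finally show ?thesis by (simp add: inner_sum_right)
  qed
  have 9: "(\<Sum>b\<in>UNIV. \<Sum>k\<in>UNIV. \<Sum>j\<in>UNIV. if b = k then if b = j then P j \<bullet> P k else 0 else 0) = ?P2"
  proof (rule sum.cong[OF refl])
    fix b
    have "(\<Sum>k\<in>UNIV. \<Sum>j\<in>UNIV. if b = k then if b = j then P j \<bullet> P k else 0 else 0)
        = (\<Sum>j\<in>UNIV. if b = j then P j \<bullet> P b else 0)" by (rule row)
    then show "(\<Sum>k\<in>UNIV. \<Sum>j\<in>UNIV. if b = k then if b = j then P j \<bullet> P k else 0 else 0) = (norm (P b))\<^sup>2"
      by (simp add: power2_norm_eq_inner)
  qed
  show ?thesis
    unfolding e
    by (simp only: sum.distrib sum_subtractf sum_distrib_left[symmetric] 2 3 4 5 6 7 8 9)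
      (simp add: algebra_simps power2_eq_square)
qed

text \<open>
  The Laplacian is replaced by \<open>F + P\<close> with the help of the equation; this turns the factor 1 of
  \<open>|P|\<^sup>2\<close> into \<open>1 - 2 \<mu>\<close>.
\<close>

lemma stress_derivative_coercive:
  fixes H :: "'n::finite \<Rightarrow> 'n \<Rightarrow> 'n \<Rightarrow> 'b::real_inner"
  assumes sym: "\<And>b j k. H b j k = H b k j" and div: "\<And>j. (\<Sum>k\<in>UNIV. H k j k) = 0"
    and lap: "\<And>b. (\<Sum>k\<in>UNIV. H b k k) = F b + P b" and \<tau>: "1 - 2 * \<mu> > 0"
  shows "(\<Sum>b\<in>UNIV. \<Sum>k\<in>UNIV. \<Sum>j\<in>UNIV. stress \<mu> (\<lambda>b. H b j) (P j) b k \<bullet> stress \<mu> (\<lambda>b. H b k) (P k) b j)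
    \<ge> (1 - \<bar>2 * \<mu> + \<mu>\<^sup>2\<bar>) * (\<Sum>b\<in>UNIV. \<Sum>j\<in>UNIV. \<Sum>k\<in>UNIV. (norm (H b j k))\<^sup>2)
      + ((1 - 2 * \<mu>) / 2) * (\<Sum>j\<in>UNIV. (norm (P j))\<^sup>2) - (2 * \<mu>\<^sup>2 / (1 - 2 * \<mu>)) * (\<Sum>j\<in>UNIV. (norm (F j))\<^sup>2)"
proof -
  let ?A = "\<Sum>b\<in>UNIV. \<Sum>j\<in>UNIV. \<Sum>k\<in>UNIV. (norm (H b j k))\<^sup>2"
  let ?B = "\<Sum>b\<in>UNIV. \<Sum>j\<in>UNIV. \<Sum>k\<in>UNIV. H b j k \<bullet> H j b k"
  let ?P2 = "\<Sum>j\<in>UNIV. (norm (P j))\<^sup>2" and ?F2 = "\<Sum>j\<in>UNIV. (norm (F j))\<^sup>2"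
  define \<kappa> where "\<kappa> = 2 * \<mu> + \<mu>\<^sup>2"
  have le: "- ((\<bar>\<kappa>\<bar> / 2) * (norm (H b j k))\<^sup>2 + (\<bar>\<kappa>\<bar> / 2) * (norm (H j b k))\<^sup>2) \<le> \<kappa> * (H b j k \<bullet> H j b k)" for b j k
  proof -
    have "\<bar>\<kappa> * (H b j k \<bullet> H j b k)\<bar> \<le> (\<bar>\<kappa>\<bar> / 2) * (norm (H b j k))\<^sup>2 + (\<bar>\<kappa>\<bar> / 2) * (norm (H j b k))\<^sup>2"
      by (rule scaled_inner_bound) (auto simp: power2_eq_square)
    then show ?thesis by linarith
  qed
  have "(\<Sum>b\<in>UNIV. \<Sum>j\<in>UNIV. \<Sum>k\<in>UNIV. - ((\<bar>\<kappa>\<bar> / 2) * (norm (H b j k))\<^sup>2 + (\<bar>\<kappa>\<bar> / 2) * (norm (H j b k))\<^sup>2))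
     \<le> (\<Sum>b\<in>UNIV. \<Sum>j\<in>UNIV. \<Sum>k\<in>UNIV. \<kappa> * (H b j k \<bullet> H j b k))"
    by (intro sum_mono le)
  then have "- ((\<bar>\<kappa>\<bar> / 2) * ?A + (\<bar>\<kappa>\<bar> / 2) * (\<Sum>b\<in>UNIV. \<Sum>j\<in>UNIV. \<Sum>k\<in>UNIV. (norm (H j b k))\<^sup>2)) \<le> \<kappa> * ?B"
    by (simp only: sum_negf sum.distrib sum_distrib_left)
  moreover have "(\<Sum>b\<in>UNIV. \<Sum>j\<in>UNIV. \<Sum>k\<in>UNIV. (norm (H j b k))\<^sup>2) = ?A" by (rule sum.swap)
  ultimately have B: "- \<bar>\<kappa>\<bar> * ?A \<le> \<kappa> * ?B" by simp
  have "2 * \<mu> * (P j \<bullet> F j) \<le> ((1 - 2 * \<mu>) / 2) * (norm (P j))\<^sup>2 + (2 * \<mu>\<^sup>2 / (1 - 2 * \<mu>)) * (norm (F j))\<^sup>2" for j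
  proof -
    have aux: "4 * (t / 2) * (2 * \<mu>\<^sup>2 / t) = 4 * \<mu>\<^sup>2" if "t > 0" for t :: real using that by simp
    have "(2 * \<mu>)\<^sup>2 \<le> 4 * ((1 - 2 * \<mu>) / 2) * (2 * \<mu>\<^sup>2 / (1 - 2 * \<mu>))"
      unfolding aux[OF \<tau>] by (simp add: power_mult_distrib)
    then have "\<bar>2 * \<mu> * (P j \<bullet> F j)\<bar> \<le> ((1 - 2 * \<mu>) / 2) * (norm (P j))\<^sup>2 + (2 * \<mu>\<^sup>2 / (1 - 2 * \<mu>)) * (norm (F j))\<^sup>2"
      using \<tau> by (intro scaled_inner_bound) auto
    then show ?thesis by linarith
  qed
  then have "(\<Sum>j\<in>UNIV. 2 * \<mu> * (P j \<bullet> F j)) \<le> (\<Sum>j\<in>UNIV. ((1 - 2 * \<mu>) / 2) * (norm (P j))\<^sup>2 + (2 * \<mu>\<^sup>2 / (1 - 2 * \<mu>)) * (norm (F j))\<^sup>2)"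
    by (intro sum_mono) auto
  then have PF: "2 * \<mu> * (\<Sum>j\<in>UNIV. P j \<bullet> F j) \<le> ((1 - 2 * \<mu>) / 2) * ?P2 + (2 * \<mu>\<^sup>2 / (1 - 2 * \<mu>)) * ?F2"
    by (simp only: sum.distrib sum_distrib_left)
  have X: "(\<Sum>j\<in>UNIV. P j \<bullet> (\<Sum>k\<in>UNIV. H j k k)) = (\<Sum>j\<in>UNIV. P j \<bullet> F j) + ?P2"
    by (simp add: lap inner_add_right sum.distrib power2_norm_eq_inner)
  have "(\<Sum>b\<in>UNIV. \<Sum>k\<in>UNIV. \<Sum>j\<in>UNIV. stress \<mu> (\<lambda>b. H b j) (P j) b k \<bullet> stress \<mu> (\<lambda>b. H b k) (P k) b j)
    = ?A + \<kappa> * ?B - 2 * \<mu> * ((\<Sum>j\<in>UNIV. P j \<bullet> F j) + ?P2) + ?P2"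
    using stress_derivative_identity[of H \<mu> P, OF sym div] by (simp only: X \<kappa>_def)
  moreover have "(1 - K) * A + (1 - 2 * \<mu>) / 2 * Q - c * f \<le> L"
    if "L = A + B - 2 * \<mu> * (S + Q) + Q" "- K * A \<le> B" "2 * \<mu> * S \<le> (1 - 2 * \<mu>) / 2 * Q + c * f"
    for K A Q c f L S B :: real
    using that by (simp add: field_simps)
  ultimately show ?thesis using B PF unfolding \<kappa>_def[symmetric] by blast
qed

section \<open>The flux and the pointwise lower bound for its divergence\<close>

lemma sum_norm_stress_derivative_le:
  fixes H :: "'n::finite \<Rightarrow> 'n \<Rightarrow> 'n \<Rightarrow> 'b::real_inner"
  assumes "\<bar>\<mu>\<bar> \<le> 1"
  shows "(\<Sum>j\<in>UNIV. \<Sum>b\<in>UNIV. \<Sum>k\<in>UNIV. (norm (stress \<mu> (\<lambda>b. H b k) (P k) b j))\<^sup>2)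
    \<le> 6 * (\<Sum>b\<in>UNIV. \<Sum>j\<in>UNIV. \<Sum>k\<in>UNIV. (norm (H b j k))\<^sup>2) + 3 * real CARD('n) * (\<Sum>j\<in>UNIV. (norm (P j))\<^sup>2)"
proof -
  let ?S = "\<lambda>b j k. (norm (stress \<mu> (\<lambda>b. H b k) (P k) b j))\<^sup>2"
  have "(\<Sum>j\<in>UNIV. \<Sum>b\<in>UNIV. \<Sum>k\<in>UNIV. ?S b j k) = (\<Sum>b\<in>UNIV. \<Sum>j\<in>UNIV. \<Sum>k\<in>UNIV. ?S b j k)" by (rule sum.swap)
  also have "\<dots> = (\<Sum>b\<in>UNIV. \<Sum>k\<in>UNIV. \<Sum>j\<in>UNIV. ?S b j k)" by (rule sum.cong[OF refl sum.swap])
  also have "\<dots> = (\<Sum>k\<in>UNIV. \<Sum>b\<in>UNIV. \<Sum>j\<in>UNIV. ?S b j k)" by (rule sum.swap)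
  also have "\<dots> \<le> (\<Sum>k\<in>UNIV. 6 * (\<Sum>b\<in>UNIV. \<Sum>j\<in>UNIV. (norm (H b k j))\<^sup>2) + 3 * real CARD('n) * (norm (P k))\<^sup>2)"
    by (intro sum_mono sum_norm_stress_le assms)
  also have "\<dots> = 6 * (\<Sum>k\<in>UNIV. \<Sum>b\<in>UNIV. \<Sum>j\<in>UNIV. (norm (H b k j))\<^sup>2) + 3 * real CARD('n) * (\<Sum>j\<in>UNIV. (norm (P j))\<^sup>2)"
    by (simp only: sum.distrib sum_distrib_left)
  also have "(\<Sum>k\<in>UNIV. \<Sum>b\<in>UNIV. \<Sum>j\<in>UNIV. (norm (H b k j))\<^sup>2) = (\<Sum>b\<in>UNIV. \<Sum>k\<in>UNIV. \<Sum>j\<in>UNIV. (norm (H b k j))\<^sup>2)"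
    by (rule sum.swap)
  finally show ?thesis .
qed

lemma weighted_inner_sum_ge:
  fixes T V :: "'n::finite \<Rightarrow> 'm::finite \<Rightarrow> 'b::real_inner"
  assumes "\<And>j. (dw j)\<^sup>2 \<le> 4 * x * y" "0 \<le> x" "0 \<le> y"
  shows "- (x * (\<Sum>j\<in>UNIV. \<Sum>i\<in>UNIV. (norm (T j i))\<^sup>2) + y * (\<Sum>j\<in>UNIV. \<Sum>i\<in>UNIV. (norm (V j i))\<^sup>2))
     \<le> (\<Sum>j\<in>UNIV. dw j * (\<Sum>i\<in>UNIV. T j i \<bullet> V j i))"
    "(\<Sum>j\<in>UNIV. dw j * (\<Sum>i\<in>UNIV. T j i \<bullet> V j i))
     \<le> x * (\<Sum>j\<in>UNIV. \<Sum>i\<in>UNIV. (norm (T j i))\<^sup>2) + y * (\<Sum>j\<in>UNIV. \<Sum>i\<in>UNIV. (norm (V j i))\<^sup>2)"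
proof -
  have "\<bar>\<Sum>j\<in>UNIV. dw j * (\<Sum>i\<in>UNIV. T j i \<bullet> V j i)\<bar> \<le> (\<Sum>j\<in>UNIV. \<bar>dw j * (\<Sum>i\<in>UNIV. T j i \<bullet> V j i)\<bar>)" by (rule sum_abs)
  also have "\<dots> \<le> (\<Sum>j\<in>UNIV. \<Sum>i\<in>UNIV. \<bar>dw j * (T j i \<bullet> V j i)\<bar>)"
    by (intro sum_mono) (simp only: sum_distrib_left sum_abs)
  also have "\<dots> \<le> (\<Sum>j\<in>UNIV. \<Sum>i\<in>UNIV. x * (norm (T j i))\<^sup>2 + y * (norm (V j i))\<^sup>2)"
    by (intro sum_mono scaled_inner_bound assms)
  also have "\<dots> = x * (\<Sum>j\<in>UNIV. \<Sum>i\<in>UNIV. (norm (T j i))\<^sup>2) + y * (\<Sum>j\<in>UNIV. \<Sum>i\<in>UNIV. (norm (V j i))\<^sup>2)"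
    by (simp only: sum.distrib sum_distrib_left)
  finally have "\<bar>\<Sum>j\<in>UNIV. dw j * (\<Sum>i\<in>UNIV. T j i \<bullet> V j i)\<bar>
     \<le> x * (\<Sum>j\<in>UNIV. \<Sum>i\<in>UNIV. (norm (T j i))\<^sup>2) + y * (\<Sum>j\<in>UNIV. \<Sum>i\<in>UNIV. (norm (V j i))\<^sup>2)" .
  then show "- (x * (\<Sum>j\<in>UNIV. \<Sum>i\<in>UNIV. (norm (T j i))\<^sup>2) + y * (\<Sum>j\<in>UNIV. \<Sum>i\<in>UNIV. (norm (V j i))\<^sup>2))
     \<le> (\<Sum>j\<in>UNIV. dw j * (\<Sum>i\<in>UNIV. T j i \<bullet> V j i))"
    "(\<Sum>j\<in>UNIV. dw j * (\<Sum>i\<in>UNIV. T j i \<bullet> V j i))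
     \<le> x * (\<Sum>j\<in>UNIV. \<Sum>i\<in>UNIV. (norm (T j i))\<^sup>2) + y * (\<Sum>j\<in>UNIV. \<Sum>i\<in>UNIV. (norm (V j i))\<^sup>2)"
    by (simp_all only: abs_le_iff minus_le_iff)
qed

text \<open>
  The first two sums are \<open>\<Sum>\<^sub>b (T\<^sub>b \<bullet> \<nabla>) T\<^sub>b\<^sub>j - T\<^sub>b\<^sub>j div T\<^sub>b\<close> with \<open>div T\<^sub>b = \<lambda> u\<^sub>b\<close> inserted; their divergence is
  \<open>\<partial>\<^sub>j T\<^sub>b\<^sub>k \<bullet> \<partial>\<^sub>k T\<^sub>b\<^sub>j - |div T|\<^sup>2\<close>. The last sum is the flux that results from testing the equation with \<open>|\<lambda>| u\<close>.
  The product \<open>\<bullet>\<close> on the complex numbers is the real part of \<open>z * cnj z'\<close>.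
\<close>

definition flux ::
  "real \<Rightarrow> complex \<Rightarrow> ('n::finite \<Rightarrow> complex) \<Rightarrow> ('n \<Rightarrow> 'n \<Rightarrow> complex) \<Rightarrow> ('n \<Rightarrow> 'n \<Rightarrow> 'n \<Rightarrow> complex) \<Rightarrow>
     complex \<Rightarrow> ('n \<Rightarrow> complex) \<Rightarrow> 'n \<Rightarrow> real" where
  "flux \<mu> lam u G H \<phi> P j =
     (\<Sum>b\<in>UNIV. \<Sum>k\<in>UNIV. stress \<mu> G \<phi> b k \<bullet> stress \<mu> (\<lambda>b. H b k) (P k) b j)
     - (\<Sum>b\<in>UNIV. stress \<mu> G \<phi> b j \<bullet> (lam * u b))
     + norm lam * (\<Sum>b\<in>UNIV. u b \<bullet> stress \<mu> G \<phi> b j)"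

text \<open>
  The divergence of the flux after the equations have been used, see \<open>sum_flux_partial\<close>.
\<close>

definition flux_divergence ::
  "real \<Rightarrow> complex \<Rightarrow> ('n::finite \<Rightarrow> complex) \<Rightarrow> ('n \<Rightarrow> 'n \<Rightarrow> complex) \<Rightarrow> ('n \<Rightarrow> 'n \<Rightarrow> 'n \<Rightarrow> complex) \<Rightarrow>
     complex \<Rightarrow> ('n \<Rightarrow> complex) \<Rightarrow> real" where
  "flux_divergence \<mu> lam u G H \<phi> P =
     (\<Sum>b\<in>UNIV. \<Sum>k\<in>UNIV. \<Sum>j\<in>UNIV. stress \<mu> (\<lambda>b. H b j) (P j) b k \<bullet> stress \<mu> (\<lambda>b. H b k) (P k) b j)
     - (\<Sum>b\<in>UNIV. (norm (lam * u b))\<^sup>2)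
     + norm lam * ((\<Sum>b\<in>UNIV. u b \<bullet> (lam * u b)) + (\<Sum>b\<in>UNIV. \<Sum>k\<in>UNIV. G b k \<bullet> stress \<mu> G \<phi> b k))"

text \<open>
  The terms with a derivative of the cutoff. In those with derivatives of the stress, the factor
  \<open>dw j\<close> is split so that these derivatives carry \<open>\<epsilon> * w\<close> and can be absorbed later; the others have
  no derivative of the stress, and \<open>w \<le> 1\<close> suffices.
\<close>

lemma flux_cutoff_bound:
  fixes u P :: "'n::finite \<Rightarrow> complex"
  assumes \<mu>: "\<bar>\<mu>\<bar> \<le> 1" and \<epsilon>: "\<epsilon> > 0" and h: "h > 0" and w: "0 \<le> w" "w \<le> 1"
    and dw: "\<And>j. (dw j)\<^sup>2 \<le> 64 * w / h\<^sup>2"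
  shows "- (\<epsilon> * w * (6 * (\<Sum>b\<in>UNIV. \<Sum>j\<in>UNIV. \<Sum>k\<in>UNIV. (norm (H b j k))\<^sup>2) + 3 * real CARD('n) * (\<Sum>j\<in>UNIV. (norm (P j))\<^sup>2))
       + real CARD('n) * (norm lam)\<^sup>2 * (\<Sum>b\<in>UNIV. (norm (u b))\<^sup>2)
       + (16 * real CARD('n) / \<epsilon> + 64) / h\<^sup>2 * (6 * (\<Sum>b\<in>UNIV. \<Sum>k\<in>UNIV. (norm (G b k))\<^sup>2) + 3 * real CARD('n) * (norm \<phi>)\<^sup>2))
    \<le> (\<Sum>j\<in>UNIV. dw j * flux \<mu> lam u G H \<phi> P j)"
proof -
  define T where "T = stress \<mu> G \<phi>"
  define S where "S b j k = stress \<mu> (\<lambda>b. H b k) (P k) b j" for b j k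
  define T2 where "T2 = (\<Sum>b\<in>UNIV. \<Sum>k\<in>UNIV. (norm (T b k))\<^sup>2)"
  define F2 where "F2 = (norm lam)\<^sup>2 * (\<Sum>b\<in>UNIV. (norm (u b))\<^sup>2)"
  define A where "A = (\<Sum>b\<in>UNIV. \<Sum>j\<in>UNIV. \<Sum>k\<in>UNIV. (norm (H b j k))\<^sup>2)"
  define P2 where "P2 = (\<Sum>j\<in>UNIV. (norm (P j))\<^sup>2)"
  define TG where "TG = 6 * (\<Sum>b\<in>UNIV. \<Sum>k\<in>UNIV. (norm (G b k))\<^sup>2) + 3 * real CARD('n) * (norm \<phi>)\<^sup>2"
  have T2: "T2 \<le> TG" unfolding T2_def T_def TG_def by (rule sum_norm_stress_le[OF \<mu>])
  have S2: "(\<Sum>j\<in>UNIV. \<Sum>b\<in>UNIV. \<Sum>k\<in>UNIV. (norm (S b j k))\<^sup>2) \<le> 6 * A + 3 * real CARD('n) * P2"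
    unfolding S_def A_def P2_def by (rule sum_norm_stress_derivative_le[OF \<mu>])
  have dw1: "(dw j)\<^sup>2 \<le> 4 * (16 / (\<epsilon> * h\<^sup>2)) * (\<epsilon> * w)" for j
    using dw[of j] \<epsilon> h by (simp add: field_simps)
  have dw2: "(dw j)\<^sup>2 \<le> 4 * (32 / h\<^sup>2) * (1 / 2)" for j
  proof -
    have "64 * w / h\<^sup>2 \<le> 64 / h\<^sup>2" using w h by (intro divide_right_mono) auto
    then show ?thesis using dw[of j] by simp
  qed
  have cart: "(\<Sum>p\<in>UNIV. f (fst p) (snd p)) = (\<Sum>b\<in>UNIV. \<Sum>k\<in>UNIV. f b k)" for f :: "'n \<Rightarrow> 'n \<Rightarrow> real"
    by (simp add: sum.cartesian_product case_prod_beta UNIV_Times_UNIV[symmetric] del: UNIV_Times_UNIV)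
  have 1: "- (16 / (\<epsilon> * h\<^sup>2) * (real CARD('n) * T2) + \<epsilon> * w * (\<Sum>j\<in>UNIV. \<Sum>b\<in>UNIV. \<Sum>k\<in>UNIV. (norm (S b j k))\<^sup>2))
     \<le> (\<Sum>j\<in>UNIV. dw j * (\<Sum>b\<in>UNIV. \<Sum>k\<in>UNIV. T b k \<bullet> S b j k))"
  proof -
    have "- (16 / (\<epsilon> * h\<^sup>2) * (\<Sum>j\<in>(UNIV::'n set). \<Sum>p\<in>UNIV. (norm (T (fst p) (snd p)))\<^sup>2)
        + \<epsilon> * w * (\<Sum>j\<in>UNIV. \<Sum>p\<in>UNIV. (norm (S (fst p) j (snd p)))\<^sup>2))
      \<le> (\<Sum>j\<in>UNIV. dw j * (\<Sum>p\<in>UNIV. T (fst p) (snd p) \<bullet> S (fst p) j (snd p)))"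
      using \<epsilon> h w by (intro weighted_inner_sum_ge(1) dw1) auto
    then show ?thesis
      unfolding cart[where f = "\<lambda>b k. (norm (T b k))\<^sup>2"] cart[where f = "\<lambda>b k. (norm (S b _ k))\<^sup>2"]
        cart[where f = "\<lambda>b k. T b k \<bullet> S b _ k"] T2_def[symmetric] by simp
  qed
  have sw: "(\<Sum>j\<in>UNIV. \<Sum>b\<in>UNIV. (norm (T b j))\<^sup>2) = T2" unfolding T2_def by (rule sum.swap)
  have 2: "(\<Sum>j\<in>UNIV. dw j * (\<Sum>b\<in>UNIV. T b j \<bullet> (lam * u b))) \<le> 32 / h\<^sup>2 * T2 + 1 / 2 * (real CARD('n) * F2)"
  proof -
    have "(\<Sum>j\<in>UNIV. dw j * (\<Sum>b\<in>UNIV. T b j \<bullet> (lam * u b)))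
      \<le> 32 / h\<^sup>2 * (\<Sum>j\<in>UNIV. \<Sum>b\<in>UNIV. (norm (T b j))\<^sup>2) + 1 / 2 * (\<Sum>j\<in>(UNIV::'n set). \<Sum>b\<in>UNIV. (norm (lam * u b))\<^sup>2)"
      by (rule weighted_inner_sum_ge(2)[OF dw2]) auto
    then show ?thesis unfolding sw by (simp add: F2_def norm_mult power_mult_distrib sum_distrib_left)
  qed
  have 3: "- (1 / 2 * (real CARD('n) * F2) + 32 / h\<^sup>2 * T2) \<le> (\<Sum>j\<in>UNIV. dw j * (\<Sum>b\<in>UNIV. (norm lam *\<^sub>R u b) \<bullet> T b j))"
  proof -
    have "- (1 / 2 * (\<Sum>j\<in>(UNIV::'n set). \<Sum>b\<in>UNIV. (norm (norm lam *\<^sub>R u b))\<^sup>2) + 32 / h\<^sup>2 * (\<Sum>j\<in>UNIV. \<Sum>b\<in>UNIV. (norm (T b j))\<^sup>2))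
      \<le> (\<Sum>j\<in>UNIV. dw j * (\<Sum>b\<in>UNIV. (norm lam *\<^sub>R u b) \<bullet> T b j))"
      by (rule weighted_inner_sum_ge(1)) (use dw2 in \<open>auto simp: mult_ac\<close>)
    then show ?thesis unfolding sw by (simp add: F2_def power_mult_distrib sum_distrib_left)
  qed
  have split: "(\<Sum>j\<in>UNIV. dw j * flux \<mu> lam u G H \<phi> P j) = (\<Sum>j\<in>UNIV. dw j * (\<Sum>b\<in>UNIV. \<Sum>k\<in>UNIV. T b k \<bullet> S b j k))
     - (\<Sum>j\<in>UNIV. dw j * (\<Sum>b\<in>UNIV. T b j \<bullet> (lam * u b))) + (\<Sum>j\<in>UNIV. dw j * (\<Sum>b\<in>UNIV. (norm lam *\<^sub>R u b) \<bullet> T b j))"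
    unfolding flux_def T_def[symmetric] S_def[symmetric]
    by (simp only: sum.distrib sum_subtractf distrib_left right_diff_distrib inner_scaleR_left sum_distrib_left[symmetric])
  have T_part: "16 / (\<epsilon> * h\<^sup>2) * (real CARD('n) * T2) + 2 * (32 / h\<^sup>2 * T2) \<le> (16 * real CARD('n) / \<epsilon> + 64) / h\<^sup>2 * TG"
  proof -
    have "16 / (\<epsilon> * h\<^sup>2) * (real CARD('n) * T2) + 2 * (32 / h\<^sup>2 * T2) = (16 * real CARD('n) / \<epsilon> + 64) / h\<^sup>2 * T2"
      using \<epsilon> h by (simp add: field_simps)
    also have "\<dots> \<le> (16 * real CARD('n) / \<epsilon> + 64) / h\<^sup>2 * TG" using T2 \<epsilon> by (intro mult_left_mono) auto
    finally show ?thesis .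
  qed
  have S_part: "\<epsilon> * w * (\<Sum>j\<in>UNIV. \<Sum>b\<in>UNIV. \<Sum>k\<in>UNIV. (norm (S b j k))\<^sup>2) \<le> \<epsilon> * w * (6 * A + 3 * real CARD('n) * P2)"
    using S2 \<epsilon> w by (intro mult_left_mono) auto
  have combine: "- (sb + d * F + tt) \<le> z"
    if "z = x1 - x2 + x3" "- (a1 + s) \<le> x1" "x2 \<le> a2 + 1 / 2 * (d * F)" "- (1 / 2 * (d * F) + a2) \<le> x3" "a1 + 2 * a2 \<le> tt" "s \<le> sb"
    for z x1 x2 x3 a1 a2 s sb d F tt :: real using that by linarith
  have "- (\<epsilon> * w * (6 * A + 3 * real CARD('n) * P2) + real CARD('n) * F2 + (16 * real CARD('n) / \<epsilon> + 64) / h\<^sup>2 * TG)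
      \<le> (\<Sum>j\<in>UNIV. dw j * flux \<mu> lam u G H \<phi> P j)"
    by (rule combine[OF split 1 2 3 T_part S_part])
  then show ?thesis unfolding A_def P2_def F2_def TG_def by (simp only: mult.assoc)
qed

text \<open>
  With the factors \<open>c\<close> and \<open>C\<close>, the quantities to be estimated, localised by \<open>w\<close>, minus the data are
  bounded by the divergence of \<open>w\<close> times the flux. The premises are what holds at a point for a
  solution \<open>u\<close>, \<open>\<phi>\<close> with derivatives \<open>G\<close>, \<open>H\<close>, \<open>P\<close>, and for a cutoff \<open>w\<close> with gradient \<open>dw\<close>.
\<close>

definition pointwise_flux_bound :: "real \<Rightarrow> real \<Rightarrow> real \<Rightarrow> 'n::finite itself \<Rightarrow> bool" where
  "pointwise_flux_bound \<mu> c C _ \<longleftrightarrow> (\<forall>lam (u :: 'n \<Rightarrow> complex) G H \<phi> P w dw h.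
    0 \<le> w \<longrightarrow> w \<le> 1 \<longrightarrow> h > 0 \<longrightarrow> (\<forall>j. (dw j)\<^sup>2 \<le> 64 * w / h\<^sup>2) \<longrightarrow>
    (\<forall>b j k. H b j k = H b k j) \<longrightarrow> (\<Sum>k\<in>UNIV. G k k) = 0 \<longrightarrow> (\<forall>j. (\<Sum>k\<in>UNIV. H k j k) = 0) \<longrightarrow>
    (\<forall>b. (\<Sum>k\<in>UNIV. H b k k) = lam * u b + P b) \<longrightarrow>
    c * (w * (norm lam * (\<Sum>b\<in>UNIV. \<Sum>k\<in>UNIV. (norm (G b k))\<^sup>2)
        + (\<Sum>b\<in>UNIV. \<Sum>j\<in>UNIV. \<Sum>k\<in>UNIV. (norm (H b j k))\<^sup>2) + (\<Sum>j\<in>UNIV. (norm (P j))\<^sup>2)))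
      - C * ((norm lam)\<^sup>2 * (\<Sum>b\<in>UNIV. (norm (u b))\<^sup>2) + ((\<Sum>b\<in>UNIV. \<Sum>k\<in>UNIV. (norm (G b k))\<^sup>2) + (norm \<phi>)\<^sup>2) / h\<^sup>2)
    \<le> (\<Sum>j\<in>UNIV. dw j * flux \<mu> lam u G H \<phi> P j) + w * flux_divergence \<mu> lam u G H \<phi> P)"

text \<open>
  Half of the second-order terms in
  \<open>stress_derivative_coercive\<close> is spent on absorbing the cutoff terms, which fixes \<open>\<epsilon>\<close>.
\<close>

lemma flux_divergence_lower_bound:
  fixes \<mu> :: real
  assumes "- 1 < \<mu>" "\<mu> < sqrt 2 - 1"
  shows "\<exists>c>0. \<exists>C>0. pointwise_flux_bound \<mu> c C TYPE('n::finite)"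
proof -
  have sq2: "sqrt 2 < 3 / 2" by (rule real_less_lsqrt) (auto simp: power2_eq_square)
  define \<tau> where "\<tau> = 1 - 2 * \<mu>"
  define \<kappa> where "\<kappa> = \<bar>2 * \<mu> + \<mu>\<^sup>2\<bar>"
  define d where "d = real CARD('n)"
  have \<tau>: "\<tau> > 0" using assms sq2 by (simp add: \<tau>_def)
  have \<mu>1: "\<bar>\<mu>\<bar> < 1" using assms sq2 by linarith
  have \<kappa>: "\<kappa> < 1"
  proof -
    have "(\<mu> + 1)\<^sup>2 < (sqrt 2)\<^sup>2" using assms by (intro power_strict_mono) auto
    moreover have "(\<mu> + 1)\<^sup>2 > 0" using assms by simp
    ultimately show ?thesis unfolding \<kappa>_def by (simp add: power2_eq_square algebra_simps abs_less_iff)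
  qed
  have d: "d > 0" by (simp add: d_def)
  define \<epsilon> where "\<epsilon> = min ((1 - \<kappa>) / 12) (\<tau> / (12 * d))"
  have \<epsilon>: "\<epsilon> > 0" using \<kappa> \<tau> d by (simp add: \<epsilon>_def)
  have \<epsilon>1: "6 * \<epsilon> \<le> (1 - \<kappa>) / 2"
    using min.cobounded1[of "(1 - \<kappa>) / 12" "\<tau> / (12 * d)"] unfolding \<epsilon>_def by linarith
  have \<epsilon>2: "3 * d * \<epsilon> \<le> \<tau> / 4"
  proof -
    have "\<epsilon> \<le> \<tau> / (12 * d)" unfolding \<epsilon>_def by (rule min.cobounded2)
    then have "3 * d * \<epsilon> \<le> 3 * d * (\<tau> / (12 * d))" using d by (intro mult_left_mono) auto
    then show ?thesis using d by simp
  qed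
  define c where "c = min (min ((1 - \<kappa>) / 2) (\<tau> / 4)) (1 - \<bar>\<mu>\<bar>)"
  have c: "c > 0" "c \<le> (1 - \<kappa>) / 2" "c \<le> \<tau> / 4" "c \<le> 1 - \<bar>\<mu>\<bar>" 
  proof -
    show "c > 0" using \<kappa> \<tau> \<mu>1 by (simp add: c_def)
    have "c \<le> min ((1 - \<kappa>) / 2) (\<tau> / 4)" unfolding c_def by (rule min.cobounded1)
    then show "c \<le> (1 - \<kappa>) / 2" "c \<le> \<tau> / 4" by (simp_all only: min.bounded_iff)
    show "c \<le> 1 - \<bar>\<mu>\<bar>" unfolding c_def by (rule min.cobounded2)
  qed
  define q where "q = 16 * d / \<epsilon> + 64"
  define C1 where "C1 = 2 * \<mu>\<^sup>2 / \<tau> + 2 + d"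
  define C where "C = C1 + q * (6 + 3 * d)"
  have q: "q > 0" using \<epsilon> d by (simp add: q_def add_pos_pos)
  have C1: "C1 > 0" using \<tau> d by (simp add: C1_def add_nonneg_pos)
  have C: "C > 0" "C1 \<le> C" "q * (6 + 3 * d) \<le> C" using q C1 d by (auto simp: C_def add_pos_pos)
  show ?thesis
  proof (rule exI[of _ c], rule conjI[OF c(1)], rule exI[of _ C], rule conjI[OF C(1)], unfold pointwise_flux_bound_def, intro allI impI)
    fix lam \<phi> :: complex and u P :: "'n \<Rightarrow> complex" and G :: "'n \<Rightarrow> 'n \<Rightarrow> complex"
      and H :: "'n \<Rightarrow> 'n \<Rightarrow> 'n \<Rightarrow> complex" and w h :: real and dw :: "'n \<Rightarrow> real"
    assume w: "0 \<le> w" "w \<le> 1" and h: "h > 0" and dw: "\<forall>j. (dw j)\<^sup>2 \<le> 64 * w / h\<^sup>2"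
      and sym: "\<forall>b j k. H b j k = H b k j" and tr: "(\<Sum>k\<in>UNIV. G k k) = 0"
      and div: "\<forall>j. (\<Sum>k\<in>UNIV. H k j k) = 0" and lap: "\<forall>b. (\<Sum>k\<in>UNIV. H b k k) = lam * u b + P b"
    define U2 where "U2 = (\<Sum>b\<in>UNIV. (norm (u b))\<^sup>2)"
    define F2 where "F2 = (norm lam)\<^sup>2 * U2"
    define A where "A = (\<Sum>b\<in>UNIV. \<Sum>j\<in>UNIV. \<Sum>k\<in>UNIV. (norm (H b j k))\<^sup>2)"
    define P2 where "P2 = (\<Sum>j\<in>UNIV. (norm (P j))\<^sup>2)"
    define G2 where "G2 = (\<Sum>b\<in>UNIV. \<Sum>k\<in>UNIV. (norm (G b k))\<^sup>2)"
    define f2 where "f2 = (norm \<phi>)\<^sup>2"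
    define M where "M = (\<Sum>b\<in>UNIV. \<Sum>k\<in>UNIV. \<Sum>j\<in>UNIV. stress \<mu> (\<lambda>b. H b j) (P j) b k \<bullet> stress \<mu> (\<lambda>b. H b k) (P k) b j)"
    define E where "E = (\<Sum>b\<in>UNIV. \<Sum>k\<in>UNIV. G b k \<bullet> stress \<mu> G \<phi> b k)"
    define Y where "Y = (\<Sum>b\<in>UNIV. u b \<bullet> (lam * u b))"
    define X where "X = (\<Sum>j\<in>UNIV. dw j * flux \<mu> lam u G H \<phi> P j)"
    have nn: "U2 \<ge> 0" "F2 \<ge> 0" "A \<ge> 0" "P2 \<ge> 0" "G2 \<ge> 0" "f2 \<ge> 0"
      unfolding U2_def F2_def A_def P2_def G2_def f2_def by (auto intro!: sum_nonneg mult_nonneg_nonneg)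
    have F2': "(\<Sum>b\<in>UNIV. (norm (lam * u b))\<^sup>2) = F2"
      by (simp add: F2_def U2_def norm_mult power_mult_distrib sum_distrib_left)
    have M: "(1 - \<kappa>) * A + (\<tau> / 2) * P2 - (2 * \<mu>\<^sup>2 / \<tau>) * F2 \<le> M"
      using stress_derivative_coercive[of H "\<lambda>b. lam * u b" P \<mu>] sym div lap \<tau>
      unfolding M_def \<kappa>_def \<tau>_def A_def P2_def F2' by blast
    have E: "(1 - \<bar>\<mu>\<bar>) * G2 \<le> E" unfolding E_def G2_def using sum_inner_stress[of G \<mu> \<phi>] tr \<mu>1 by simp
    have X: "- (\<epsilon> * w * (6 * A + 3 * d * P2) + d * F2 + q / h\<^sup>2 * (6 * G2 + 3 * d * f2)) \<le> X"
      using flux_cutoff_bound[where \<epsilon> = \<epsilon> and h = h and w = w and dw = dw and \<mu> = \<mu>, OF _ \<epsilon> h w, of H P lam u G \<phi>] dw \<mu>1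
      unfolding X_def A_def P2_def F2_def U2_def G2_def f2_def d_def q_def by (simp add: mult.assoc)
    have Y: "- F2 \<le> norm lam * Y"
    proof -
      have "\<bar>Y\<bar> \<le> (\<Sum>b\<in>UNIV. norm (u b) * norm (lam * u b))" unfolding Y_def
        by (intro order_trans[OF sum_abs] sum_mono Cauchy_Schwarz_ineq2)
      also have "\<dots> = norm lam * U2" by (simp add: U2_def norm_mult sum_distrib_left power2_eq_square mult_ac)
      finally have "norm lam * \<bar>Y\<bar> \<le> norm lam * (norm lam * U2)" by (rule mult_left_mono) simp
      moreover have "norm lam * (- \<bar>Y\<bar>) \<le> norm lam * Y" by (intro mult_left_mono) auto
      ultimately show ?thesis unfolding F2_def by (simp add: power2_eq_square)
    qed
    have wM: "w * ((1 - \<kappa>) * A + (\<tau> / 2) * P2) - (2 * \<mu>\<^sup>2 / \<tau>) * F2 \<le> w * M"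
    proof -
      have "w * ((1 - \<kappa>) * A + (\<tau> / 2) * P2 - (2 * \<mu>\<^sup>2 / \<tau>) * F2) \<le> w * M" using M w by (intro mult_left_mono)
      moreover have "w * ((2 * \<mu>\<^sup>2 / \<tau>) * F2) \<le> 1 * ((2 * \<mu>\<^sup>2 / \<tau>) * F2)" using w nn \<tau> by (intro mult_right_mono) auto
      ultimately show ?thesis by (simp only: right_diff_distrib)
    qed
    have wF: "w * F2 \<le> F2" using w nn by (simp add: mult_left_le_one_le)
    have wY: "- F2 \<le> w * (norm lam * Y)"
    proof -
      have "w * (- F2) \<le> w * (norm lam * Y)" using Y w by (intro mult_left_mono)
      then show ?thesis using wF by simp
    qed
    have wE: "c * (w * (norm lam * G2)) \<le> w * (norm lam * E)"
    proof -
      have "c * G2 \<le> (1 - \<bar>\<mu>\<bar>) * G2" using c nn by (intro mult_right_mono)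
      then have "w * (norm lam * (c * G2)) \<le> w * (norm lam * E)" using E w by (intro mult_left_mono) auto
      then show ?thesis by (simp add: mult_ac)
    qed
    have wA: "c * (w * A) \<le> w * ((1 - \<kappa>) * A) - \<epsilon> * w * (6 * A)"
    proof -
      have "c * (w * A) \<le> ((1 - \<kappa>) - 6 * \<epsilon>) * (w * A)" using c \<epsilon>1 w nn by (intro mult_right_mono) auto
      then show ?thesis by (simp add: algebra_simps)
    qed
    have wP: "c * (w * P2) \<le> w * ((\<tau> / 2) * P2) - \<epsilon> * w * (3 * d * P2)"
    proof -
      have "c * (w * P2) \<le> (\<tau> / 2 - 3 * d * \<epsilon>) * (w * P2)" using c \<epsilon>2 w nn by (intro mult_right_mono) auto
      then show ?thesis by (simp add: algebra_simps)
    qed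
    have CF: "C1 * F2 \<le> C * F2" using C nn by (intro mult_right_mono)
    have CG: "q / h\<^sup>2 * (6 * G2 + 3 * d * f2) \<le> C * ((G2 + f2) / h\<^sup>2)"
    proof -
      have "6 * G2 + 3 * d * f2 \<le> (6 + 3 * d) * (G2 + f2)" using nn d by (simp add: algebra_simps)
      then have "q * (6 * G2 + 3 * d * f2) \<le> q * ((6 + 3 * d) * (G2 + f2))" using q by (intro mult_left_mono) auto
      also have "\<dots> \<le> C * (G2 + f2)" using C(3) nn by (simp only: mult.assoc[symmetric]) (intro mult_right_mono, auto)
      finally have "q * (6 * G2 + 3 * d * f2) / h\<^sup>2 \<le> C * (G2 + f2) / h\<^sup>2" by (intro divide_right_mono) auto
      then show ?thesis by simp
    qed
    have fdv: "flux_divergence \<mu> lam u G H \<phi> P = M - F2 + norm lam * (Y + E)"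
      unfolding flux_divergence_def M_def Y_def E_def F2' ..
    have fd: "w * flux_divergence \<mu> lam u G H \<phi> P = w * M - w * F2 + w * (norm lam * Y) + w * (norm lam * E)"
      unfolding fdv by (simp add: algebra_simps)
    have C1F: "C1 * F2 = (2 * \<mu>\<^sup>2 / \<tau>) * F2 + 2 * F2 + d * F2" by (simp add: C1_def distrib_right)
    have "c * (w * (norm lam * G2)) + c * (w * A) + c * (w * P2) - (C * F2 + C * ((G2 + f2) / h\<^sup>2)) \<le> X + w * flux_divergence \<mu> lam u G H \<phi> P"
      using X wM wF wY wE wA wP CF CG C1F unfolding fd distrib_left by linarith
    then have "c * (w * (norm lam * G2 + A + P2)) - C * (F2 + (G2 + f2) / h\<^sup>2) \<le> X + w * flux_divergence \<mu> lam u G H \<phi> P"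
      by (simp only: distrib_left)
    then show "c * (w * (norm lam * (\<Sum>b\<in>UNIV. \<Sum>k\<in>UNIV. (norm (G b k))\<^sup>2)
        + (\<Sum>b\<in>UNIV. \<Sum>j\<in>UNIV. \<Sum>k\<in>UNIV. (norm (H b j k))\<^sup>2) + (\<Sum>j\<in>UNIV. (norm (P j))\<^sup>2)))
      - C * ((norm lam)\<^sup>2 * (\<Sum>b\<in>UNIV. (norm (u b))\<^sup>2) + ((\<Sum>b\<in>UNIV. \<Sum>k\<in>UNIV. (norm (G b k))\<^sup>2) + (norm \<phi>)\<^sup>2) / h\<^sup>2)
    \<le> (\<Sum>j\<in>UNIV. dw j * flux \<mu> lam u G H \<phi> P j) + w * flux_divergence \<mu> lam u G H \<phi> P"
      unfolding X_def A_def P2_def F2_def U2_def G2_def f2_def .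
  qed
qed

section \<open>A cutoff function on cubes\<close>

text \<open>
  A continuously differentiable function that vanishes on the negative half line and whose derivative
  is twice its square root. The cutoff \<open>w\<close> built from it inherits a bound of this kind,
  \<open>(\<partial>\<^sub>j w)\<^sup>2 \<le> 64 w / h\<^sup>2\<close>.
\<close>

definition pos_square :: "real \<Rightarrow> real" where "pos_square t = (max 0 t)\<^sup>2"

lemma DERIV_pos_square: "(pos_square has_real_derivative 2 * max 0 t) (at t)"
proof -
  consider "t < 0" | "t > 0" | "t = 0" by linarith
  then show ?thesis
  proof cases
    case 1
    have "((\<lambda>t. 0) has_real_derivative 2 * max 0 t) (at t)" using 1 by (auto intro!: derivative_eq_intros)
    then show ?thesis
      by (rule has_field_derivative_transform_within_open[where S = "{..<0}"]) (use 1 in \<open>auto simp: pos_square_def\<close>)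
  next
    case 2
    have "((\<lambda>t. t\<^sup>2) has_real_derivative 2 * max 0 t) (at t)" using 2 by (auto intro!: derivative_eq_intros)
    then show ?thesis
      by (rule has_field_derivative_transform_within_open[where S = "{0<..}"]) (use 2 in \<open>auto simp: pos_square_def\<close>)
  next
    case 3
    have "((\<lambda>y. (pos_square y - pos_square 0) / (y - 0)) \<longlongrightarrow> 0) (at 0)"
    proof (rule Lim_null_comparison)
      show "\<forall>\<^sub>F y in at 0. norm ((pos_square y - pos_square 0) / (y - 0)) \<le> \<bar>y\<bar>"
        by (auto simp: eventually_at_filter pos_square_def max_def power2_eq_square)
      show "((\<lambda>y::real. \<bar>y\<bar>) \<longlongrightarrow> 0) (at 0)" by (rule tendsto_rabs_zero[OF tendsto_ident_at])
    qed
    then show ?thesis using 3 by (simp add: has_field_derivative_iff)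
  qed
qed

text \<open>
  The inner function is 1 on \<open>[-1, 1]\<close> and nonpositive for \<open>|s| \<ge> 3/2\<close>.
\<close>

definition bump :: "real \<Rightarrow> real" where
  "bump s = pos_square (1 - 4 * pos_square (s - 1) - 4 * pos_square (- s - 1))"

definition bump' :: "real \<Rightarrow> real" where
  "bump' s = 2 * max 0 (1 - 4 * pos_square (s - 1) - 4 * pos_square (- s - 1)) * (8 * max 0 (- s - 1) - 8 * max 0 (s - 1))"

lemma DERIV_bump: "(bump has_real_derivative bump' s) (at s)"
proof -
  let ?q = "\<lambda>s. 1 - 4 * pos_square (s - 1) - 4 * pos_square (- s - 1)"
  have a: "((\<lambda>s. pos_square (s - 1)) has_real_derivative 2 * max 0 (s - 1) * 1) (at s)"
    by (rule DERIV_chain2[OF DERIV_pos_square]) (auto intro!: derivative_eq_intros)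
  have b: "((\<lambda>s. pos_square (- s - 1)) has_real_derivative 2 * max 0 (- s - 1) * (- 1)) (at s)"
    by (rule DERIV_chain2[OF DERIV_pos_square]) (auto intro!: derivative_eq_intros)
  have "(?q has_real_derivative 0 - 4 * (2 * max 0 (s - 1) * 1) - 4 * (2 * max 0 (- s - 1) * (- 1))) (at s)"
    by (intro DERIV_diff DERIV_const DERIV_cmult a b)
  then have q: "(?q has_real_derivative 8 * max 0 (- s - 1) - 8 * max 0 (s - 1)) (at s)" by simp
  show ?thesis unfolding bump_def[abs_def] bump'_def by (rule DERIV_chain2[OF DERIV_pos_square q])
qed

lemma pos_square_nonneg: "pos_square t \<ge> 0" by (simp add: pos_square_def)

lemma bump_range: "0 \<le> bump s" "bump s \<le> 1"
proof -
  show "0 \<le> bump s" by (simp add: bump_def pos_square_nonneg)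
  have "1 - 4 * pos_square (s - 1) - 4 * pos_square (- s - 1) \<le> 1"
    using pos_square_nonneg[of "s - 1"] pos_square_nonneg[of "- s - 1"] by linarith
  then show "bump s \<le> 1" unfolding bump_def pos_square_def[of "1 - _ - _"] by (intro power_le_one) auto
qed

lemma bump_eq_1: "\<bar>s\<bar> \<le> 1 \<Longrightarrow> bump s = 1"
proof -
  assume s: "\<bar>s\<bar> \<le> 1"
  have "pos_square t = 0" if "t \<le> 0" for t using that by (simp add: pos_square_def)
  then have "pos_square (s - 1) = 0" "pos_square (- s - 1) = 0" using s by (simp_all add: abs_le_iff)
  then show "bump s = 1" by (simp add: bump_def) (simp add: pos_square_def)
qed

lemma bump_eq_0:
  assumes "\<bar>s\<bar> \<ge> 3 / 2" shows "bump s = 0"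
proof -
  have half: "pos_square t \<ge> 1 / 4" if "t \<ge> 1 / 2" for t
  proof -
    have "(1 / 2)\<^sup>2 \<le> t\<^sup>2" using that by (intro power_mono) auto
    then show ?thesis using that by (simp add: pos_square_def max_def power2_eq_square)
  qed
  have "s - 1 \<ge> 1 / 2 \<or> - s - 1 \<ge> 1 / 2" using assms by linarith
  then have "1 - 4 * pos_square (s - 1) - 4 * pos_square (- s - 1) \<le> 0"
    using half[of "s - 1"] half[of "- s - 1"] pos_square_nonneg[of "s - 1"] pos_square_nonneg[of "- s - 1"] by linarith
  then show ?thesis by (simp add: bump_def pos_square_def[of "1 - _ - _"] max_def)
qed

lemma bump'_square_le: "(bump' s)\<^sup>2 \<le> 64 * bump s"
proof -
  define q where "q = 1 - 4 * pos_square (s - 1) - 4 * pos_square (- s - 1)"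
  define m where "m = 8 * max 0 (- s - 1) - 8 * max 0 (s - 1)"
  have m: "m\<^sup>2 = 16 * (1 - q)"
    by (simp add: m_def q_def pos_square_def max_def power2_eq_square algebra_simps)
  have "(bump' s)\<^sup>2 = 4 * (max 0 q)\<^sup>2 * m\<^sup>2" by (simp add: bump'_def q_def m_def power_mult_distrib)
  also have "\<dots> \<le> 4 * (max 0 q)\<^sup>2 * 16"
  proof (cases "q \<le> 0")
    case False
    then show ?thesis unfolding m by (intro mult_left_mono) auto
  qed (simp add: max_def)
  also have "\<dots> = 64 * bump s" by (simp add: bump_def q_def pos_square_def[of "1 - _ - _"])
  finally show ?thesis .
qed

lemma continuous_on_bump': "continuous_on UNIV bump'"
  unfolding bump'_def[abs_def] pos_square_def by (intro continuous_intros)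

lemma mem_cube: "x \<in> cube c h \<longleftrightarrow> (\<forall>i. \<bar>x $ i - c $ i\<bar> < h)"
  unfolding cube_def mem_box_cart by (auto simp: vec_def abs_less_iff algebra_simps)

lemma cube_cutoff:
  fixes c :: "real^'n" and h :: real
  assumes h: "h > 0"
  obtains w dw where "\<And>x. 0 \<le> w x" "\<And>x. w x \<le> (1::real)" "\<And>x S. has_partials w (\<lambda>j. dw j x) x S"
    "\<And>j. continuous_on UNIV (dw j)" "\<And>x. x \<in> cube c h \<Longrightarrow> w x = 1"
    "\<And>x. x \<notin> cube c (3 / 2 * h) \<Longrightarrow> w x = 0" "\<And>x j. (dw j x)\<^sup>2 \<le> 64 * w x / h\<^sup>2"
proof -
  define s where "s i x = (x $ i - c $ i) / h" for i and x :: "real^'n"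
  define w where "w x = (\<Prod>i\<in>UNIV. bump (s i x))" for x
  define dw where "dw j x = bump' (s j x) / h * (\<Prod>i\<in>UNIV - {j}. bump (s i x))" for j x
  have cs: "continuous_on UNIV (s i)" for i unfolding s_def using h by (intro continuous_intros) auto
  have cb: "continuous_on UNIV bump" using DERIV_bump DERIV_isCont continuous_at_imp_continuous_on by blast
  have wj: "w x = bump (s j x) * (\<Prod>i\<in>UNIV - {j}. bump (s i x))" for x j
    unfolding w_def by (rule prod.remove) auto
  have prod01: "0 \<le> (\<Prod>i\<in>I. bump (s i x))" "(\<Prod>i\<in>I. bump (s i x)) \<le> 1" for I x
    using bump_range by (auto intro!: prod_nonneg prod_le_1)
  show ?thesis
  proof (rule that[of w dw])
    show "0 \<le> w x" "w x \<le> 1" for x unfolding w_def using prod01 by auto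
    show "has_partials w (\<lambda>j. dw j x) x S" for x S
    proof -
      have "((\<lambda>x. bump (s i x)) has_derivative (\<lambda>v. v $ i * (bump' (s i x) / h))) (at x within S)" for i
      proof -
        have "(s i has_derivative (\<lambda>v. v $ i / h)) (at x within S)"
          unfolding s_def using h
          by (auto intro!: derivative_eq_intros bounded_linear.has_derivative[OF bounded_linear_vec_nth])
        from has_derivative_compose[OF this DERIV_bump[of "s i x", unfolded has_field_derivative_def]]
        show ?thesis by (simp add: mult.commute)
      qed
      from has_derivative_prod[of UNIV "\<lambda>i x. bump (s i x)", OF this]
      show ?thesis unfolding has_partials_def w_def[abs_def] dw_def
        by (simp add: mult.assoc)
    qed
    show "continuous_on UNIV (dw j)" for j unfolding dw_def
      using h by (intro continuous_intros continuous_on_compose2[OF continuous_on_bump' cs] continuous_on_compose2[OF cb cs]) auto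
    show "w x = 1" if "x \<in> cube c h" for x
      unfolding w_def using that h by (intro prod.neutral) (auto intro!: bump_eq_1 simp: s_def mem_cube divide_simps less_imp_le)
    show "w x = 0" if x: "x \<notin> cube c (3 / 2 * h)" for x
    proof -
      obtain i where "\<not> \<bar>x $ i - c $ i\<bar> < 3 / 2 * h" using x unfolding mem_cube by blast
      then have "bump (s i x) = 0" using h by (intro bump_eq_0) (simp add: s_def field_simps)
      then show ?thesis unfolding wj[of x i] by simp
    qed
    show "(dw j x)\<^sup>2 \<le> 64 * w x / h\<^sup>2" for x j
    proof -
      let ?p = "\<Prod>i\<in>UNIV - {j}. bump (s i x)"
      have "?p\<^sup>2 \<le> ?p" using prod01[of x "UNIV - {j}"] by (simp add: power2_eq_square mult_left_le_one_le)
      then have "(bump' (s j x))\<^sup>2 * ?p\<^sup>2 \<le> (64 * bump (s j x)) * ?p"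
        using bump'_square_le bump_range prod01 by (intro mult_mono) auto
      then have "(bump' (s j x))\<^sup>2 * ?p\<^sup>2 / h\<^sup>2 \<le> 64 * w x / h\<^sup>2"
        unfolding wj[of x j] by (intro divide_right_mono) (auto simp: mult.assoc)
      then show ?thesis by (simp add: dw_def power_mult_distrib power_divide)
    qed
  qed
qed

section \<open>The divergence of the flux\<close>

lemma stress_has_partials:
  assumes "\<And>b k. has_partials (G b k) (\<lambda>i. H b i k) x S" "has_partials \<phi> P x S"
  shows "has_partials (\<lambda>y. stress \<mu> (\<lambda>b k. G b k y) (\<phi> y) b k) (\<lambda>i. stress \<mu> (\<lambda>b. H b i) (P i) b k) x S"
proof -
  have "has_partials (\<lambda>y. if b = k then \<phi> y else 0) (\<lambda>i. if b = k then P i else 0) x S"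
    using assms(2) has_partials_const[of 0 x S] by (cases "b = k") auto
  then show ?thesis unfolding stress_def
    by (intro has_partials_diff has_partials_add has_partials_scaleR assms)
qed

text \<open>
  The product rule applied to \<open>\<partial>\<^sub>i\<close> of the component \<open>j\<close> of the flux; \<open>Z b i j k\<close> stands for
  \<open>\<partial>\<^sub>i \<partial>\<^sub>j \<partial>\<^sub>k u\<^sub>b\<close> and \<open>Q i j\<close> for \<open>\<partial>\<^sub>i \<partial>\<^sub>j \<phi>\<close>.
\<close>

definition flux_partial ::
  "real \<Rightarrow> complex \<Rightarrow> ('n::finite \<Rightarrow> complex) \<Rightarrow> ('n \<Rightarrow> 'n \<Rightarrow> complex) \<Rightarrow> ('n \<Rightarrow> 'n \<Rightarrow> 'n \<Rightarrow> complex) \<Rightarrow>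
     ('n \<Rightarrow> 'n \<Rightarrow> 'n \<Rightarrow> 'n \<Rightarrow> complex) \<Rightarrow> complex \<Rightarrow> ('n \<Rightarrow> complex) \<Rightarrow> ('n \<Rightarrow> 'n \<Rightarrow> complex) \<Rightarrow> 'n \<Rightarrow> 'n \<Rightarrow> real" where
  "flux_partial \<mu> lam u G H Z \<phi> P Q j i =
     (\<Sum>b\<in>UNIV. \<Sum>k\<in>UNIV. stress \<mu> (\<lambda>b. H b i) (P i) b k \<bullet> stress \<mu> (\<lambda>b. H b k) (P k) b j
        + stress \<mu> G \<phi> b k \<bullet> stress \<mu> (\<lambda>b. Z b i k) (Q i k) b j)
     - (\<Sum>b\<in>UNIV. stress \<mu> (\<lambda>b. H b i) (P i) b j \<bullet> (lam * u b) + stress \<mu> G \<phi> b j \<bullet> (lam * G b i))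
     + norm lam * (\<Sum>b\<in>UNIV. G b i \<bullet> stress \<mu> G \<phi> b j + u b \<bullet> stress \<mu> (\<lambda>b. H b i) (P i) b j)"

lemma flux_has_partials:
  assumes u: "\<And>b. has_partials (u b) (\<lambda>i. G b i x) x S"
    and G: "\<And>b k. has_partials (G b k) (\<lambda>i. H b i k x) x S"
    and H: "\<And>b j k. has_partials (H b j k) (\<lambda>i. Z b i j k) x S"
    and \<phi>: "has_partials \<phi> (\<lambda>i. P i x) x S" and P: "\<And>j. has_partials (P j) (\<lambda>i. Q i j) x S"
  shows "has_partials (\<lambda>y. flux \<mu> lam (\<lambda>b. u b y) (\<lambda>b k. G b k y) (\<lambda>b j k. H b j k y) (\<phi> y) (\<lambda>j. P j y) j)
    (\<lambda>i. flux_partial \<mu> lam (\<lambda>b. u b x) (\<lambda>b k. G b k x) (\<lambda>b j k. H b j k x) Z (\<phi> x) (\<lambda>j. P j x) Q j i) x S"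
proof -
  have T: "has_partials (\<lambda>y. stress \<mu> (\<lambda>b k. G b k y) (\<phi> y) b k) (\<lambda>i. stress \<mu> (\<lambda>b k. H b i k x) (P i x) b k) x S" for b k
    by (rule stress_has_partials[OF G \<phi>])
  have S: "has_partials (\<lambda>y. stress \<mu> (\<lambda>b k. H b j k y) (P j y) b k) (\<lambda>i. stress \<mu> (\<lambda>b. Z b i j) (Q i j) b k) x S" for b j k
    by (rule stress_has_partials[OF H P])
  show ?thesis
    unfolding flux_def flux_partial_def
    by (intro has_partials_add has_partials_diff has_partials_sum has_partials_inner T S u
        has_partials_mult_left has_partials_bounded_linear[OF bounded_linear_mult_right])
qed

text \<open>
  Third derivatives enter only through \<open>\<partial>\<^sub>j \<partial>\<^sub>k T\<^sub>b\<^sub>j\<close>, summed over \<open>j\<close>. By symmetry this is \<open>\<partial>\<^sub>k\<close> of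
  \<open>div T\<^sub>b = \<lambda> u\<^sub>b\<close>, and the resulting terms cancel against those from differentiating \<open>\<lambda> u\<^sub>b\<close>.
\<close>

lemma sum_flux_partial:
  assumes Z: "\<And>b i j k. Z b i j k = Z b j i k" and Q: "\<And>i j. Q i j = Q j i"
    and eq1: "\<And>b. (\<Sum>j\<in>UNIV. stress \<mu> (\<lambda>b. H b j) (P j) b j) = lam * u b"
    and eq2: "\<And>b k. (\<Sum>j\<in>UNIV. stress \<mu> (\<lambda>b. Z b k j) (Q k j) b j) = lam * G b k"
  shows "(\<Sum>j\<in>UNIV. flux_partial \<mu> lam u G H Z \<phi> P Q j j) = flux_divergence \<mu> lam u G H \<phi> P"
proof -
  let ?S = "\<lambda>b i k. stress \<mu> (\<lambda>b. H b i) (P i) b k" and ?T = "stress \<mu> G \<phi>"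
  let ?R = "\<lambda>b i j k. stress \<mu> (\<lambda>b. Z b i j) (Q i j) b k"
  have R: "?R b i j k = ?R b j i k" for b i j k using Z Q by (simp add: stress_def)
  have rot: "(\<Sum>j\<in>UNIV. \<Sum>b\<in>UNIV. \<Sum>k\<in>UNIV. f b k j) = (\<Sum>b\<in>UNIV. \<Sum>k\<in>UNIV. \<Sum>j\<in>UNIV. f b k j)"
    for f :: "'a \<Rightarrow> 'a \<Rightarrow> 'a \<Rightarrow> real"
  proof -
    have "(\<Sum>j\<in>UNIV. \<Sum>b\<in>UNIV. \<Sum>k\<in>UNIV. f b k j) = (\<Sum>b\<in>UNIV. \<Sum>j\<in>UNIV. \<Sum>k\<in>UNIV. f b k j)" by (rule sum.swap)
    also have "\<dots> = (\<Sum>b\<in>UNIV. \<Sum>k\<in>UNIV. \<Sum>j\<in>UNIV. f b k j)" by (rule sum.cong[OF refl sum.swap])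
    finally show ?thesis .
  qed
  have 1: "(\<Sum>j\<in>UNIV. \<Sum>b\<in>UNIV. \<Sum>k\<in>UNIV. ?S b j k \<bullet> ?S b k j) = (\<Sum>b\<in>UNIV. \<Sum>k\<in>UNIV. \<Sum>j\<in>UNIV. ?S b j k \<bullet> ?S b k j)"
    by (rule rot)
  have 2: "(\<Sum>j\<in>UNIV. \<Sum>b\<in>UNIV. \<Sum>k\<in>UNIV. ?T b k \<bullet> ?R b j k j) = (\<Sum>b\<in>UNIV. \<Sum>k\<in>UNIV. ?T b k \<bullet> (lam * G b k))"
  proof -
    have "(\<Sum>j\<in>UNIV. ?T b k \<bullet> ?R b j k j) = ?T b k \<bullet> (lam * G b k)" for b k
    proof -
      have "(\<Sum>j\<in>UNIV. ?T b k \<bullet> ?R b j k j) = (\<Sum>j\<in>UNIV. ?T b k \<bullet> ?R b k j j)"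
        by (intro sum.cong refl arg_cong[where f = "\<lambda>z. ?T b k \<bullet> z"] R)
      then show ?thesis by (simp only: inner_sum_right[symmetric] eq2)
    qed
    then show ?thesis by (subst rot) simp
  qed
  have 3: "(\<Sum>j\<in>UNIV. \<Sum>b\<in>UNIV. ?S b j j \<bullet> (lam * u b)) = (\<Sum>b\<in>UNIV. (norm (lam * u b))\<^sup>2)"
  proof -
    have "(\<Sum>j\<in>UNIV. \<Sum>b\<in>UNIV. ?S b j j \<bullet> (lam * u b)) = (\<Sum>b\<in>UNIV. \<Sum>j\<in>UNIV. ?S b j j \<bullet> (lam * u b))" by (rule sum.swap)
    then show ?thesis by (simp only: inner_sum_left[symmetric] eq1 power2_norm_eq_inner)
  qed
  have 4: "(\<Sum>j\<in>UNIV. \<Sum>b\<in>UNIV. ?T b j \<bullet> (lam * G b j)) = (\<Sum>b\<in>UNIV. \<Sum>k\<in>UNIV. ?T b k \<bullet> (lam * G b k))" by (rule sum.swap)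
  have 5: "(\<Sum>j\<in>UNIV. \<Sum>b\<in>UNIV. G b j \<bullet> ?T b j) = (\<Sum>b\<in>UNIV. \<Sum>k\<in>UNIV. G b k \<bullet> ?T b k)" by (rule sum.swap)
  have 6: "(\<Sum>j\<in>UNIV. \<Sum>b\<in>UNIV. u b \<bullet> ?S b j j) = (\<Sum>b\<in>UNIV. u b \<bullet> (lam * u b))"
  proof -
    have "(\<Sum>j\<in>UNIV. \<Sum>b\<in>UNIV. u b \<bullet> ?S b j j) = (\<Sum>b\<in>UNIV. \<Sum>j\<in>UNIV. u b \<bullet> ?S b j j)" by (rule sum.swap)
    then show ?thesis by (simp only: inner_sum_right[symmetric] eq1)
  qed
  have "(\<Sum>j\<in>UNIV. flux_partial \<mu> lam u G H Z \<phi> P Q j j)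
    = (\<Sum>j\<in>UNIV. \<Sum>b\<in>UNIV. \<Sum>k\<in>UNIV. ?S b j k \<bullet> ?S b k j) + (\<Sum>j\<in>UNIV. \<Sum>b\<in>UNIV. \<Sum>k\<in>UNIV. ?T b k \<bullet> ?R b j k j)
      - ((\<Sum>j\<in>UNIV. \<Sum>b\<in>UNIV. ?S b j j \<bullet> (lam * u b)) + (\<Sum>j\<in>UNIV. \<Sum>b\<in>UNIV. ?T b j \<bullet> (lam * G b j)))
      + norm lam * ((\<Sum>j\<in>UNIV. \<Sum>b\<in>UNIV. G b j \<bullet> ?T b j) + (\<Sum>j\<in>UNIV. \<Sum>b\<in>UNIV. u b \<bullet> ?S b j j))"
    unfolding flux_partial_def by (simp only: sum.distrib sum_subtractf sum_distrib_left[symmetric])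
  also have "\<dots> = flux_divergence \<mu> lam u G H \<phi> P"
    unfolding 1 2 3 4 5 6 flux_divergence_def by simp
  finally show ?thesis .
qed

section \<open>The flux at the boundary\<close>

lemma stress_continuous:
  fixes G :: "'n \<Rightarrow> 'n \<Rightarrow> 'a::topological_space \<Rightarrow> complex"
  assumes "\<And>b k. continuous_on S (G b k)" "continuous_on S \<phi>"
  shows "continuous_on S (\<lambda>y. stress \<mu> (\<lambda>b k. G b k y) (\<phi> y) b k)"
proof -
  have if_cont: "continuous_on S (\<lambda>y. if b = k then \<phi> y else 0)" using assms(2) by (cases "b = k") auto
  show ?thesis unfolding stress_def by (intro continuous_on_diff continuous_on_add continuous_on_scaleR continuous_on_const if_cont assms)
qed

text \<open>
  By convexity there is a supporting normal at \<open>x\<close>, and by uniqueness it is the normalised gradient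
  of the defining function.
\<close>

lemma outward_unit_normal_supporting:
  fixes \<Omega> :: "(real^'n) set"
  assumes \<Omega>: "convex \<Omega>" "smooth_domain \<Omega>" and x: "x \<in> frontier \<Omega>" and n: "outward_unit_normal \<Omega> x \<nu>"
  shows "norm \<nu> = 1" "\<And>z. z \<in> \<Omega> \<Longrightarrow> \<nu> \<bullet> z \<le> \<nu> \<bullet> x"
    "\<And>\<mu>. norm \<mu> = 1 \<Longrightarrow> (\<And>z. z \<in> \<Omega> \<Longrightarrow> \<mu> \<bullet> z \<le> \<mu> \<bullet> x) \<Longrightarrow> \<mu> = \<nu>"
proof -
  obtain U \<rho> where \<rho>: "local_defining_function \<Omega> x U \<rho>" "\<nu> = grad \<rho> x /\<^sub>R norm (grad \<rho> x)"
    using n by (auto simp: outward_unit_normal_def)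
  have op: "open \<Omega>" "\<Omega> \<noteq> {}" using \<Omega>(2) by (auto simp: smooth_domain_def)
  have "grad \<rho> x \<noteq> 0" using \<rho>(1) by (auto simp: local_defining_function_def)
  then show n1: "norm \<nu> = 1" by (simp add: \<rho>(2))
  show uniq: "\<mu> = \<nu>" if "norm \<mu> = 1" "\<And>z. z \<in> \<Omega> \<Longrightarrow> \<mu> \<bullet> z \<le> \<mu> \<bullet> x" for \<mu>
    unfolding \<rho>(2) by (rule supporting_normal_unique[OF \<rho>(1) op(1) x that])
  have "x \<notin> \<Omega>" using x op by (simp add: frontier_def interior_open)
  then have disj: "\<Omega> \<inter> {x} = {}" by blast
  obtain a b where ab: "a \<noteq> 0" "\<forall>z\<in>\<Omega>. a \<bullet> z \<le> b" "\<forall>z\<in>{x}. b \<le> a \<bullet> z"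
    using separating_hyperplane_sets[OF \<Omega>(1) convex_singleton[of x] op(2) _ disj] by blast
  have sup: "(a /\<^sub>R norm a) \<bullet> z \<le> (a /\<^sub>R norm a) \<bullet> x" if "z \<in> \<Omega>" for z
  proof -
    have "a \<bullet> z \<le> a \<bullet> x" using ab that by force
    then show ?thesis by (simp add: mult_left_mono)
  qed
  have "a /\<^sub>R norm a = \<nu>" using ab(1) by (intro uniq sup) auto
  then show "\<nu> \<bullet> z \<le> \<nu> \<bullet> x" if "z \<in> \<Omega>" for z using sup[OF that] by metis
qed

lemma supporting_local_imp_global:
  fixes \<Omega> :: "'a::euclidean_space set"
  assumes \<Omega>: "open \<Omega>" "convex \<Omega>" and V: "open V" "x \<in> V" and x: "x \<in> frontier \<Omega>"
    and sup: "\<And>z. z \<in> V \<inter> \<Omega> \<Longrightarrow> \<nu> \<bullet> z \<le> \<nu> \<bullet> x" and z: "z \<in> \<Omega>"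
  shows "\<nu> \<bullet> z \<le> \<nu> \<bullet> x"
proof -
  have ne: "x \<noteq> z" and xc: "x \<in> closure \<Omega>" using x z \<Omega> by (auto simp: frontier_def interior_open)
  have "z \<in> interior \<Omega>" using z \<Omega> by (simp add: interior_open)
  from in_interior_closure_convex_segment[OF \<Omega>(2) this xc]
  have seg: "open_segment x z \<subseteq> \<Omega>" using interior_subset by (auto simp: open_segment_commute)
  have "((\<lambda>s. x + s *\<^sub>R (z - x)) \<longlongrightarrow> x + 0 *\<^sub>R (z - x)) (at_right 0)" by (intro tendsto_intros)
  then have "\<forall>\<^sub>F s in at_right 0. x + s *\<^sub>R (z - x) \<in> V" using V by (intro topological_tendstoD) auto
  moreover have "\<forall>\<^sub>F s in at_right (0::real). 0 < s \<and> s < 1" by (auto simp: eventually_at_right_field intro: exI[of _ 1])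
  ultimately have "\<forall>\<^sub>F s in at_right (0::real). \<nu> \<bullet> z \<le> \<nu> \<bullet> x"
  proof eventually_elim
    case (elim s)
    have "x + s *\<^sub>R (z - x) = (1 - s) *\<^sub>R x + s *\<^sub>R z" by (simp add: algebra_simps)
    then have "x + s *\<^sub>R (z - x) \<in> open_segment x z" unfolding in_segment(2) using ne elim by blast
    then have "\<nu> \<bullet> (x + s *\<^sub>R (z - x)) \<le> \<nu> \<bullet> x" using sup elim seg by blast
    then have "s * (\<nu> \<bullet> (z - x)) \<le> 0" by (simp add: inner_add_right)
    then show ?case using elim by (simp add: mult_le_0_iff inner_diff_right)
  qed
  then show ?thesis by simp
qed

text \<open>
  The rows of the stress are tangent to the boundary. Hence the terms \<open>T\<^sub>b\<^sub>j \<bullet> \<lambda> u\<^sub>b\<close> and \<open>u\<^sub>b \<bullet> T\<^sub>b\<^sub>j\<close>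
  vanish after contraction with the normal, and what is left is the second fundamental form,
  evaluated on the real and on the imaginary part of each row.
\<close>

lemma flux_normal_component_le_0:
  fixes \<Omega> :: "(real^'n) set" and G :: "'n \<Rightarrow> 'n \<Rightarrow> real^'n \<Rightarrow> complex" and n :: "real^'n \<Rightarrow> real^'n"
  assumes \<Omega>: "convex \<Omega>" "smooth_domain \<Omega>" and V: "open V" and x: "x \<in> frontier \<Omega>" "x \<in> V"
    and n: "\<And>p. p \<in> frontier \<Omega> \<inter> V \<Longrightarrow> outward_unit_normal \<Omega> p (n p)"
    and G: "\<And>b k. has_partials (G b k) (\<lambda>i. H b i k) x (V \<inter> closure \<Omega>)"
    and \<phi>: "has_partials \<phi> P x (V \<inter> closure \<Omega>)"
    and bc: "\<And>p b. p \<in> frontier \<Omega> \<inter> V \<Longrightarrow> (\<Sum>k\<in>UNIV. n p $ k *\<^sub>R stress \<mu> (\<lambda>b k. G b k p) (\<phi> p) b k) = 0"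
  shows "(\<Sum>j\<in>UNIV. n x $ j * flux \<mu> lam u (\<lambda>b k. G b k x) H (\<phi> x) P j) \<le> 0"
proof -
  have op: "open \<Omega>" "\<Omega> \<noteq> {}" using \<Omega>(2) by (auto simp: smooth_domain_def)
  define T where "T b k y = stress \<mu> (\<lambda>b k. G b k y) (\<phi> y) b k" for b k y
  define S where "S b i k = stress \<mu> (\<lambda>b. H b i) (P i) b k" for b i k
  have T: "has_partials (T b k) (\<lambda>i. S b i k) x (V \<inter> closure \<Omega>)" for b k
    unfolding T_def S_def by (rule stress_has_partials[OF G \<phi>])
  have le: "(\<Sum>j\<in>UNIV. n x $ j * (\<Sum>k\<in>UNIV. L (T b k x) * L (S b k j))) \<le> 0"
    if L: "bounded_linear L" for L :: "complex \<Rightarrow> real" and b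
  proof -
    define a where "a y = (\<chi> k. L (T b k y))" for y
    define M where "M = (\<chi> k i. L (S b i k))"
    have "has_partials (\<lambda>y. a y $ k) (\<lambda>i. L (S b i k)) x (V \<inter> closure \<Omega>)" for k
      using has_partials_bounded_linear[OF L T[of b k]] by (simp add: a_def)
    from has_partials_vector[OF this]
    have der: "(a has_derivative (\<lambda>v. M *v v)) (at x within V \<inter> closure \<Omega>)" unfolding M_def .
    have tang: "n p \<bullet> a p = 0" if p: "p \<in> frontier \<Omega> \<inter> V" for p
    proof -
      have "L (\<Sum>k\<in>UNIV. n p $ k *\<^sub>R T b k p) = 0"
        using bc[OF p, of b] linear_0[OF bounded_linear.linear[OF L]] by (simp add: T_def)
      then show ?thesis
        by (simp add: a_def inner_vec_def linear_sum[OF bounded_linear.linear[OF L]] linear_scale[OF bounded_linear.linear[OF L]])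
    qed
    have "n x \<bullet> (M *v a x) \<le> 0"
    proof (rule tangent_field_second_fundamental_form[where a' = "\<lambda>v. M *v v", OF op(1) \<Omega>(1) op(2) V x _ _ _ der])
      show "n p \<bullet> a p = 0" if "p \<in> frontier \<Omega> \<inter> V" for p using tang[OF that] .
      show "norm (n p) = 1" if "p \<in> frontier \<Omega> \<inter> V" for p
        by (rule outward_unit_normal_supporting(1)[OF \<Omega> IntD1[OF that] n[OF that]])
      show "n p \<bullet> z \<le> n p \<bullet> p" if "p \<in> frontier \<Omega> \<inter> V" "z \<in> \<Omega>" for p z
        by (rule outward_unit_normal_supporting(2)[OF \<Omega> IntD1[OF that(1)] n[OF that(1)] that(2)])
      show "\<mu> = n x" if "norm \<mu> = 1" "\<And>z. z \<in> \<Omega> \<Longrightarrow> \<mu> \<bullet> z \<le> \<mu> \<bullet> x" for \<mu>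
        by (rule outward_unit_normal_supporting(3)[OF \<Omega> x(1) n[OF IntI[OF x]] that])
    qed
    then show ?thesis by (simp add: a_def M_def inner_vec_def matrix_vector_mult_def mult.commute)
  qed
  have inner: "T b k x \<bullet> S b k j = Re (T b k x) * Re (S b k j) + Im (T b k x) * Im (S b k j)" for b k j
    by (simp add: inner_complex_def)
  have bcx: "(\<Sum>j\<in>UNIV. n x $ j *\<^sub>R T b j x) = 0" for b using bc[of x b] x by (simp add: T_def)
  have swap1: "(\<Sum>j\<in>UNIV. n x $ j * (\<Sum>b\<in>UNIV. f b j)) = (\<Sum>b\<in>UNIV. \<Sum>j\<in>UNIV. n x $ j * f b j)" for f :: "'n \<Rightarrow> 'n \<Rightarrow> real"
    unfolding sum_distrib_left by (rule sum.swap)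
  have 1: "(\<Sum>j\<in>UNIV. n x $ j * (\<Sum>b\<in>UNIV. \<Sum>k\<in>UNIV. T b k x \<bullet> S b k j)) \<le> 0"
  proof -
    have "(\<Sum>j\<in>UNIV. n x $ j * (\<Sum>k\<in>UNIV. T b k x \<bullet> S b k j)) \<le> 0" for b
      using le[OF bounded_linear_Re, of b] le[OF bounded_linear_Im, of b]
      unfolding inner sum.distrib distrib_left by simp
    then show ?thesis by (subst swap1) (rule sum_nonpos)
  qed
  have 2: "(\<Sum>j\<in>UNIV. n x $ j * (\<Sum>b\<in>UNIV. T b j x \<bullet> (lam * u b))) = 0"
  proof -
    have "(\<Sum>j\<in>UNIV. n x $ j * (T b j x \<bullet> (lam * u b))) = (\<Sum>j\<in>UNIV. n x $ j *\<^sub>R T b j x) \<bullet> (lam * u b)" for b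
      by (simp add: inner_sum_left)
    then show ?thesis by (subst swap1) (simp add: bcx)
  qed
  have 3: "(\<Sum>j\<in>UNIV. n x $ j * (\<Sum>b\<in>UNIV. u b \<bullet> T b j x)) = 0"
  proof -
    have "(\<Sum>j\<in>UNIV. n x $ j * (u b \<bullet> T b j x)) = u b \<bullet> (\<Sum>j\<in>UNIV. n x $ j *\<^sub>R T b j x)" for b
      by (simp add: inner_sum_right)
    then show ?thesis by (subst swap1) (simp add: bcx)
  qed
  have distr: "a * (p - q + l * r) = a * p - a * q + l * (a * r)" for a p q l r :: real
    by (simp add: algebra_simps)
  have "(\<Sum>j\<in>UNIV. n x $ j * flux \<mu> lam u (\<lambda>b k. G b k x) H (\<phi> x) P j)
    = (\<Sum>j\<in>UNIV. n x $ j * (\<Sum>b\<in>UNIV. \<Sum>k\<in>UNIV. T b k x \<bullet> S b k j))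
      - (\<Sum>j\<in>UNIV. n x $ j * (\<Sum>b\<in>UNIV. T b j x \<bullet> (lam * u b)))
      + norm lam * (\<Sum>j\<in>UNIV. n x $ j * (\<Sum>b\<in>UNIV. u b \<bullet> T b j x))"
    unfolding flux_def T_def S_def
    by (simp only: distr sum.distrib sum_subtractf sum_distrib_left[symmetric])
  then show ?thesis using 1 2 3 by simp
qed

lemma integrable_on_open_of_compact:
  fixes f :: "'a::euclidean_space \<Rightarrow> real"
  assumes "open D" "D \<subseteq> K" "compact K" "continuous_on K f"
  shows "set_integrable lborel D f"
proof -
  have "set_integrable lborel K f"
    unfolding set_integrable_def using borel_integrable_compact[OF assms(3,4)] by (simp add: indicator_scaleR_eq_if)
  then show ?thesis by (rule set_integrable_subset) (use assms(1,2) in auto)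
qed

section \<open>The localised estimate\<close>

lemma flux_continuous:
  fixes S :: "'a::topological_space set"
  assumes "\<And>b. continuous_on S (u b)" "\<And>b k. continuous_on S (G b k)" "\<And>b j k. continuous_on S (H b j k)"
    "continuous_on S \<phi>" "\<And>j. continuous_on S (P j)"
  shows "continuous_on S (\<lambda>y. flux \<mu> lam (\<lambda>b. u b y) (\<lambda>b k. G b k y) (\<lambda>b j k. H b j k y) (\<phi> y) (\<lambda>j. P j y) j)"
  unfolding flux_def
  by (intro continuous_on_add continuous_on_diff continuous_on_sum continuous_on_inner continuous_on_mult
      continuous_on_const stress_continuous assms)

lemma flux_partial_continuous:
  fixes S :: "'a::topological_space set"
  assumes "\<And>b. continuous_on S (u b)" "\<And>b k. continuous_on S (G b k)" "\<And>b j k. continuous_on S (H b j k)"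
    "\<And>b i j k. continuous_on S (Z b i j k)"
    "continuous_on S \<phi>" "\<And>j. continuous_on S (P j)" "\<And>i j. continuous_on S (Q i j)"
  shows "continuous_on S (\<lambda>y. flux_partial \<mu> lam (\<lambda>b. u b y) (\<lambda>b k. G b k y) (\<lambda>b j k. H b j k y)
    (\<lambda>b i j k. Z b i j k y) (\<phi> y) (\<lambda>j. P j y) (\<lambda>i j. Q i j y) j i)"
  unfolding flux_partial_def
  by (intro continuous_on_add continuous_on_diff continuous_on_sum continuous_on_inner continuous_on_mult
      continuous_on_const stress_continuous assms)

lemma cube_open_convex: "open (cube c h)" "convex (cube c h)" "bounded (cube c h)"
  by (simp_all add: cube_def open_box convex_box bounded_box)

lemma closure_cube_subset:
  assumes "h < h'" shows "closure (cube c h) \<subseteq> cube c h'"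
proof -
  have "closure (cube c h) \<subseteq> {x. \<forall>i. \<bar>x $ i - c $ i\<bar> \<le> h}"
  proof (rule closure_minimal)
    show "cube c h \<subseteq> {x. \<forall>i. \<bar>x $ i - c $ i\<bar> \<le> h}" by (auto simp: mem_cube less_imp_le)
    show "closed {x. \<forall>i. \<bar>x $ i - c $ i\<bar> \<le> h}"
      by (intro closed_Collect_all closed_Collect_le continuous_intros)
  qed
  moreover have "{x. \<forall>i. \<bar>x $ i - c $ i\<bar> \<le> h} \<subseteq> cube c h'"
    using assms unfolding mem_cube subset_iff mem_Collect_eq by (meson le_less_trans)
  ultimately show ?thesis by (rule subset_trans)
qed

definition energy_density :: "complex \<Rightarrow> (real^'n \<Rightarrow> complex^'n) \<Rightarrow> (real^'n \<Rightarrow> complex) \<Rightarrow> real^'n \<Rightarrow> real" where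
  "energy_density lam u \<phi> x = norm lam * (\<Sum>b\<in>UNIV. \<Sum>k\<in>UNIV. (norm (pd k u x $ b))\<^sup>2)
     + (\<Sum>b\<in>UNIV. \<Sum>j\<in>UNIV. \<Sum>k\<in>UNIV. (norm (pd j (pd k u) x $ b))\<^sup>2) + (\<Sum>j\<in>UNIV. (norm (pd j \<phi> x))\<^sup>2)"

definition data_density :: "complex \<Rightarrow> real \<Rightarrow> (real^'n \<Rightarrow> complex^'n) \<Rightarrow> (real^'n \<Rightarrow> complex) \<Rightarrow> real^'n \<Rightarrow> real" where
  "data_density lam h u \<phi> x = (norm lam)\<^sup>2 * (\<Sum>b\<in>UNIV. (norm (u x $ b))\<^sup>2)
     + ((\<Sum>b\<in>UNIV. \<Sum>k\<in>UNIV. (norm (pd k u x $ b))\<^sup>2) + (norm (\<phi> x))\<^sup>2) / h\<^sup>2"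

text \<open>
  The divergence inequality for \<open>w\<close> times the flux on the intermediate set
  \<open>cube c (3/2 * h) \<inter> \<Omega>\<close>. The closure of this set lies in the region where \<open>u\<close> and \<open>\<phi>\<close> extend
  smoothly, so all functions are bounded on it even if they are not on \<open>cube c (2 * h) \<inter> \<Omega>\<close>. It is
  convex, and its boundary points either carry \<open>w = 0\<close> or are boundary points of \<open>\<Omega>\<close> with the same
  supporting normals.
\<close>

proposition localised_energy_estimate:
  fixes \<Omega> :: "(real^'n) set" and n :: "real^'n \<Rightarrow> real^'n" and u :: "real^'n \<Rightarrow> complex^'n" and \<phi> :: "real^'n \<Rightarrow> complex"
  assumes key: "pointwise_flux_bound \<mu> a C TYPE('n)"
    and \<Omega>: "convex \<Omega>" "smooth_domain \<Omega>" and n: "\<And>x. x \<in> frontier \<Omega> \<Longrightarrow> outward_unit_normal \<Omega> x (n x)"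
    and h: "h > 0"
    and D: "D = cube c (2 * h) \<inter> \<Omega>"
    and su: "smooth_up_to D (cube c (2 * h) \<inter> closure \<Omega>) u" and s\<phi>: "smooth_up_to D (cube c (2 * h) \<inter> closure \<Omega>) \<phi>"
    and eq: "\<And>x. x \<in> D \<Longrightarrow> lam *s u x - laplacian u x + grad \<phi> x = 0" "\<And>x. x \<in> D \<Longrightarrow> divergence u x = 0"
    and bc: "\<And>x. x \<in> cube c (2 * h) \<inter> frontier \<Omega> \<Longrightarrow> neumann_condition \<mu> D u \<phi> (n x) x"
  obtains w where "\<And>x. 0 \<le> w x" "\<And>x. x \<in> cube c h \<Longrightarrow> w x = (1::real)"
    "set_integrable lborel (cube c (3 / 2 * h) \<inter> \<Omega>) (\<lambda>x. w x * energy_density lam u \<phi> x)"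
    "set_integrable lborel (cube c (3 / 2 * h) \<inter> \<Omega>) (data_density lam h u \<phi>)"
    "a * (LINT x:cube c (3 / 2 * h) \<inter> \<Omega>|lborel. w x * energy_density lam u \<phi> x)
       \<le> C * (LINT x:cube c (3 / 2 * h) \<inter> \<Omega>|lborel. data_density lam h u \<phi> x)"
proof -
  define V where "V = cube c (2 * h)"
  define E where "E = V \<inter> closure \<Omega>"
  define D1 where "D1 = cube c (3 / 2 * h) \<inter> \<Omega>"
  have op: "open \<Omega>" "\<Omega> \<noteq> {}" using \<Omega>(2) by (auto simp: smooth_domain_def)
  have V: "open V" "convex V" by (simp_all add: V_def cube_open_convex)
  have DV: "D = V \<inter> \<Omega>" by (simp add: D V_def)
  have Do: "open D" "convex D" using op V \<Omega>(1) by (auto simp: DV intro: convex_Int)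
  have DE: "D \<subseteq> E" using closure_subset by (auto simp: DV E_def)
  have EcD: "E \<subseteq> closure D" unfolding E_def DV using open_Int_closure_subset[OF V(1)] by blast
  have D1: "open D1" "convex D1" "bounded D1"
    using op \<Omega>(1) bounded_subset[OF cube_open_convex(3)] by (auto simp: D1_def cube_open_convex intro: convex_Int)
  have ccube: "closure (cube c (3 / 2 * h)) \<subseteq> V" unfolding V_def using h by (intro closure_cube_subset) simp
  have K: "closure D1 \<subseteq> E"
    using ccube closure_mono[of D1 "cube c (3 / 2 * h)"] closure_mono[of D1 \<Omega>] by (auto simp: D1_def E_def)
  have D1D: "D1 \<subseteq> D" using ccube closure_subset by (auto simp: D1_def DV)
  have comp: "compact (closure D1)" using D1(3) by simp
  obtain U where U: "\<And>is x. x \<in> D \<Longrightarrow> U is x = pds is u x" "\<And>is. continuous_on E (U is)"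
    "\<And>is x. x \<in> E \<Longrightarrow> has_partials (U is) (\<lambda>i. U (i # is) x) x E"
    "\<And>is i j x. x \<in> D \<Longrightarrow> U (i # j # is) x = U (j # i # is) x"
    by (rule smooth_up_to_extension[OF Do DE EcD su[folded V_def, folded E_def]]) (rule that)
  obtain F where F: "\<And>is x. x \<in> D \<Longrightarrow> F is x = pds is \<phi> x" "\<And>is. continuous_on E (F is)"
    "\<And>is x. x \<in> E \<Longrightarrow> has_partials (F is) (\<lambda>i. F (i # is) x) x E"
    "\<And>is i j x. x \<in> D \<Longrightarrow> F (i # j # is) x = F (j # i # is) x"
    by (rule smooth_up_to_extension[OF Do DE EcD s\<phi>[folded V_def, folded E_def]]) (rule that)
  obtain w dw where w: "\<And>x. 0 \<le> w x" "\<And>x. w x \<le> (1::real)" "\<And>x S. has_partials w (\<lambda>j. dw j x) x S"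
    "\<And>j. continuous_on UNIV (dw j)" "\<And>x. x \<in> cube c h \<Longrightarrow> w x = 1"
    "\<And>x. x \<notin> cube c (3 / 2 * h) \<Longrightarrow> w x = 0" "\<And>x j. (dw j x)\<^sup>2 \<le> 64 * w x / h\<^sup>2"
    by (rule cube_cutoff[OF h]) (rule that)
  define v where "v b y = U [] y $ b" for b y
  define G where "G b k y = U [k] y $ b" for b k y
  define H where "H b j k y = U [j, k] y $ b" for b j k y
  define Z where "Z b i j k y = U [i, j, k] y $ b" for b i j k y
  define p where "p y = F [] y" for y
  define P where "P j y = F [j] y" for j y
  define Q where "Q i j y = F [i, j] y" for i j y
  have cw: "continuous_on S w" for S
    unfolding continuous_on_eq_continuous_within by (intro ballI has_partials_continuous[OF w(3)])
  have cdw: "continuous_on S (dw j)" for S j by (rule continuous_on_subset[OF w(4)]) simp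
  have cU: "continuous_on E (v b)" "continuous_on E (G b k)" "continuous_on E (H b j k)" "continuous_on E (Z b i j k)"
    "continuous_on E p" "continuous_on E (P j)" "continuous_on E (Q i j)" for b i j k
    unfolding v_def G_def H_def Z_def p_def P_def Q_def
    by (rule continuous_on_component U F)+
  have hv: "has_partials (v b) (\<lambda>i. G b i x) x E" and hG: "has_partials (G b k) (\<lambda>i. H b i k x) x E"
    and hH: "has_partials (H b j k) (\<lambda>i. Z b i j k x) x E"
    and hp: "has_partials p (\<lambda>i. P i x) x E" and hP: "has_partials (P j) (\<lambda>i. Q i j x) x E"
    if "x \<in> E" for x b j k
    unfolding v_def G_def H_def Z_def p_def P_def Q_def
    by (rule has_partials_component U(3)[OF that] F(3)[OF that])+
  define fl where "fl j y = flux \<mu> lam (\<lambda>b. v b y) (\<lambda>b k. G b k y) (\<lambda>b j k. H b j k y) (p y) (\<lambda>j. P j y) j" for j y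
  define fp where "fp j i y = flux_partial \<mu> lam (\<lambda>b. v b y) (\<lambda>b k. G b k y) (\<lambda>b j k. H b j k y)
    (\<lambda>b i j k. Z b i j k y) (p y) (\<lambda>j. P j y) (\<lambda>i j. Q i j y) j i" for j i y
  have cfl: "continuous_on E (fl j)" for j unfolding fl_def by (rule flux_continuous[OF cU(1,2,3,5,6)])
  have cfp: "continuous_on E (fp j i)" for j i unfolding fp_def by (rule flux_partial_continuous[OF cU])
  have hfl: "has_partials (fl j) (\<lambda>i. fp j i x) x E" if x: "x \<in> E" for x j
    unfolding fl_def fp_def by (rule flux_has_partials[OF hv[OF x] hG[OF x] hH[OF x] hp[OF x] hP[OF x]])
  define W where "W y = (\<chi> j. w y * fl j y)" for y
  define A where "A y = (\<chi> j i. dw i y * fl j y + w y * fp j i y)" for y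
  have derW: "(W has_derivative (\<lambda>z. A x *v z)) (at x within E)" if x: "x \<in> E" for x
    unfolding A_def
  proof (rule has_partials_vector)
    fix j
    show "has_partials (\<lambda>y. W y $ j) (\<lambda>i. dw i x * fl j x + w x * fp j i x) x E"
      unfolding W_def using has_partials_mult[OF w(3) hfl[OF x]] by simp
  qed
  have cW: "continuous_on E W"
    unfolding continuous_on_eq_continuous_within by (intro ballI has_derivative_continuous[OF derW])
  have cA: "continuous_on E A" unfolding A_def
    by (intro continuous_on_vec_lambda continuous_on_add continuous_on_mult cdw cw cfl cfp)
  have bounded_A: "bounded (A ` closure D1)"
    using compact_continuous_image[OF continuous_on_subset[OF cA K] comp] compact_imp_bounded by blast
  then obtain M where M: "\<And>x. x \<in> closure D1 \<Longrightarrow> norm (A x) \<le> M" unfolding bounded_iff by auto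
  have lap: "(\<Sum>k\<in>UNIV. H b k k x) = lam * v b x + P b x" if x: "x \<in> D" for x b
  proof -
    have "(lam *s u x - laplacian u x + grad \<phi> x) $ b = 0" using eq(1)[OF x] by simp
    then show ?thesis using U(1)[OF x] F(1)[OF x]
      by (simp add: laplacian_def grad_def H_def v_def P_def algebra_simps)
  qed
  have div: "(\<Sum>k\<in>UNIV. G k k x) = 0" if x: "x \<in> D" for x
    using eq(2)[OF x] U(1)[OF x] by (simp add: divergence_def G_def)
  \<comment> \<open>The derivative of \<open>div u = 0\<close>.\<close>
  have div1: "(\<Sum>k\<in>UNIV. H k j k x) = 0" if x: "x \<in> D" for x j
    using has_partials_unique[OF has_partials_sum[OF has_partials_within[OF hG DE]] has_partials_const Do(1) x div, of j] x DE by blast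
  have symH: "H b j k x = H b k j x" if "x \<in> D" for b j k x
    using U(4)[OF that, of j k "[]"] by (simp add: H_def)
  have symZ: "Z b i j k x = Z b j i k x" if "x \<in> D" for b i j k x
    using U(4)[OF that, of i j "[k]"] by (simp add: Z_def)
  have symQ: "Q i j x = Q j i x" if "x \<in> D" for i j x
    using F(4)[OF that, of i j "[]"] by (simp add: Q_def)
  \<comment> \<open>\<open>div T\<^sub>b = \<lambda> u\<^sub>b\<close> and its derivative in direction \<open>k\<close>.\<close>
  have eq1: "(\<Sum>j\<in>UNIV. stress \<mu> (\<lambda>b k. H b j k x) (P j x) b j) = lam * v b x" if x: "x \<in> D" for x b
  proof -
    have "(\<Sum>j\<in>UNIV. H j j b x) = 0" using div1[OF x, of b] symH[OF x] by simp
    then show ?thesis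
      by (simp add: stress_def sum.distrib sum_subtractf lap[OF x] scaleR_sum_right[symmetric])
  qed
  have eq2: "(\<Sum>j\<in>UNIV. stress \<mu> (\<lambda>b l. Z b k j l x) (Q k j x) b j) = lam * G b k x" if x: "x \<in> D" for x b k
  proof (rule has_partials_unique[OF _ _ Do(1) x eq1])
    have xE: "x \<in> E" using x DE by blast
    show "has_partials (\<lambda>y. \<Sum>j\<in>UNIV. stress \<mu> (\<lambda>b k. H b j k y) (P j y) b j)
       (\<lambda>k. \<Sum>j\<in>UNIV. stress \<mu> (\<lambda>b l. Z b k j l x) (Q k j x) b j) x D"
      by (rule has_partials_within[OF has_partials_sum[OF stress_has_partials[OF hH[OF xE] hP[OF xE]]] DE])
    show "has_partials (\<lambda>y. lam * v b y) (\<lambda>k. lam * G b k x) x D"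
      by (rule has_partials_within[OF has_partials_mult_left[OF hv[OF xE]] DE])
  qed
  have trA: "trace (A x) = (\<Sum>j\<in>UNIV. dw j x * fl j x)
      + w x * flux_divergence \<mu> lam (\<lambda>b. v b x) (\<lambda>b k. G b k x) (\<lambda>b j k. H b j k x) (p x) (\<lambda>j. P j x)" if x: "x \<in> D" for x
  proof -
    have "(\<Sum>j\<in>UNIV. fp j j x) = flux_divergence \<mu> lam (\<lambda>b. v b x) (\<lambda>b k. G b k x) (\<lambda>b j k. H b j k x) (p x) (\<lambda>j. P j x)"
      unfolding fp_def by (rule sum_flux_partial[OF symZ[OF x] symQ[OF x] eq1[OF x] eq2[OF x]])
    then show ?thesis by (simp add: trace_def A_def sum.distrib sum_distrib_left[symmetric])
  qed
  \<comment> \<open>The Neumann condition says that the rows of the stress are tangent to the boundary.\<close>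
  have tang: "(\<Sum>k\<in>UNIV. n x $ k *\<^sub>R stress \<mu> (\<lambda>b k. G b k x) (p x) b k) = 0" if x: "x \<in> frontier \<Omega> \<inter> V" for x b
  proof -
    have xE: "x \<in> E" and xD: "x \<notin> D" using x op by (auto simp: E_def DV frontier_def interior_open)
    have xc: "x \<in> closure D" using xE EcD by blast
    have J: "boundary_value D (jacobi u) x = (\<chi> b k. G b k x)"
    proof (rule boundary_value_eq[OF _ _ xE DE xc xD])
      show "continuous_on E (\<lambda>y. \<chi> b k. G b k y)" by (intro continuous_on_vec_lambda cU)
      show "jacobi u y = (\<chi> b k. G b k y)" if "y \<in> D" for y
        using U(1)[OF that] by (simp add: jacobi_def G_def)
    qed
    have p: "boundary_value D \<phi> x = p x"
      by (rule boundary_value_eq[OF cU(5) _ xE DE xc xD]) (simp add: p_def F(1))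
    have "neumann_condition \<mu> D u \<phi> (n x) x" using bc[of x] x by (auto simp: V_def)
    then have "(((\<chi> b k. G b k x) + \<mu> *\<^sub>R transpose (\<chi> b k. G b k x)) *v complex_vec (n x) - p x *s complex_vec (n x)) $ b = 0"
      unfolding neumann_condition_def J p Let_def by simp
    then have "(\<Sum>k\<in>UNIV. (G b k x + \<mu> *\<^sub>R G k b x) * complex_of_real (n x $ k)) = p x * complex_of_real (n x $ b)"
      by (simp add: matrix_vector_mult_def transpose_def complex_vec_def)
    moreover have "(\<Sum>k\<in>UNIV. n x $ k *\<^sub>R stress \<mu> (\<lambda>b k. G b k x) (p x) b k)
       = (\<Sum>k\<in>UNIV. (G b k x + \<mu> *\<^sub>R G k b x) * complex_of_real (n x $ k)) - (\<Sum>k\<in>UNIV. if b = k then p x * complex_of_real (n x $ k) else 0)"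
      unfolding sum_subtractf[symmetric]
      by (intro sum.cong refl) (simp add: stress_def scaleR_conv_of_real algebra_simps)
    ultimately show ?thesis by simp
  qed
  have normal: "\<nu> \<bullet> W x \<le> 0" if x: "x \<in> frontier D1" and \<nu>: "\<And>z. z \<in> D1 \<Longrightarrow> \<nu> \<bullet> z \<le> \<nu> \<bullet> x" for x \<nu>
  proof (cases "x \<in> cube c (3 / 2 * h) \<and> \<nu> \<noteq> 0")
    case False
    then have "w x = 0 \<or> \<nu> = 0" using w(6) by blast
    then have "W x = 0 \<or> \<nu> = 0" by (auto simp: W_def vec_eq_iff)
    then show ?thesis by auto
  next
    case True
    have xcl: "x \<in> closure D1" and xnD: "x \<notin> D1" using x D1(1) by (auto simp: frontier_def interior_open)
    have xf: "x \<in> frontier \<Omega>" and xV: "x \<in> V"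
      using xcl xnD K True op by (auto simp: D1_def E_def frontier_def interior_open)
    have sup: "\<nu> \<bullet> z \<le> \<nu> \<bullet> x" if "z \<in> \<Omega>" for z
      using \<nu> True by (intro supporting_local_imp_global[OF op(1) \<Omega>(1) cube_open_convex(1) _ xf _ that]) (auto simp: D1_def)
    have nx: "\<nu> /\<^sub>R norm \<nu> = n x"
    proof (rule outward_unit_normal_supporting(3)[OF \<Omega> xf n[OF xf]])
      show "norm (\<nu> /\<^sub>R norm \<nu>) = 1" using True by simp
      show "(\<nu> /\<^sub>R norm \<nu>) \<bullet> z \<le> (\<nu> /\<^sub>R norm \<nu>) \<bullet> x" if "z \<in> \<Omega>" for z
        using sup[OF that] by (simp add: mult_left_mono)
    qed
    have "\<nu> = norm \<nu> *\<^sub>R (\<nu> /\<^sub>R norm \<nu>)" using True by simp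
    then have \<nu>n: "\<nu> = norm \<nu> *\<^sub>R n x" by (simp only: nx)
    have xE: "x \<in> E" using xcl K by blast
    have "(\<Sum>j\<in>UNIV. n x $ j * fl j x) \<le> 0"
      unfolding fl_def
    proof (rule flux_normal_component_le_0[OF \<Omega> V(1) xf xV n])
      show "has_partials (G b k) (\<lambda>i. H b i k x) x (V \<inter> closure \<Omega>)" for b k using hG[OF xE] by (simp add: E_def)
      show "has_partials p (\<lambda>j. P j x) x (V \<inter> closure \<Omega>)" using hp[OF xE] by (simp add: E_def)
    qed (use tang in auto)
    then have "w x * (norm \<nu> * (\<Sum>j\<in>UNIV. n x $ j * fl j x)) \<le> 0"
      using w(1) by (intro mult_nonneg_nonpos) (auto intro: mult_nonneg_nonpos)
    moreover have "\<nu> \<bullet> W x = w x * (norm \<nu> * (\<Sum>j\<in>UNIV. n x $ j * fl j x))"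
      by (subst \<nu>n) (simp add: W_def inner_vec_def sum_distrib_left mult_ac)
    ultimately show ?thesis by simp
  qed
  have D1E: "D1 \<subseteq> E" using K closure_subset by (rule subset_trans[rotated])
  have int_le: "(LINT x:D1|lborel. trace (A x)) \<le> 0"
  proof (rule integral_divergence_le_0[where w = W and A = A and M = M, OF D1])
    show "(W has_derivative (\<lambda>z. A x *v z)) (at x)" if x: "x \<in> D1" for x
    proof -
      have "(W has_derivative (\<lambda>z. A x *v z)) (at x within D1)"
        by (rule has_derivative_subset[OF derW[OF subsetD[OF D1E x]] D1E])
      then show ?thesis using at_within_open[OF x D1(1)] by simp
    qed
    show "continuous_on D1 A" by (rule continuous_on_subset[OF cA D1E])
    show "norm (A x) \<le> M" if "x \<in> D1" for x by (rule M[OF subsetD[OF closure_subset that]])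
    show "continuous_on (closure D1) W" by (rule continuous_on_subset[OF cW K])
    show "\<nu> \<bullet> W x \<le> 0" if "x \<in> frontier D1" "\<And>z. z \<in> D1 \<Longrightarrow> \<nu> \<bullet> z \<le> \<nu> \<bullet> x" for x \<nu>
      by (rule normal[OF that])
  qed
  define f where "f x = norm lam * (\<Sum>b\<in>UNIV. \<Sum>k\<in>UNIV. (norm (G b k x))\<^sup>2)
     + (\<Sum>b\<in>UNIV. \<Sum>j\<in>UNIV. \<Sum>k\<in>UNIV. (norm (H b j k x))\<^sup>2) + (\<Sum>j\<in>UNIV. (norm (P j x))\<^sup>2)" for x
  define g where "g x = (norm lam)\<^sup>2 * (\<Sum>b\<in>UNIV. (norm (v b x))\<^sup>2)
     + ((\<Sum>b\<in>UNIV. \<Sum>k\<in>UNIV. (norm (G b k x))\<^sup>2) + (norm (p x))\<^sup>2) / h\<^sup>2" for x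
  have fe: "f x = energy_density lam u \<phi> x" and ge: "g x = data_density lam h u \<phi> x" if "x \<in> D1" for x
    using U(1)[of x] F(1)[of x] that D1D
    by (auto simp: f_def g_def energy_density_def data_density_def v_def G_def H_def p_def P_def subset_iff)
  have cf: "continuous_on (closure D1) (\<lambda>x. w x * f x)"
    unfolding f_def by (intro continuous_intros cw continuous_on_subset[OF cU(2) K] continuous_on_subset[OF cU(3) K] continuous_on_subset[OF cU(6) K])
  have cg: "continuous_on (closure D1) g"
    unfolding g_def using h by (intro continuous_intros continuous_on_subset[OF cU(1) K] continuous_on_subset[OF cU(2) K] continuous_on_subset[OF cU(5) K]) auto
  have ctr: "continuous_on (closure D1) (\<lambda>x. trace (A x))"
    unfolding trace_def using continuous_on_subset[OF cA K] by (intro continuous_on_sum continuous_on_component)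
  note int = integrable_on_open_of_compact[OF D1(1) closure_subset comp]
  have if': "set_integrable lborel D1 (\<lambda>x. w x * f x)" and ig: "set_integrable lborel D1 g"
    by (rule int[OF cf], rule int[OF cg])
  have "(LINT x:D1|lborel. a * (w x * f x) - C * g x) \<le> (LINT x:D1|lborel. trace (A x))"
  proof (rule set_integral_mono)
    show "set_integrable lborel D1 (\<lambda>x. a * (w x * f x) - C * g x)"
      using if' ig by (intro set_integral_diff set_integrable_mult_right) auto
    show "set_integrable lborel D1 (\<lambda>x. trace (A x))" by (rule int[OF ctr])
    fix x assume "x \<in> D1"
    then have x: "x \<in> D" using D1D by blast
    show "a * (w x * f x) - C * g x \<le> trace (A x)"
      unfolding trA[OF x] fl_def f_def g_def
    proof (rule key[unfolded pointwise_flux_bound_def, rule_format, where w = "w x" and dw = "\<lambda>j. dw j x" and u = "\<lambda>b. v b x" and G = "\<lambda>b k. G b k x"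
          and H = "\<lambda>b j k. H b j k x" and P = "\<lambda>j. P j x"])
      show "0 \<le> w x" "w x \<le> 1" "h > 0" "(dw j x)\<^sup>2 \<le> 64 * w x / h\<^sup>2" for j by (rule w h)+
      show "H b j k x = H b k j x" for b j k by (rule symH[OF x])
      show "(\<Sum>k\<in>UNIV. G k k x) = 0" by (rule div[OF x])
      show "(\<Sum>k\<in>UNIV. H k j k x) = 0" for j by (rule div1[OF x])
      show "(\<Sum>k\<in>UNIV. H b k k x) = lam * v b x + P b x" for b by (rule lap[OF x])
    qed
  qed
  also have "\<dots> \<le> 0" by (rule int_le)
  also have "(LINT x:D1|lborel. a * (w x * f x) - C * g x) = a * (LINT x:D1|lborel. w x * f x) - C * (LINT x:D1|lborel. g x)"
    using if' ig by (simp add: set_integral_diff set_integrable_mult_right)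
  finally have main: "a * (LINT x:D1|lborel. w x * f x) \<le> C * (LINT x:D1|lborel. g x)" by simp
  have fe': "indicator D1 x *\<^sub>R (w x * f x) = indicator D1 x *\<^sub>R (w x * energy_density lam u \<phi> x)"
    and ge': "indicator D1 x *\<^sub>R g x = indicator D1 x *\<^sub>R data_density lam h u \<phi> x" for x
    using fe ge by (auto simp: indicator_def)
  have "set_integrable lborel D1 (\<lambda>x. w x * energy_density lam u \<phi> x)" "set_integrable lborel D1 (data_density lam h u \<phi>)"
    using if' ig by (simp_all only: set_integrable_def fe' ge')
  moreover have "a * (LINT x:D1|lborel. w x * energy_density lam u \<phi> x) \<le> C * (LINT x:D1|lborel. data_density lam h u \<phi> x)"
    using main by (simp only: set_lebesgue_integral_def fe' ge')
  ultimately show ?thesis using that[OF w(1) w(5)] by (simp only: D1_def)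
qed

section \<open>The estimate for all cubes\<close>

lemma norm_vec_square: "(norm (x :: 'a::real_normed_vector^'n))\<^sup>2 = (\<Sum>i\<in>UNIV. (norm (x $ i))\<^sup>2)"
  by (simp add: norm_vec_def L2_set_def sum_nonneg)

lemma norm_jacobi_square: "(norm (jacobi u x))\<^sup>2 = (\<Sum>b\<in>UNIV. \<Sum>k\<in>UNIV. (norm (pd k u x $ b))\<^sup>2)"
  unfolding jacobi_def by (subst norm_vec_square) (simp add: norm_vec_square)

lemma norm_grad_square: "(norm (grad \<phi> x))\<^sup>2 = (\<Sum>j\<in>UNIV. (norm (pd j \<phi> x))\<^sup>2)"
  unfolding grad_def by (subst norm_vec_square) simp

lemma norm_hessian_square:
  fixes u :: "real^'n \<Rightarrow> 'b::real_normed_vector^'n"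
  shows "(\<Sum>j\<in>UNIV. \<Sum>k\<in>UNIV. (norm (pd j (pd k u) x))\<^sup>2) = (\<Sum>b\<in>UNIV. \<Sum>j\<in>UNIV. \<Sum>k\<in>UNIV. (norm (pd j (pd k u) x $ b))\<^sup>2)"
proof -
  have "(\<Sum>j\<in>UNIV. \<Sum>k\<in>UNIV. (norm (pd j (pd k u) x))\<^sup>2) = (\<Sum>j\<in>UNIV. \<Sum>k\<in>UNIV. \<Sum>b\<in>UNIV. (norm (pd j (pd k u) x $ b))\<^sup>2)"
    by (simp only: norm_vec_square)
  also have "\<dots> = (\<Sum>j\<in>UNIV. \<Sum>b\<in>UNIV. \<Sum>k\<in>UNIV. (norm (pd j (pd k u) x $ b))\<^sup>2)"
    by (rule sum.cong[OF refl sum.swap])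
  also have "\<dots> = (\<Sum>b\<in>UNIV. \<Sum>j\<in>UNIV. \<Sum>k\<in>UNIV. (norm (pd j (pd k u) x $ b))\<^sup>2)"
    by (rule sum.swap)
  finally show ?thesis .
qed

lemma energy_density_eq:
  "energy_density lam u \<phi> x = norm lam * (norm (jacobi u x))\<^sup>2
     + (\<Sum>j\<in>UNIV. \<Sum>k\<in>UNIV. (norm (pd j (pd k u) x))\<^sup>2) + (norm (grad \<phi> x))\<^sup>2"
  by (simp only: energy_density_def norm_jacobi_square norm_hessian_square norm_grad_square)

lemma data_density_eq:
  "data_density lam h u \<phi> x = (norm lam)\<^sup>2 * (norm (u x))\<^sup>2 + 1 / h\<^sup>2 * ((norm (jacobi u x))\<^sup>2 + (norm (\<phi> x))\<^sup>2)"
  unfolding data_density_def norm_jacobi_square norm_vec_square[of "u x"] by simp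

lemma smooth_up_to_continuous:
  assumes "smooth_up_to D E f" shows "continuous_on D (pds is f)"
  using assms unfolding smooth_up_to_def smooth_on_def by (blast intro: differentiable_imp_continuous_on)

lemma diameter_cube:
  fixes c :: "real^'n"
  assumes "h > 0"
  shows "(diameter (cube c h))\<^sup>2 = 4 * h\<^sup>2 * CARD('n)"
proof -
  have ne: "box (c - vec h) (c + vec h) \<noteq> {}"
    using assms unfolding box_ne_empty by (auto simp: Basis_vec_def inner_axis vec_def)
  have "diameter (cube c h) = diameter (cbox (c - vec h) (c + vec h))"
    unfolding cube_def using diameter_closure[of "box (c - vec h) (c + vec h)"] closure_box[OF ne] by simp
  also have "\<dots> = dist (c - vec h) (c + vec h)"
    using assms by (intro diameter_cbox) (auto simp: Basis_vec_def inner_axis vec_def)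
  also have "\<dots> = norm (vec (2 * h) :: real^'n)"
    by (simp add: dist_norm norm_minus_commute vec_eq_iff) (rule arg_cong[where f = norm], simp add: vec_eq_iff)
  finally have "(diameter (cube c h))\<^sup>2 = (norm (vec (2 * h) :: real^'n))\<^sup>2" by simp
  also have "\<dots> = 4 * h\<^sup>2 * CARD('n)" by (simp add: norm_vec_square vec_def power_mult_distrib)
  finally show ?thesis .
qed

lemma set_nn_integral_eq_set_integral:
  fixes f :: "'a \<Rightarrow> real"
  assumes "set_integrable M A f" "\<And>x. 0 \<le> f x"
  shows "(\<integral>\<^sup>+x\<in>A. ennreal (f x) \<partial>M) = ennreal (LINT x:A|M. f x)"
proof -
  have "(\<integral>\<^sup>+x\<in>A. ennreal (f x) \<partial>M) = (\<integral>\<^sup>+x. ennreal (indicator A x *\<^sub>R f x) \<partial>M)"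
    by (intro nn_integral_cong) (auto simp: indicator_def)
  also have "\<dots> = ennreal (LINT x|M. indicator A x *\<^sub>R f x)"
    using assms by (intro nn_integral_eq_integral) (auto simp: set_integrable_def)
  finally show ?thesis by (simp add: set_lebesgue_integral_def)
qed

lemma nn_integral_linear_combination:
  fixes X Y :: "'a \<Rightarrow> ennreal"
  assumes "X \<in> borel_measurable M" "Y \<in> borel_measurable M"
  shows "(\<integral>\<^sup>+x. k * X x + l * Y x \<partial>M) = k * integral\<^sup>N M X + l * integral\<^sup>N M Y"
  using assms by (simp add: nn_integral_add nn_integral_cmult)

text \<open>
  The factor \<open>4 * d\<close> in the constant converts \<open>1 / h\<^sup>2\<close> into \<open>1 / R\<^sup>2\<close>, since \<open>R\<^sup>2 = 4 d h\<^sup>2\<close>.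
\<close>

theorem proposition4p12:
  fixes \<mu> \<theta> :: real
  assumes "CARD('n::finite) \<ge> 2"
    and "0 < \<theta>" "\<theta> < pi"
    and "- 1 < \<mu>" "\<mu> < sqrt 2 - 1"
  shows "\<exists>C>0. \<forall>(\<Omega> :: (real^'n) set) (n :: real^'n \<Rightarrow> real^'n) (c :: real^'n) (h :: real)
      (lam :: complex) (u :: real^'n \<Rightarrow> complex^'n) (\<phi> :: real^'n \<Rightarrow> complex).
    bounded \<Omega> \<longrightarrow> convex \<Omega> \<longrightarrow> smooth_domain \<Omega> \<longrightarrow>
    (\<forall>x\<in>frontier \<Omega>. outward_unit_normal \<Omega> x (n x)) \<longrightarrow>
    h > 0 \<longrightarrow>
    (let Q = cube c h; D = cube c (2 * h) \<inter> \<Omega>; R = diameter Q in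
      Q \<inter> \<Omega> \<noteq> {} \<longrightarrow>
      lam \<in> sector \<theta> \<longrightarrow>
      smooth_up_to D (cube c (2 * h) \<inter> closure \<Omega>) u \<longrightarrow>
      smooth_up_to D (cube c (2 * h) \<inter> closure \<Omega>) \<phi> \<longrightarrow>
      (\<forall>x\<in>D. lam *s u x - laplacian u x + grad \<phi> x = 0 \<and> divergence u x = 0) \<longrightarrow>
      (\<forall>x \<in> cube c (2 * h) \<inter> frontier \<Omega>. neumann_condition \<mu> D u \<phi> (n x) x) \<longrightarrow>
      ennreal (norm lam) * (\<integral>\<^sup>+x\<in>Q \<inter> \<Omega>. ennreal ((norm (jacobi u x))\<^sup>2) \<partial>lborel)
        + (\<integral>\<^sup>+x\<in>Q \<inter> \<Omega>. ennreal (\<Sum>j\<in>UNIV. \<Sum>k\<in>UNIV. (norm (pd j (pd k u) x))\<^sup>2) \<partial>lborel)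
        + (\<integral>\<^sup>+x\<in>Q \<inter> \<Omega>. ennreal ((norm (grad \<phi> x))\<^sup>2) \<partial>lborel)
      \<le> ennreal C *
        (ennreal ((norm lam)\<^sup>2) * (\<integral>\<^sup>+x\<in>D. ennreal ((norm (u x))\<^sup>2) \<partial>lborel)
          + ennreal (1 / R\<^sup>2) *
            (\<integral>\<^sup>+x\<in>D. ennreal ((norm (jacobi u x))\<^sup>2 + (norm (\<phi> x))\<^sup>2) \<partial>lborel)))"
proof -
  obtain a C where aC: "a > 0" "C > 0" and key: "pointwise_flux_bound \<mu> a C TYPE('n)"
    using flux_divergence_lower_bound[OF assms(4,5), where 'n = 'n] by blast
  define d where "d = real CARD('n)"
  have d: "d \<ge> 1" using assms(1) by (simp add: d_def)
  define C' where "C' = C / a * (4 * d)"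
  have C': "C' > 0" using aC d by (simp add: C'_def)
  show ?thesis
    unfolding Let_def
  proof (rule exI[of _ C'], rule conjI[OF C'], intro allI impI)
    fix \<Omega> :: "(real^'n) set" and n :: "real^'n \<Rightarrow> real^'n" and c :: "real^'n" and h :: real
      and lam :: complex and u :: "real^'n \<Rightarrow> complex^'n" and \<phi> :: "real^'n \<Rightarrow> complex"
    define D where "D = cube c (2 * h) \<inter> \<Omega>"
    define B where "B = cube c h \<inter> \<Omega>"
    define D1 where "D1 = cube c (3 / 2 * h) \<inter> \<Omega>"
    assume \<Omega>: "convex \<Omega>" "smooth_domain \<Omega>" and n: "\<forall>x\<in>frontier \<Omega>. outward_unit_normal \<Omega> x (n x)"
      and h: "h > 0"
      and su: "smooth_up_to (cube c (2 * h) \<inter> \<Omega>) (cube c (2 * h) \<inter> closure \<Omega>) u"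
      and s\<phi>: "smooth_up_to (cube c (2 * h) \<inter> \<Omega>) (cube c (2 * h) \<inter> closure \<Omega>) \<phi>"
      and eq: "\<forall>x\<in>cube c (2 * h) \<inter> \<Omega>. lam *s u x - laplacian u x + grad \<phi> x = 0 \<and> divergence u x = 0"
      and bc: "\<forall>x\<in>cube c (2 * h) \<inter> frontier \<Omega>. neumann_condition \<mu> (cube c (2 * h) \<inter> \<Omega>) u \<phi> (n x) x"
    have op: "open \<Omega>" using \<Omega>(2) by (simp add: smooth_domain_def)
    have sets: "open D" "open B" "open D1" using op by (auto simp: D_def B_def D1_def cube_open_convex)
    have sub: "B \<subseteq> D1" "D1 \<subseteq> D"
    proof -
      have "cube c h \<subseteq> cube c (3 / 2 * h)" "cube c (3 / 2 * h) \<subseteq> cube c (2 * h)"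
        using closure_cube_subset[of h "3 / 2 * h" c] closure_cube_subset[of "3 / 2 * h" "2 * h" c] h closure_subset
        by (force, force)
      then show "B \<subseteq> D1" "D1 \<subseteq> D" by (auto simp: B_def D1_def D_def)
    qed
    obtain w where w': "\<And>x. 0 \<le> w x" "\<And>x. x \<in> cube c h \<Longrightarrow> w x = (1::real)"
      "set_integrable lborel (cube c (3 / 2 * h) \<inter> \<Omega>) (\<lambda>x. w x * energy_density lam u \<phi> x)"
      "set_integrable lborel (cube c (3 / 2 * h) \<inter> \<Omega>) (data_density lam h u \<phi>)"
      "a * (LINT x:cube c (3 / 2 * h) \<inter> \<Omega>|lborel. w x * energy_density lam u \<phi> x)
         \<le> C * (LINT x:cube c (3 / 2 * h) \<inter> \<Omega>|lborel. data_density lam h u \<phi> x)"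
    proof (rule localised_energy_estimate[where a = a and C = C and \<mu> = \<mu> and lam = lam and u = u and \<phi> = \<phi>
          and \<Omega> = \<Omega> and n = n and c = c and h = h and D = D])
      show "pointwise_flux_bound \<mu> a C TYPE('n)" by (rule key)
      show "outward_unit_normal \<Omega> x (n x)" if "x \<in> frontier \<Omega>" for x by (rule bspec[OF n that])
      show "lam *s u x - laplacian u x + grad \<phi> x = 0" "divergence u x = 0" if "x \<in> D" for x
        using bspec[OF eq that[unfolded D_def]] by (rule conjunct1, rule conjunct2)
      show "neumann_condition \<mu> D u \<phi> (n x) x" if "x \<in> cube c (2 * h) \<inter> frontier \<Omega>" for x
        unfolding D_def by (rule bspec[OF bc that])
      show "smooth_up_to D (cube c (2 * h) \<inter> closure \<Omega>) u" "smooth_up_to D (cube c (2 * h) \<inter> closure \<Omega>) \<phi>"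
        unfolding D_def by (rule su, rule s\<phi>)
    qed (rule \<Omega> h D_def | (rule that; assumption))+
    note w = w'[folded D1_def]
    have e0: "0 \<le> energy_density lam u \<phi> x" and g0: "0 \<le> data_density lam h u \<phi> x" for x
      unfolding energy_density_eq data_density_eq by (simp_all add: sum_nonneg)
    have "(\<integral>\<^sup>+x\<in>B. ennreal (energy_density lam u \<phi> x) \<partial>lborel) \<le> (\<integral>\<^sup>+x\<in>D1. ennreal (w x * energy_density lam u \<phi> x) \<partial>lborel)"
      using w(2) sub by (intro nn_integral_mono) (auto simp: indicator_def B_def)
    also have "\<dots> = ennreal (LINT x:D1|lborel. w x * energy_density lam u \<phi> x)"
      using w(1,3) e0 by (intro set_nn_integral_eq_set_integral) auto
    also have "\<dots> \<le> ennreal (C / a * (LINT x:D1|lborel. data_density lam h u \<phi> x))"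
      using w(5) aC by (intro ennreal_leI) (simp add: field_simps)
    also have "\<dots> = ennreal (C / a) * (\<integral>\<^sup>+x\<in>D1. ennreal (data_density lam h u \<phi> x) \<partial>lborel)"
      using aC by (subst set_nn_integral_eq_set_integral[OF w(4) g0]) (rule ennreal_mult', simp)
    also have "\<dots> \<le> ennreal (C / a) * (\<integral>\<^sup>+x\<in>D. ennreal (data_density lam h u \<phi> x) \<partial>lborel)"
      using sub by (intro mult_left_mono nn_integral_mono) (auto simp: indicator_def)
    finally have main: "(\<integral>\<^sup>+x\<in>B. ennreal (energy_density lam u \<phi> x) \<partial>lborel)
      \<le> ennreal (C / a) * (\<integral>\<^sup>+x\<in>D. ennreal (data_density lam h u \<phi> x) \<partial>lborel)" .
    have cont: "continuous_on D (pds is u)" "continuous_on D (pds is \<phi>)" for "is"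
      using smooth_up_to_continuous[OF su] smooth_up_to_continuous[OF s\<phi>] by (simp_all add: D_def)
    have cu: "continuous_on D u" and c\<phi>: "continuous_on D \<phi>" using cont[of "[]"] by simp_all
    have cuk: "continuous_on D (pd k u)" and c\<phi>k: "continuous_on D (pd k \<phi>)" for k using cont[of "[k]"] by simp_all
    have cujk: "continuous_on D (pd j (pd k u))" for j k using cont(1)[of "[j, k]"] by simp
    have cJ: "continuous_on D (\<lambda>x. (norm (jacobi u x))\<^sup>2)"
      unfolding norm_jacobi_square by (intro continuous_intros cuk)
    have cG: "continuous_on D (\<lambda>x. (norm (grad \<phi> x))\<^sup>2)"
      unfolding norm_grad_square by (intro continuous_intros c\<phi>k)
    have cH: "continuous_on D (\<lambda>x. \<Sum>j\<in>UNIV. \<Sum>k\<in>UNIV. (norm (pd j (pd k u) x))\<^sup>2)"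
      by (intro continuous_intros cujk)
    have cu2: "continuous_on D (\<lambda>x. (norm (u x))\<^sup>2)" by (intro continuous_intros cu)
    have cJ\<phi>: "continuous_on D (\<lambda>x. (norm (jacobi u x))\<^sup>2 + (norm (\<phi> x))\<^sup>2)" by (intro continuous_intros cJ c\<phi>)
    have meas: "(\<lambda>x. ennreal (f x) * indicator S x) \<in> borel_measurable lborel"
      if "continuous_on D f" "S \<subseteq> D" "open S" for f :: "real^'n \<Rightarrow> real" and S
    proof -
      have "(\<lambda>x. indicator S x *\<^sub>R f x) \<in> borel_measurable borel"
        using that continuous_on_subset by (intro borel_measurable_continuous_on_indicator) auto
      then have "(\<lambda>x. ennreal (indicator S x *\<^sub>R f x)) \<in> borel_measurable lborel" by simp
      moreover have "(\<lambda>x. ennreal (indicator S x *\<^sub>R f x)) = (\<lambda>x. ennreal (f x) * indicator S x)"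
        by (auto simp: fun_eq_iff indicator_def)
      ultimately show ?thesis by simp
    qed
    have BD: "B \<subseteq> D" using sub by blast
    have lhs: "ennreal (norm lam) * (\<integral>\<^sup>+x\<in>B. ennreal ((norm (jacobi u x))\<^sup>2) \<partial>lborel)
        + (\<integral>\<^sup>+x\<in>B. ennreal (\<Sum>j\<in>UNIV. \<Sum>k\<in>UNIV. (norm (pd j (pd k u) x))\<^sup>2) \<partial>lborel)
        + (\<integral>\<^sup>+x\<in>B. ennreal ((norm (grad \<phi> x))\<^sup>2) \<partial>lborel)
      = (\<integral>\<^sup>+x\<in>B. ennreal (energy_density lam u \<phi> x) \<partial>lborel)"
    proof -
      have "(\<integral>\<^sup>+x\<in>B. ennreal (energy_density lam u \<phi> x) \<partial>lborel)
        = (\<integral>\<^sup>+x. ennreal (norm lam) * (ennreal ((norm (jacobi u x))\<^sup>2) * indicator B x)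
            + ennreal (\<Sum>j\<in>UNIV. \<Sum>k\<in>UNIV. (norm (pd j (pd k u) x))\<^sup>2) * indicator B x
            + ennreal ((norm (grad \<phi> x))\<^sup>2) * indicator B x \<partial>lborel)"
        unfolding energy_density_eq
        by (intro nn_integral_cong) (simp add: ennreal_plus ennreal_mult' sum_nonneg distrib_right mult.assoc del: sum_ennreal)
      then show ?thesis
        using meas[OF cJ BD sets(2)] meas[OF cH BD sets(2)] meas[OF cG BD sets(2)]
        by (simp only:) (subst nn_integral_add, simp_all add: nn_integral_add nn_integral_cmult)
    qed
    have rhs: "(\<integral>\<^sup>+x\<in>D. ennreal (data_density lam h u \<phi> x) \<partial>lborel)
      = ennreal ((norm lam)\<^sup>2) * (\<integral>\<^sup>+x\<in>D. ennreal ((norm (u x))\<^sup>2) \<partial>lborel)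
        + ennreal (1 / h\<^sup>2) * (\<integral>\<^sup>+x\<in>D. ennreal ((norm (jacobi u x))\<^sup>2 + (norm (\<phi> x))\<^sup>2) \<partial>lborel)"
    proof -
      have "(\<integral>\<^sup>+x\<in>D. ennreal (data_density lam h u \<phi> x) \<partial>lborel)
        = (\<integral>\<^sup>+x. ennreal ((norm lam)\<^sup>2) * (ennreal ((norm (u x))\<^sup>2) * indicator D x)
            + ennreal (1 / h\<^sup>2) * (ennreal ((norm (jacobi u x))\<^sup>2 + (norm (\<phi> x))\<^sup>2) * indicator D x) \<partial>lborel)"
      proof (intro nn_integral_cong)
        fix x
        have "ennreal (p * q + r * s) * i = ennreal p * (ennreal q * i) + ennreal r * (ennreal s * i)"
          if "p \<ge> 0" "q \<ge> 0" "r \<ge> 0" "s \<ge> 0" for p q r s :: real and i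
          using that by (simp add: ennreal_plus ennreal_mult distrib_right mult.assoc)
        then show "ennreal (data_density lam h u \<phi> x) * indicator D x
          = ennreal ((norm lam)\<^sup>2) * (ennreal ((norm (u x))\<^sup>2) * indicator D x)
            + ennreal (1 / h\<^sup>2) * (ennreal ((norm (jacobi u x))\<^sup>2 + (norm (\<phi> x))\<^sup>2) * indicator D x)"
          unfolding data_density_eq by (metis zero_le_power2 add_nonneg_nonneg zero_le_divide_1_iff)
      qed
      then show ?thesis
        by (simp only: nn_integral_linear_combination[OF meas[OF cu2 order_refl sets(1)] meas[OF cJ\<phi> order_refl sets(1)]])
    qed
    let ?X = "ennreal ((norm lam)\<^sup>2) * (\<integral>\<^sup>+x\<in>D. ennreal ((norm (u x))\<^sup>2) \<partial>lborel)"
    let ?Y = "\<integral>\<^sup>+x\<in>D. ennreal ((norm (jacobi u x))\<^sup>2 + (norm (\<phi> x))\<^sup>2) \<partial>lborel"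
    let ?R = "diameter (cube c h)"
    have "1 / h\<^sup>2 = 4 * d * (1 / ?R\<^sup>2)" using h d by (simp add: diameter_cube[OF h] d_def)
    then have "ennreal (1 / h\<^sup>2) = ennreal (4 * d) * ennreal (1 / ?R\<^sup>2)" using d by (simp only:) (rule ennreal_mult'; simp)
    moreover have "?X \<le> ennreal (4 * d) * ?X"
    proof -
      have "1 * ?X \<le> ennreal (4 * d) * ?X" using d by (intro mult_right_mono) (auto simp: ennreal_1[symmetric] simp del: ennreal_1)
      then show ?thesis by simp
    qed
    ultimately have "?X + ennreal (1 / h\<^sup>2) * ?Y \<le> ennreal (4 * d) * (?X + ennreal (1 / ?R\<^sup>2) * ?Y)"
      unfolding distrib_left mult.assoc[symmetric] by (intro add_mono) (auto simp: mult.assoc)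
    then have "ennreal (C / a) * (?X + ennreal (1 / h\<^sup>2) * ?Y) \<le> ennreal (C / a) * (ennreal (4 * d) * (?X + ennreal (1 / ?R\<^sup>2) * ?Y))"
      by (intro mult_left_mono) auto
    also have "\<dots> = ennreal C' * (?X + ennreal (1 / ?R\<^sup>2) * ?Y)"
    proof -
      have "ennreal C' = ennreal (C / a) * ennreal (4 * d)" unfolding C'_def using aC by (intro ennreal_mult') simp
      then show ?thesis by (simp only: mult.assoc)
    qed
    finally show "ennreal (norm lam) * (\<integral>\<^sup>+x\<in>cube c h \<inter> \<Omega>. ennreal ((norm (jacobi u x))\<^sup>2) \<partial>lborel)
        + (\<integral>\<^sup>+x\<in>cube c h \<inter> \<Omega>. ennreal (\<Sum>j\<in>UNIV. \<Sum>k\<in>UNIV. (norm (pd j (pd k u) x))\<^sup>2) \<partial>lborel)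
        + (\<integral>\<^sup>+x\<in>cube c h \<inter> \<Omega>. ennreal ((norm (grad \<phi> x))\<^sup>2) \<partial>lborel)
      \<le> ennreal C' *
        (ennreal ((norm lam)\<^sup>2) * (\<integral>\<^sup>+x\<in>cube c (2 * h) \<inter> \<Omega>. ennreal ((norm (u x))\<^sup>2) \<partial>lborel)
          + ennreal (1 / (diameter (cube c h))\<^sup>2) *
            (\<integral>\<^sup>+x\<in>cube c (2 * h) \<inter> \<Omega>. ennreal ((norm (jacobi u x))\<^sup>2 + (norm (\<phi> x))\<^sup>2) \<partial>lborel))"
      using main unfolding lhs[symmetric] rhs unfolding B_def D_def by (rule order_trans[rotated])
  qed
qed

end
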